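(* Let $G$ be a countably infinite group and let $\Gamma$ be either the alternating enrichment $\mathscr{A}(G)$ or the elementary enrichment $\mathscr{E}(G)$ of $G$ (over a fixed finite field $F$). Let the normal subgroup $N\lhd\Gamma$ be $\mathrm{Alt}_{\mathrm{fin}}(G)$ or $\mathrm{SL}_{\mathrm{fin}}(V_G)$, respectively. If $G$ is ICC then $$\mathrm{Ch}(\Gamma)\cong\big(\mathrm{Ch}(G)\sqcup\mathrm{Ch}(N)\big)/\big(\delta_e^G\sim 1_N\big).$$ If $G$ is not ICC then $$\mathrm{Ch}(\Gamma)\cong\mathrm{Ch}(G)\sqcup\big(\mathrm{Ch}(N)\setminus\{1_N\}\big).$$ These identifications are homeomorphisms of topological spaces.
   Context: A trace on a countable group $G$ is a positive-definite, conjugation-invariant function $\varphi:G\to\mathbb{C}$ with $\varphi(e)=1$. The convex set $\mathrm{Tr}(G)$ of traces is compact in the topology of pointwise convergence. Its extreme points are called characters; $\mathrm{Ch}(G)\subset\mathrm{Tr}(G)$ denotes the space of characters with the topology of pointwise convergence. $\delta_e^G$ is the function on $G$ equal to $1$ at $e$ and $0$ elsewhere, and $1_N$ is the constant function $1$ on $N$. A group is ICC if every conjugacy class other than $\{e\}$ is infinite. $\sqcup$ denotes topological disjoint union, and $/(\delta_e^G\sim1_N)$ the quotient identifying these two points. $\mathrm{Alt}_{\mathrm{fin}}(G)$ is the group of finitely supported even permutations of the underlying set of $G$. The alternating enrichment is $\mathscr{A}(G)=G\ltimes\mathrm{Alt}_{\mathrm{fin}}(G)$, where $G$ acts on $\mathrm{Alt}_{\mathrm{fin}}(G)$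 via conjugation by the left multiplication action of $G$ on itself. Fix a finite field $F$. $V_G$ is the $F$-vector space with basis indexed by the set $G$. $\mathrm{SL}_{\mathrm{fin}}(V_G)$ is the group of linear automorphisms of $V_G$ whose matrix in this basis differs from the identity matrix in only finitely many entries and which have determinant $1$ (equivalently, the direct limit of the groups $\mathrm{SL}(V_X)$ over finite subsets $X\subset G$). The elementary enrichment is $\mathscr{E}(G)=G\ltimes\mathrm{SL}_{\mathrm{fin}}(V_G)$, where $G$ acts via conjugation by the left regular representation (left multiplication permuting the basis). *)

theory Defs
  imports "HOL-Analysis.Analysis" "HOL-Library.Nonpos_Ints" "HOL-Algebra.Bij"
begin

section \<open>Traces and characters\<close>

definition positive_definite :: "('a, 'm) monoid_scheme \<Rightarrow> ('a \<Rightarrow> complex) \<Rightarrow> bool" where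
  "positive_definite G \<phi> \<longleftrightarrow>
     (\<forall>S c. finite S \<longrightarrow> S \<subseteq> carrier G \<longrightarrow>
        (\<Sum>x\<in>S. \<Sum>y\<in>S. cnj (c x) * c y * \<phi> (inv\<^bsub>G\<^esub> x \<otimes>\<^bsub>G\<^esub> y)) \<in> \<real>\<^sub>\<ge>\<^sub>0)"

text \<open>A function on the group is represented by its extensional representative, which is
  \<open>undefined\<close> off the carrier, so that equality of functions is equality on the group.\<close>

definition traces :: "('a, 'm) monoid_scheme \<Rightarrow> ('a \<Rightarrow> complex) set" where
  "traces G = {\<phi> \<in> extensional (carrier G).
     positive_definite G \<phi> \<and>
     (\<forall>g\<in>carrier G. \<forall>h\<in>carrier G. \<phi> (h \<otimes>\<^bsub>G\<^esub> g \<otimes>\<^bsub>G\<^esub> inv\<^bsub>G\<^esub> h) = \<phi> g) \<and>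
     \<phi> \<one>\<^bsub>G\<^esub> = 1}"

text \<open>The extreme points of the set of traces. The library's \<open>extreme_point_of\<close> needs a real vector
  space type, which a function type is not, so it is spelled out pointwise.\<close>

definition characters :: "('a, 'm) monoid_scheme \<Rightarrow> ('a \<Rightarrow> complex) set" where
  "characters G = {\<phi> \<in> traces G.
     \<not> (\<exists>\<psi>\<in>traces G. \<exists>\<theta>\<in>traces G. \<psi> \<noteq> \<theta> \<and>
         (\<exists>t::real. 0 < t \<and> t < 1 \<and>
            (\<forall>g\<in>carrier G. \<phi> g = of_real (1 - t) * \<psi> g + of_real t * \<theta> g)))}"

definition character_space :: "('a, 'm) monoid_scheme \<Rightarrow> ('a \<Rightarrow> complex) topology" where
  "character_space G =
     subtopology (product_topology (\<lambda>_. euclidean) (carrier G)) (characters G)"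

definition delta_one :: "('a, 'm) monoid_scheme \<Rightarrow> 'a \<Rightarrow> complex" where
  "delta_one G = (\<lambda>g\<in>carrier G. if g = \<one>\<^bsub>G\<^esub> then 1 else 0)"

definition const_one :: "('a, 'm) monoid_scheme \<Rightarrow> 'a \<Rightarrow> complex" where
  "const_one G = (\<lambda>g\<in>carrier G. 1)"

definition icc :: "('a, 'm) monoid_scheme \<Rightarrow> bool" where
  "icc G \<longleftrightarrow>
     (\<forall>g\<in>carrier G. g \<noteq> \<one>\<^bsub>G\<^esub> \<longrightarrow>
        infinite ((\<lambda>h. h \<otimes>\<^bsub>G\<^esub> g \<otimes>\<^bsub>G\<^esub> inv\<^bsub>G\<^esub> h) ` carrier G))"


section \<open>Disjoint union of two spaces and identification of two points\<close>

text \<open>A version of \<open>sum_topology\<close> for two spaces whose points have different types.\<close>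

definition disjoint_union_topology :: "'a topology \<Rightarrow> 'b topology \<Rightarrow> ('a + 'b) topology" where
  "disjoint_union_topology X Y =
     topology (\<lambda>U. U \<subseteq> topspace X <+> topspace Y \<and> openin X (Inl -` U) \<and> openin Y (Inr -` U))"

lemma openin_disjoint_union_topology:
  "openin (disjoint_union_topology X Y) U \<longleftrightarrow>
     U \<subseteq> topspace X <+> topspace Y \<and> openin X (Inl -` U) \<and> openin Y (Inr -` U)"
proof -
  have "istopology (\<lambda>U. U \<subseteq> topspace X <+> topspace Y \<and> openin X (Inl -` U) \<and> openin Y (Inr -` U))"
    unfolding istopology_def by (auto simp: vimage_Union)
  then show ?thesis
    by (simp add: disjoint_union_topology_def)
qed

text \<open>The quotient of \<open>X\<close> by the smallest equivalence relation identifying the points \<open>a\<close> and \<open>b\<close>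
  of \<open>X\<close>, with the quotient topology on the set of equivalence classes.\<close>

definition identify_rel :: "'a set \<Rightarrow> 'a \<Rightarrow> 'a \<Rightarrow> ('a \<times> 'a) set" where
  "identify_rel S a b = Id_on S \<union> {(a, b), (b, a)}"

definition identify_points :: "'a topology \<Rightarrow> 'a \<Rightarrow> 'a \<Rightarrow> 'a set topology" where
  "identify_points X a b =
     topology (\<lambda>U. U \<subseteq> topspace X // identify_rel (topspace X) a b \<and>
       openin X {x \<in> topspace X. identify_rel (topspace X) a b `` {x} \<in> U})"

lemma equiv_identify_rel:
  assumes "a \<in> S" "b \<in> S"
  shows "equiv S (identify_rel S a b)"
  using assms
  by (auto simp: identify_rel_def equiv_def refl_on_def sym_def trans_def)

lemma openin_identify_points:
  "openin (identify_points X a b) U \<longleftrightarrow>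
     U \<subseteq> topspace X // identify_rel (topspace X) a b \<and>
     openin X {x \<in> topspace X. identify_rel (topspace X) a b `` {x} \<in> U}"
proof -
  let ?r = "identify_rel (topspace X) a b"
  have 1: "{x \<in> topspace X. ?r `` {x} \<in> U \<inter> V} =
      {x \<in> topspace X. ?r `` {x} \<in> U} \<inter> {x \<in> topspace X. ?r `` {x} \<in> V}" for U V
    by auto
  have 2: "{x \<in> topspace X. ?r `` {x} \<in> \<Union>\<K>} = (\<Union>K\<in>\<K>. {x \<in> topspace X. ?r `` {x} \<in> K})" for \<K>
    by auto
  have "istopology (\<lambda>U. U \<subseteq> topspace X // ?r \<and> openin X {x \<in> topspace X. ?r `` {x} \<in> U})"
    unfolding istopology_def 1 2 by blast
  then show ?thesis
    by (simp add: identify_points_def)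
qed


section \<open>Semidirect products\<close>

text \<open>\<open>G \<ltimes> N\<close> for the action \<open>\<alpha>\<close> of \<open>G\<close> on \<open>N\<close>; the pair \<open>(g, n)\<close> stands for the product \<open>n g\<close>,
  so that \<open>g n g\<^sup>-\<^sup>1 = \<alpha> g n\<close>.\<close>

definition semidirect_product ::
  "('a, 'm) monoid_scheme \<Rightarrow> ('b, 'k) monoid_scheme \<Rightarrow> ('a \<Rightarrow> 'b \<Rightarrow> 'b) \<Rightarrow> ('a \<times> 'b) monoid" where
  "semidirect_product G N \<alpha> =
     \<lparr>carrier = carrier G \<times> carrier N,
      mult = (\<lambda>(g, n) (h, m). (g \<otimes>\<^bsub>G\<^esub> h, n \<otimes>\<^bsub>N\<^esub> \<alpha> g m)),
      one = (\<one>\<^bsub>G\<^esub>, \<one>\<^bsub>N\<^esub>)\<rparr>"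


section \<open>The alternating enrichment\<close>

definition alt_fin :: "'a set \<Rightarrow> ('a \<Rightarrow> 'a) monoid" where
  "alt_fin S =
     \<lparr>carrier = {p. p permutes S \<and> finite {x. p x \<noteq> x} \<and> evenperm p},
      mult = (\<circ>),
      one = id\<rparr>"

text \<open>Extended by the identity off the carrier, as \<open>permutes\<close> requires.\<close>

definition left_mult :: "('a, 'm) monoid_scheme \<Rightarrow> 'a \<Rightarrow> 'a \<Rightarrow> 'a" where
  "left_mult G g x = (if x \<in> carrier G then g \<otimes>\<^bsub>G\<^esub> x else x)"

definition alternating_enrichment :: "('a, 'm) monoid_scheme \<Rightarrow> ('a \<times> ('a \<Rightarrow> 'a)) monoid" where
  "alternating_enrichment G =
     semidirect_product G (alt_fin (carrier G))
       (\<lambda>g p. left_mult G g \<circ> p \<circ> left_mult G (inv\<^bsub>G\<^esub> g))"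


section \<open>The elementary enrichment\<close>

text \<open>The vector space with basis \<open>S\<close>, as the finitely supported functions \<open>S \<rightarrow> F\<close> extended by 0.\<close>

definition free_space :: "'a set \<Rightarrow> ('a \<Rightarrow> 'f::field) set" where
  "free_space S = {v. finite {x. v x \<noteq> 0} \<and> {x. v x \<noteq> 0} \<subseteq> S}"

definition basis_vector :: "'a \<Rightarrow> 'a \<Rightarrow> 'f::field" where
  "basis_vector y = (\<lambda>x. if x = y then 1 else 0)"

definition linear_on_free_space :: "'a set \<Rightarrow> (('a \<Rightarrow> 'f::field) \<Rightarrow> ('a \<Rightarrow> 'f)) \<Rightarrow> bool" where
  "linear_on_free_space S T \<longleftrightarrow>
     (\<forall>u\<in>free_space S. \<forall>v\<in>free_space S. T (\<lambda>x. u x + v x) = (\<lambda>x. T u x + T v x)) \<and>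
     (\<forall>c. \<forall>v\<in>free_space S. T (\<lambda>x. c * v x) = (\<lambda>x. c * T v x))"

definition matrix_entry :: "(('a \<Rightarrow> 'f::field) \<Rightarrow> ('a \<Rightarrow> 'f)) \<Rightarrow> 'a \<Rightarrow> 'a \<Rightarrow> 'f" where
  "matrix_entry T x y = T (basis_vector y) x"

definition nontrivial_entries ::
  "'a set \<Rightarrow> (('a \<Rightarrow> 'f::field) \<Rightarrow> ('a \<Rightarrow> 'f)) \<Rightarrow> ('a \<times> 'a) set" where
  "nontrivial_entries S T =
     {(x, y). x \<in> S \<and> y \<in> S \<and> matrix_entry T x y \<noteq> (if x = y then 1 else 0)}"

text \<open>The Leibniz formula of \<open>det\<close>, for a square matrix indexed by a finite set \<open>X\<close>.\<close>

definition det_on :: "'a set \<Rightarrow> ('a \<Rightarrow> 'a \<Rightarrow> 'f::field) \<Rightarrow> 'f" where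
  "det_on X A = (\<Sum>p | p permutes X. of_int (sign p) * (\<Prod>x\<in>X. A x (p x)))"

text \<open>The determinant of a map with finitely many nontrivial entries is that of its block on the
  finite set of all row and column indices of such entries; outside this block the matrix is the
  identity.\<close>

definition fin_det :: "'a set \<Rightarrow> (('a \<Rightarrow> 'f::field) \<Rightarrow> ('a \<Rightarrow> 'f)) \<Rightarrow> 'f" where
  "fin_det S T =
     det_on (fst ` nontrivial_entries S T \<union> snd ` nontrivial_entries S T) (matrix_entry T)"

definition sl_fin :: "'a set \<Rightarrow> (('a \<Rightarrow> 'f::field) \<Rightarrow> ('a \<Rightarrow> 'f)) monoid" where
  "sl_fin S = (BijGroup (free_space S))
     \<lparr>carrier := {T \<in> Bij (free_space S).
        linear_on_free_space S T \<and> finite (nontrivial_entries S T) \<and> fin_det S T = 1}\<rparr>"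

text \<open>Maps the basis vector at \<open>y\<close> to the basis vector at \<open>g \<otimes> y\<close>.\<close>

definition left_regular :: "('a, 'm) monoid_scheme \<Rightarrow> 'a \<Rightarrow> ('a \<Rightarrow> 'f::field) \<Rightarrow> ('a \<Rightarrow> 'f)" where
  "left_regular G g v = (\<lambda>x. if x \<in> carrier G then v (inv\<^bsub>G\<^esub> g \<otimes>\<^bsub>G\<^esub> x) else 0)"

lemma left_regular_basis_vector:
  assumes "group G" "g \<in> carrier G" "y \<in> carrier G"
  shows "left_regular G g (basis_vector y) = basis_vector (g \<otimes>\<^bsub>G\<^esub> y)"
proof -
  interpret group G by fact
  have "inv\<^bsub>G\<^esub> g \<otimes>\<^bsub>G\<^esub> x = y \<longleftrightarrow> x = g \<otimes>\<^bsub>G\<^esub> y" if "x \<in> carrier G" for x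
    using that assms(2,3) by (metis inv_closed inv_solve_left)
  then show ?thesis
    using assms(2,3) by (auto simp: left_regular_def basis_vector_def fun_eq_iff)
qed

definition elementary_enrichment ::
  "('a, 'm) monoid_scheme \<Rightarrow> ('a \<times> (('a \<Rightarrow> 'f::field) \<Rightarrow> ('a \<Rightarrow> 'f))) monoid" where
  "elementary_enrichment G =
     semidirect_product G (sl_fin (carrier G))
       (\<lambda>g T. restrict (left_regular G g \<circ> T \<circ> left_regular G (inv\<^bsub>G\<^esub> g)) (free_space (carrier G)))"

end

theory Submission
  imports Defs "HOL-Algebra.Generated_Groups"
begin

text \<open>Write \<open>\<Gamma> = G \<ltimes> N\<close>. In both cases \<open>N\<close> is a group of finitely supported transformations: elements
  with disjoint supports commute, and any finite support can be moved anywhere by conjugating with an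
  even permutation.

  Let \<open>\<phi>\<close> be a character of \<open>\<Gamma>\<close> or of \<open>N\<close> and let \<open>b\<^sub>i\<close> be conjugates of \<open>b \<in> N\<close> whose supports escape to
  infinity. The Cauchy-Schwarz inequality shows that \<open>\<phi> (x b\<^sub>i)\<close> converges to a class function \<open>\<psi> x\<close>;
  this limit is dominated by \<open>\<phi>\<close>, so extremality gives \<open>\<psi> = \<phi> b * \<phi>\<close>. Hence \<open>\<phi>\<close> is multiplicative on
  disjointly supported elements of \<open>N\<close>. Conversely, a trace of \<open>N\<close> that is multiplicative in this sense
  is extreme, because averages of \<open>a\<^sub>i - \<phi> a\<close> over disjoint copies \<open>a\<^sub>i\<close> of \<open>a\<close> tend to 0.

  As \<open>N\<close> has no nontrivial homomorphism to the multiplicative group of complex numbers, either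
  \<open>\<phi> = 1\<close> on \<open>N\<close>, and then \<open>\<phi>\<close> factors through \<open>G\<close>, or \<open>\<bar>\<phi> b\<bar> < 1\<close> for some \<open>b \<in> N\<close>, and then conjugating
  \<open>\<gamma> \<notin> N\<close> by far translates of products of copies of \<open>b\<close> yields almost orthogonal elements, whence
  \<open>\<phi> \<gamma> = 0\<close>. So the characters of \<open>\<Gamma>\<close> form two closed sets, the inflations of characters of \<open>G\<close> and
  the extensions by zero of characters of \<open>N\<close>. They can only meet in the inflation of \<open>\<delta>\<^sub>e\<close>, which
  is a character if and only if \<open>G\<close> is ICC.\<close>

section \<open>Positive-definite functions\<close>

text \<open>Everything happens on finite Gram sums: \<open>gram\<close> is the squared norm of a
  vector of the GNS space, and Cauchy-Schwarz is the nonnegativity of a Gram sum with one more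
  point, so no representation is built. The obstacle is that \<open>x \<mapsto> \<phi> (x b)\<close>
  and its limits are not positive definite, so such a limit cannot itself be a component of a convex
  decomposition. It is therefore hidden in the perturbation by \<open>2 + l b\<close>: the expansion
  has 4 + 1 = 5 copies of \<open>\<phi>\<close> and two cross terms, and varying the phase
  \<open>l\<close> separates the limit from its adjoint. A second obstacle is that left translation
  by \<open>g\<close> moves every point unless \<open>g\<close> is the identity, so it is not
  finitary. On a finite set, however, it agrees with some finitary even permutation, so
  \<open>g\<close> acts on each single element of \<open>N\<close> as an inner automorphism does.
  Hence every trace of \<open>N\<close> is automatically invariant under \<open>G\<close>. This
  makes extension by zero a trace, and it is the only fact about the action on which the common
  treatment of both enrichments rests besides the axioms of an action.\<close>

definition gram :: "('a, 'm) monoid_scheme \<Rightarrow> ('a \<Rightarrow> complex) \<Rightarrow> 'i set \<Rightarrow> ('i \<Rightarrow> complex) \<Rightarrow> ('i \<Rightarrow> 'a) \<Rightarrow> complex"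
  where "gram G \<phi> I c x = (\<Sum>i\<in>I. \<Sum>j\<in>I. cnj (c i) * c j * \<phi> (inv\<^bsub>G\<^esub> x i \<otimes>\<^bsub>G\<^esub> x j))"

text \<open>A family may repeat points of the group. Adding up the coefficients of equal points
  (\<open>d\<close>) turns its Gram sum into one over the set of values, to which the definition
  applies. Families are needed for images under homomorphisms and for points indexed by
  \<open>nat\<close>.\<close>

lemma positive_definiteD:
  assumes "positive_definite G \<phi>" "finite I" "x ` I \<subseteq> carrier G"
  shows "gram G \<phi> I c x \<in> \<real>\<^sub>\<ge>\<^sub>0"
proof -
  define d where "d = (\<lambda>g. \<Sum>i\<in>{i\<in>I. x i = g}. c i)"
  have 1: "(\<Sum>j\<in>I. c j * F (x j)) = (\<Sum>h\<in>x ` I. d h * F h)" for F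
  proof -
    have "(\<Sum>j\<in>I. c j * F (x j)) = (\<Sum>h\<in>x ` I. \<Sum>j\<in>{j\<in>I. x j = h}. c j * F (x j))"
      by (rule sum.image_gen[OF assms(2)])
    also have "\<dots> = (\<Sum>h\<in>x ` I. d h * F h)"
      unfolding d_def sum_distrib_right by (intro sum.cong refl) auto
    finally show ?thesis .
  qed
  have 2: "(\<Sum>i\<in>I. cnj (c i) * F (x i)) = (\<Sum>g\<in>x ` I. cnj (d g) * F g)" for F
    using arg_cong[OF 1[of "\<lambda>g. cnj (F g)"], of cnj] by simp
  have "gram G \<phi> I c x = (\<Sum>i\<in>I. cnj (c i) * (\<Sum>j\<in>I. c j * \<phi> (inv\<^bsub>G\<^esub> x i \<otimes>\<^bsub>G\<^esub> x j)))"
    by (simp add: gram_def sum_distrib_left mult.assoc)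
  also have "\<dots> = (\<Sum>g\<in>x ` I. cnj (d g) * (\<Sum>h\<in>x ` I. d h * \<phi> (inv\<^bsub>G\<^esub> g \<otimes>\<^bsub>G\<^esub> h)))"
    by (subst 1) (rule 2)
  also have "\<dots> = (\<Sum>g\<in>x ` I. \<Sum>h\<in>x ` I. cnj (d g) * d h * \<phi> (inv\<^bsub>G\<^esub> g \<otimes>\<^bsub>G\<^esub> h))"
    by (simp add: sum_distrib_left mult.assoc)
  finally have 3: "gram G \<phi> I c x = (\<Sum>g\<in>x ` I. \<Sum>h\<in>x ` I. cnj (d g) * d h * \<phi> (inv\<^bsub>G\<^esub> g \<otimes>\<^bsub>G\<^esub> h))" .
  show ?thesis
    unfolding 3 using assms unfolding positive_definite_def by blast
qed

lemma positive_definite_iff_gram: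
  "positive_definite G \<phi> \<longleftrightarrow>
    (\<forall>S c. finite S \<longrightarrow> S \<subseteq> carrier G \<longrightarrow> gram G \<phi> S c (\<lambda>x. x) \<in> \<real>\<^sub>\<ge>\<^sub>0)"
  by (simp add: positive_definite_def gram_def)

lemma gram_cong:
  assumes "\<And>i j. i \<in> I \<Longrightarrow> j \<in> I \<Longrightarrow> \<phi> (inv\<^bsub>G\<^esub> x i \<otimes>\<^bsub>G\<^esub> x j) = \<psi> (inv\<^bsub>H\<^esub> y i \<otimes>\<^bsub>H\<^esub> y j)"
  shows "gram G \<phi> I c x = gram H \<psi> I c y"
  unfolding gram_def by (intro sum.cong refl) (simp add: assms)

lemma (in group) positive_definite_cong:
  assumes "\<And>g. g \<in> carrier G \<Longrightarrow> \<phi> g = \<psi> g"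
  shows "positive_definite G \<phi> \<longleftrightarrow> positive_definite G \<psi>"
proof -
  have "gram G \<phi> S c (\<lambda>x. x) = gram G \<psi> S c (\<lambda>x. x)" if "S \<subseteq> carrier G" for S c
    using that by (intro gram_cong assms) blast
  then show ?thesis
    unfolding positive_definite_iff_gram by metis
qed

lemma positive_definite_scale:
  assumes "positive_definite G \<phi>" "0 \<le> (r::real)"
  shows "positive_definite G (\<lambda>x. of_real r * \<phi> x)"
proof -
  have *: "gram G (\<lambda>x. of_real r * \<phi> x) S c (\<lambda>x. x) = of_real r * gram G \<phi> S c (\<lambda>x. x)" for S c
    by (simp add: gram_def sum_distrib_left mult_ac)
  show ?thesis
    using assms unfolding positive_definite_iff_gram *
    by (auto simp: complex_nonneg_Reals_iff)
qed

lemma positive_definite_sum: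
  assumes "\<And>k. k \<in> K \<Longrightarrow> positive_definite G (\<phi> k)"
  shows "positive_definite G (\<lambda>x. \<Sum>k\<in>K. \<phi> k x)"
proof -
  have *: "gram G (\<lambda>x. \<Sum>k\<in>K. \<phi> k x) S c (\<lambda>x. x) = (\<Sum>k\<in>K. gram G (\<phi> k) S c (\<lambda>x. x))" for S c
    unfolding gram_def sum_distrib_left
    by (subst (2) sum.swap, subst (1) sum.swap) (simp add: sum.swap[of _ K])
  show ?thesis
    using assms unfolding positive_definite_iff_gram *
    by (auto simp: complex_nonneg_Reals_iff intro: sum_nonneg)
qed

lemma positive_definite_limit:
  fixes \<phi> :: "nat \<Rightarrow> 'a \<Rightarrow> complex"
  assumes "group G" "\<And>n. positive_definite G (\<phi> n)"
    and "\<And>g. g \<in> carrier G \<Longrightarrow> (\<lambda>n. \<phi> n g) \<longlonglongrightarrow> \<psi> g"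
  shows "positive_definite G \<psi>"
  unfolding positive_definite_iff_gram
proof (intro allI impI)
  interpret group G by fact
  fix S c assume S: "finite S" "S \<subseteq> carrier G"
  have "(\<lambda>n. gram G (\<phi> n) S c (\<lambda>x. x)) \<longlonglongrightarrow> gram G \<psi> S c (\<lambda>x. x)"
    unfolding gram_def using S by (intro tendsto_sum tendsto_mult tendsto_const assms(3)) auto
  moreover have "gram G (\<phi> n) S c (\<lambda>x. x) \<in> \<real>\<^sub>\<ge>\<^sub>0" for n
    using assms(2) S unfolding positive_definite_iff_gram by blast
  ultimately show "gram G \<psi> S c (\<lambda>x. x) \<in> \<real>\<^sub>\<ge>\<^sub>0"
    by (meson closed_nonneg_Reals_complex closed_sequentially)
qed

context group
begin

lemma positive_definite_one:
  assumes "positive_definite G \<phi>"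
  shows "\<phi> \<one> \<in> \<real>\<^sub>\<ge>\<^sub>0"
  using positive_definiteD[OF assms, of "{0::nat}" "\<lambda>_. \<one>" "\<lambda>_. 1"] by (simp add: gram_def)

text \<open>Only nonnegativity of Gram sums is assumed, so hermitian symmetry has to be extracted:
  the Gram sum of the points \<open>\<one>\<close> and \<open>x\<close> with coefficients 1 and
  \<open>l\<close> is real. The choice \<open>l = 1\<close> compares the imaginary parts,
  \<open>l = \<i>\<close> the real parts.\<close>

lemma positive_definite_inv:
  assumes pd: "positive_definite G \<phi>" and x: "x \<in> carrier G"
  shows "\<phi> (inv x) = cnj (\<phi> x)"
proof -
  have one: "Im (\<phi> \<one>) = 0"
    using positive_definite_one[OF pd] by (simp add: complex_nonneg_Reals_iff)
  have *: "\<phi> \<one> + l * \<phi> x + (cnj l * \<phi> (inv x) + cnj l * l * \<phi> \<one>) \<in> \<real>\<^sub>\<ge>\<^sub>0" for l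
    using positive_definiteD[OF pd, of "{False, True}" "\<lambda>b. if b then x else \<one>" "\<lambda>b. if b then l else 1"] x
    by (simp add: gram_def)
  have "Im (\<phi> x) + Im (\<phi> (inv x)) = 0"
    using *[of 1] one by (simp add: complex_nonneg_Reals_iff)
  moreover have "Re (\<phi> x) = Re (\<phi> (inv x))"
    using *[of \<i>] one by (simp add: complex_nonneg_Reals_iff)
  ultimately show ?thesis
    by (simp add: complex_eq_iff)
qed

lemma gram_insert:
  assumes "finite I" "a \<notin> I"
  shows "gram G \<phi> (insert a I) c x =
    cnj (c a) * c a * \<phi> (inv x a \<otimes> x a) + cnj (c a) * (\<Sum>j\<in>I. c j * \<phi> (inv x a \<otimes> x j))
    + c a * (\<Sum>i\<in>I. cnj (c i) * \<phi> (inv x i \<otimes> x a)) + gram G \<phi> I c x"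
  using assms by (simp add: gram_def sum.distrib sum_distrib_left algebra_simps)

lemma gram_insert_pd:
  assumes pd: "positive_definite G \<phi>" and I: "finite I" "a \<notin> I" and x: "x ` insert a I \<subseteq> carrier G"
  shows "gram G \<phi> (insert a I) c x = of_real ((cmod (c a))\<^sup>2) * \<phi> \<one>
    + of_real (2 * Re (cnj (c a) * (\<Sum>j\<in>I. c j * \<phi> (inv x a \<otimes> x j)))) + gram G \<phi> I c x"
proof -
  have "\<phi> (inv x i \<otimes> x a) = cnj (\<phi> (inv x a \<otimes> x i))" if "i \<in> I" for i
    using positive_definite_inv[OF pd, of "inv x a \<otimes> x i"] that x by (auto simp: inv_mult_group image_subset_iff)
  then have *: "(\<Sum>i\<in>I. cnj (c i) * \<phi> (inv x i \<otimes> x a)) = cnj (\<Sum>j\<in>I. c j * \<phi> (inv x a \<otimes> x j))"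
    by simp
  have "x a \<in> carrier G" using x by simp
  then show ?thesis
    unfolding gram_insert[OF I] *
    using complex_add_cnj[of "cnj (c a) * (\<Sum>j\<in>I. c j * \<phi> (inv x a \<otimes> x j))"]
      complex_norm_square[of "c a"]
    by (simp add: algebra_simps)
qed

text \<open>The sum on the left is the inner product of \<open>inv y\<close> with the vector of the
  family. Adjoining \<open>inv y\<close> with the optimal coefficient \<open>- W\<close> changes the
  Gram sum by \<open>|W|^2 - 2 |W|^2\<close>, and the result is still nonnegative.\<close>

lemma positive_definite_Cauchy_Schwarz:
  assumes pd: "positive_definite G \<phi>" and one: "\<phi> \<one> = 1"
    and I: "finite I" and x: "x ` I \<subseteq> carrier G" and y: "y \<in> carrier G"
  shows "(cmod (\<Sum>i\<in>I. c i * \<phi> (y \<otimes> x i)))\<^sup>2 \<le> Re (gram G \<phi> I c x)"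
proof -
  define W where "W = (\<Sum>i\<in>I. c i * \<phi> (y \<otimes> x i))"
  \<comment> \<open>The type \<open>option\<close> supplies a fresh index \<open>None\<close> for
    the additional point, whatever the index type is.\<close>
  define c' where "c' = case_option (- W) c"
  define x' where "x' = case_option (inv y) x"
  have sub: "x' ` insert None (Some ` I) \<subseteq> carrier G"
    using x y by (auto simp: x'_def)
  have W': "(\<Sum>j\<in>Some ` I. c' j * \<phi> (inv x' None \<otimes> x' j)) = W"
    using y by (simp add: sum.reindex c'_def x'_def W_def)
  have Q: "gram G \<phi> (Some ` I) c' x' = gram G \<phi> I c x"
    by (simp add: gram_def sum.reindex c'_def x'_def)
  have "gram G \<phi> (insert None (Some ` I)) c' x' \<in> \<real>\<^sub>\<ge>\<^sub>0"
    using I sub by (intro positive_definiteD[OF pd]) auto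
  moreover have "gram G \<phi> (insert None (Some ` I)) c' x' =
      of_real ((cmod W)\<^sup>2) + of_real (2 * Re (- cnj W * W)) + gram G \<phi> I c x"
    using gram_insert_pd[OF pd _ _ sub, of c'] I
    unfolding W' Q one by (simp add: c'_def)
  moreover have "Re (- cnj W * W) = - (cmod W)\<^sup>2"
    using cmod_power2[of W] by (simp add: power2_eq_square)
  ultimately have "0 \<le> Re (of_real ((cmod W)\<^sup>2) + of_real (2 * - (cmod W)\<^sup>2) + gram G \<phi> I c x)"
    by (metis complex_nonneg_Reals_iff)
  then show ?thesis by (simp add: W_def)
qed

lemma positive_definite_norm_le:
  assumes pd: "positive_definite G \<phi>" and one: "\<phi> \<one> = 1" and x: "x \<in> carrier G"
  shows "cmod (\<phi> x) \<le> 1"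
  using positive_definite_Cauchy_Schwarz[OF pd one, of "{()}" "\<lambda>_. x" \<one> "\<lambda>_. 1"] x one
  by (simp add: gram_def power_le_one_iff)

text \<open>The vector \<open>m - \<phi> m\<close> has squared norm
  \<open>1 - |\<phi> m|^2 = 0\<close>, so by Cauchy-Schwarz its inner product with anything
  vanishes. This yields multiplicativity where all values are unimodular and lets elements of value
  1 be cancelled.\<close>

lemma positive_definite_mult_unit:
  assumes pd: "positive_definite G \<phi>" and one: "\<phi> \<one> = 1"
    and x: "x \<in> carrier G" and m: "m \<in> carrier G" and norm: "cmod (\<phi> m) = 1"
  shows "\<phi> (x \<otimes> m) = \<phi> x * \<phi> m"
proof -
  have "(cmod (\<phi> (x \<otimes> m) - \<phi> m * \<phi> x))\<^sup>2 \<le> Re (gram G \<phi> {False, True} (\<lambda>b. if b then 1 else - \<phi> m) (\<lambda>b. if b then m else \<one>))"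
    using positive_definite_Cauchy_Schwarz[OF pd one, of "{False, True}" "\<lambda>b. if b then m else \<one>" x "\<lambda>b. if b then 1 else - \<phi> m"] x m
    by simp
  also have "gram G \<phi> {False, True} (\<lambda>b. if b then 1 else - \<phi> m) (\<lambda>b. if b then m else \<one>)
      = 1 - cnj (\<phi> m) * \<phi> m"
    using m positive_definite_inv[OF pd m] by (simp add: gram_def one)
  also have "cnj (\<phi> m) * \<phi> m = 1"
    using complex_norm_square[of "\<phi> m"] norm by (simp add: mult.commute)
  finally show ?thesis by (simp add: mult.commute)
qed

end

section \<open>Traces and characters of a group\<close>

definition class_function :: "('a, 'm) monoid_scheme \<Rightarrow> ('a \<Rightarrow> complex) \<Rightarrow> bool" where
  "class_function G \<phi> \<longleftrightarrow>
     (\<forall>g\<in>carrier G. \<forall>h\<in>carrier G. \<phi> (h \<otimes>\<^bsub>G\<^esub> g \<otimes>\<^bsub>G\<^esub> inv\<^bsub>G\<^esub> h) = \<phi> g)"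

lemma traces_iff:
  "\<phi> \<in> traces G \<longleftrightarrow> \<phi> \<in> extensional (carrier G) \<and> positive_definite G \<phi> \<and>
     class_function G \<phi> \<and> \<phi> \<one>\<^bsub>G\<^esub> = 1"
  by (simp add: traces_def class_function_def)

lemma charactersD:
  assumes "\<phi> \<in> characters G" "\<psi> \<in> traces G" "\<theta> \<in> traces G" "0 < (t::real)" "t < 1"
    "\<And>g. g \<in> carrier G \<Longrightarrow> \<phi> g = of_real (1 - t) * \<psi> g + of_real t * \<theta> g"
  shows "\<psi> = \<theta>"
  using assms unfolding characters_def by blast

lemma characters_subset_traces: "characters G \<subseteq> traces G"
  by (auto simp: characters_def)

text \<open>It is enough to identify one component of a decomposition: since \<open>t > 0\<close>,
  the other component is then determined.\<close>

lemma charactersI: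
  assumes "\<phi> \<in> traces G"
    and "\<And>\<psi> \<theta> t g. \<psi> \<in> traces G \<Longrightarrow> \<theta> \<in> traces G \<Longrightarrow> 0 < (t::real) \<Longrightarrow> t < 1 \<Longrightarrow>
      (\<And>h. h \<in> carrier G \<Longrightarrow> \<phi> h = of_real (1 - t) * \<psi> h + of_real t * \<theta> h) \<Longrightarrow>
      g \<in> carrier G \<Longrightarrow> \<psi> g = \<phi> g"
  shows "\<phi> \<in> characters G"
  unfolding characters_def
proof (intro CollectI conjI notI; (elim bexE conjE exE)?)
  show "\<phi> \<in> traces G" by fact
  fix \<psi> \<theta> t
  assume *: "\<psi> \<in> traces G" "\<theta> \<in> traces G" "\<psi> \<noteq> \<theta>" "0 < (t::real)" "t < 1"
    "\<forall>g\<in>carrier G. \<phi> g = of_real (1 - t) * \<psi> g + of_real t * \<theta> g"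
  have "\<psi> g = \<theta> g" if g: "g \<in> carrier G" for g
  proof -
    have "\<psi> g = \<phi> g" using assms(2)[OF *(1,2,4,5) _ g] *(6) by blast
    moreover have "of_real t * (\<theta> g - \<psi> g) = (of_real (1 - t) * \<psi> g + of_real t * \<theta> g) - \<psi> g"
      by (simp add: algebra_simps)
    ultimately have "of_real t * (\<theta> g - \<psi> g) = 0" using *(6) g by simp
    then show ?thesis
      using \<open>0 < t\<close> by (metis eq_iff_diff_eq_0 less_irrefl mult_eq_0_iff of_real_eq_0_iff)
  qed
  moreover have "\<psi> \<in> extensional (carrier G)" "\<theta> \<in> extensional (carrier G)"
    using *(1,2) by (auto simp: traces_iff)
  ultimately show False
    using \<open>\<psi> \<noteq> \<theta>\<close> extensionalityI[of \<psi> "carrier G" \<theta>] by blast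
qed

context group
begin

lemma class_function_commute:
  assumes "class_function G \<phi>" "x \<in> carrier G" "y \<in> carrier G"
  shows "\<phi> (x \<otimes> y) = \<phi> (y \<otimes> x)"
proof -
  have "y \<otimes> (x \<otimes> y) \<otimes> inv y = y \<otimes> x"
    using assms by (simp add: m_assoc)
  moreover have "\<phi> (y \<otimes> (x \<otimes> y) \<otimes> inv y) = \<phi> (x \<otimes> y)"
    using assms unfolding class_function_def by simp
  ultimately show ?thesis by simp
qed

lemma restrict_in_traces:
  assumes "positive_definite G \<phi>" "class_function G \<phi>" "\<phi> \<one> = 1"
  shows "restrict \<phi> (carrier G) \<in> traces G"
proof -
  have "positive_definite G (restrict \<phi> (carrier G)) \<longleftrightarrow> positive_definite G \<phi>"
    by (rule positive_definite_cong) simp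
  then show ?thesis
    using assms by (auto simp: traces_iff class_function_def)
qed

lemma trace_norm_le: "\<phi> \<in> traces G \<Longrightarrow> x \<in> carrier G \<Longrightarrow> cmod (\<phi> x) \<le> 1"
  by (simp add: positive_definite_norm_le traces_iff)

lemma trace_inv: "\<phi> \<in> traces G \<Longrightarrow> x \<in> carrier G \<Longrightarrow> \<phi> (inv x) = cnj (\<phi> x)"
  by (simp add: positive_definite_inv traces_iff)

text \<open>If \<open>\<phi>\<close> dominates the perturbation \<open>2 l \<psi> + 2 (cnj l) \<psi>'\<close> for every phase \<open>l\<close>, then the
  two normalised perturbations \<open>5 \<phi> \<plusminus> (2 l \<psi> + 2 (cnj l) \<psi>')\<close> average to \<open>\<phi>\<close>.\<close>

lemma character_dominates:
  assumes \<phi>: "\<phi> \<in> characters G"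
    and cl: "class_function G \<psi>" "class_function G \<psi>'"
    and pd: "\<And>l. cmod l = 1 \<Longrightarrow> positive_definite G (\<lambda>x. 5 * \<phi> x + 2 * l * \<psi> x + 2 * cnj l * \<psi>' x)"
    and one: "\<psi>' \<one> = cnj (\<psi> \<one>)" and le: "cmod (\<psi> \<one>) \<le> 1"
    and x: "x \<in> carrier G"
  shows "\<psi> x = \<psi> \<one> * \<phi> x"
proof -
  have tr: "\<phi> \<in> traces G" using \<phi> characters_subset_traces by blast
  then have clphi: "class_function G \<phi>" and phi1: "\<phi> \<one> = 1" by (auto simp: traces_iff)
  have key: "2 * l * \<psi> x + 2 * cnj l * \<psi>' x = of_real (4 * Re (l * \<psi> \<one>)) * \<phi> x" if l: "cmod l = 1" for l
  proof -
    define s where "s = Re (l * \<psi> \<one>)"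
    define D where "D y = 2 * l * \<psi> y + 2 * cnj l * \<psi>' y" for y
    have sle: "\<bar>s\<bar> \<le> 1"
      using abs_Re_le_cmod[of "l * \<psi> \<one>"] le l by (simp add: s_def norm_mult)
    have D1: "D \<one> = of_real (4 * s)"
      by (simp add: complex_eq_iff D_def one s_def algebra_simps)
    define T where "T e = (\<lambda>y. of_real (1 / (5 + e * 4 * s)) * (5 * \<phi> y + of_real e * D y))" for e :: real
    have T: "restrict (T e) (carrier G) \<in> traces G" if e: "e = 1 \<or> e = -1" for e
    proof (rule restrict_in_traces)
      have pos: "0 < 5 + e * 4 * s" using e sle by auto
      have "(\<lambda>y. 5 * \<phi> y + of_real e * D y) = (\<lambda>y. 5 * \<phi> y + 2 * (of_real e * l) * \<psi> y + 2 * cnj (of_real e * l) * \<psi>' y)"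
        by (simp add: D_def fun_eq_iff algebra_simps)
      moreover have "cmod (of_real e * l) = 1" using e l by (auto simp: norm_mult)
      ultimately have "positive_definite G (\<lambda>y. 5 * \<phi> y + of_real e * D y)"
        using pd by metis
      then show "positive_definite G (T e)"
        unfolding T_def by (rule positive_definite_scale) (use pos in simp)
      show "class_function G (T e)"
        using cl clphi by (simp add: class_function_def T_def D_def)
      have "T e \<one> = of_real (1 / (5 + e * 4 * s) * (5 + e * 4 * s))"
      proof -
        have "5 * \<phi> \<one> + of_real e * D \<one> = of_real (5 + e * 4 * s)"
          by (simp add: D1 phi1)
        then show ?thesis by (simp only: T_def of_real_mult)
      qed
      then show "T e \<one> = 1" using pos by simp
    qed
    \<comment> \<open>The weights are proportional to the values \<open>5 + 4 s\<close> and
      \<open>5 - 4 s\<close> of the two perturbations at the identity, so they cancel the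
      normalisations. As \<open>4 |s| \<le> 4 < 5\<close>, both weights are positive.\<close>
    define t where "t = (5 - 4 * s) / 10"
    have t: "0 < t" "t < 1" using sle by (auto simp: t_def)
    have "restrict (T 1) (carrier G) = restrict (T (-1)) (carrier G)"
    proof (rule charactersD[OF \<phi> T T t])
      fix g assume g: "g \<in> carrier G"
      have a: "1 - t = (5 + 4 * s) / 10" by (simp add: t_def field_simps)
      have "of_real (1 - t) * T 1 g = (5 * \<phi> g + D g) / 10"
      proof -
        have "of_real (1 - t) * T 1 g = of_real ((1 - t) * (1 / (5 + 1 * 4 * s))) * (5 * \<phi> g + of_real 1 * D g)"
          unfolding T_def by (simp only: of_real_mult mult.assoc)
        also have "(1 - t) * (1 / (5 + 1 * 4 * s)) = 1 / 10"
          unfolding a using sle by simp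
        finally show ?thesis by simp
      qed
      moreover have "of_real t * T (-1) g = (5 * \<phi> g - D g) / 10"
      proof -
        have "of_real t * T (-1) g = of_real (t * (1 / (5 + -1 * 4 * s))) * (5 * \<phi> g + of_real (-1) * D g)"
          unfolding T_def by (simp only: of_real_mult mult.assoc)
        also have "t * (1 / (5 + -1 * 4 * s)) = 1 / 10"
          unfolding t_def using sle by (simp add: field_simps)
        finally show ?thesis by simp
      qed
      moreover have "\<phi> g = (5 * \<phi> g + D g) / 10 + (5 * \<phi> g - D g) / 10"
        by (simp add: field_simps)
      ultimately show "\<phi> g = of_real (1 - t) * restrict (T 1) (carrier G) g + of_real t * restrict (T (-1)) (carrier G) g"
        using g by (simp only: restrict_apply')
    qed auto
    then have "T 1 x = T (-1) x" using x by (metis restrict_apply')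
    then have "(5 * \<phi> x + D x) / of_real (5 + 4 * s) = (5 * \<phi> x - D x) / of_real (5 - 4 * s)"
      by (simp add: T_def)
    moreover have "complex_of_real (5 + 4 * s) \<noteq> 0" "complex_of_real (5 - 4 * s) \<noteq> 0"
      using sle unfolding of_real_eq_0_iff by auto
    ultimately have "(5 * \<phi> x + D x) * of_real (5 - 4 * s) = (5 * \<phi> x - D x) * of_real (5 + 4 * s)"
      by (simp add: frac_eq_eq)
    then have "D x = of_real (4 * s) * \<phi> x" by (simp add: algebra_simps)
    then show ?thesis by (simp add: D_def s_def)
  qed
  \<comment> \<open>The phases \<open>l = 1\<close> and \<open>l = \<i>\<close> give the sum and the
    difference of \<open>\<psi>\<close> and \<open>\<psi>'\<close>; adding the two relations
    eliminates \<open>\<psi>'\<close>.\<close>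
  have "\<psi> x + \<psi>' x = of_real (2 * Re (\<psi> \<one>)) * \<phi> x"
  proof -
    have "2 * (\<psi> x + \<psi>' x) = 2 * (of_real (2 * Re (\<psi> \<one>)) * \<phi> x)"
      using key[of 1] by (simp add: algebra_simps)
    then show ?thesis by (simp only: mult_cancel_left) simp
  qed
  moreover have "\<psi> x - \<psi>' x = 2 * \<i> * of_real (Im (\<psi> \<one>)) * \<phi> x"
  proof -
    have "\<i> * (\<psi> x - \<psi>' x) * 2 = \<i> * (2 * \<i> * of_real (Im (\<psi> \<one>)) * \<phi> x) * 2"
      using key[of \<i>] by (simp add: algebra_simps)
    then show ?thesis by (simp only: mult_cancel_left mult_cancel_right) simp
  qed
  ultimately have "2 * \<psi> x = (of_real (2 * Re (\<psi> \<one>)) + 2 * \<i> * of_real (Im (\<psi> \<one>))) * \<phi> x"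
    by (simp add: algebra_simps)
  also have "of_real (2 * Re (\<psi> \<one>)) + 2 * \<i> * of_real (Im (\<psi> \<one>)) = 2 * \<psi> \<one>"
    by (simp add: complex_eq_iff)
  finally show ?thesis by simp
qed

text \<open>The function \<open>x \<mapsto> \<phi> ((2 + l b)\<^sup>* x (2 + l b))\<close>, expanded in the group algebra.\<close>

lemma positive_definite_perturb:
  assumes pd: "positive_definite G \<phi>" and cl: "class_function G \<phi>"
    and b: "b \<in> carrier G" and l: "cmod l = 1"
  shows "positive_definite G (\<lambda>x. 5 * \<phi> x + 2 * l * \<phi> (x \<otimes> b) + 2 * cnj l * \<phi> (inv b \<otimes> x))"
  unfolding positive_definite_iff_gram
proof (intro allI impI)
  fix S :: "'a set" and c assume S: "finite S" "S \<subseteq> carrier G"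
  \<comment> \<open>Each point \<open>s\<close> is doubled into \<open>s\<close> and
    \<open>s b\<close>, with coefficients \<open>2 c s\<close> and \<open>l c s\<close>. These
    represent the product of \<open>s\<close> and \<open>2 + l b\<close> in the group
    algebra.\<close>
  let ?J = "S \<times> {False, True}"
  let ?c = "\<lambda>(s::'a, e). if e then l * c s else 2 * c s"
  let ?x = "\<lambda>(s, e). if e then s \<otimes> b else s"
  have ll: "cnj l * l = 1" using l complex_norm_square[of l] by (simp add: mult.commute)
  have "gram G \<phi> ?J ?c ?x = (\<Sum>i\<in>S. \<Sum>j\<in>S. \<Sum>e\<in>{False, True}. \<Sum>f\<in>{False, True}.
      cnj (?c (i, e)) * ?c (j, f) * \<phi> (inv (?x (i, e)) \<otimes> ?x (j, f)))"
    unfolding gram_def sum.cartesian_product'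
    by (rule sum.cong[OF refl], rule sum.swap)
  also have "\<dots> = gram G (\<lambda>x. 5 * \<phi> x + 2 * l * \<phi> (x \<otimes> b) + 2 * cnj l * \<phi> (inv b \<otimes> x)) S c (\<lambda>x. x)"
    unfolding gram_def
  proof (intro sum.cong refl)
    fix i j assume "i \<in> S" "j \<in> S"
    then have ij: "i \<in> carrier G" "j \<in> carrier G" using S by auto
    \<comment> \<open>This term carries the coefficient \<open>|l|^2 = 1\<close>. Conjugation
      invariance removes \<open>b\<close> from it, so it joins the term with coefficient 4, which
      explains the 5.\<close>
    have "\<phi> (inv (i \<otimes> b) \<otimes> (j \<otimes> b)) = \<phi> (inv b \<otimes> (inv i \<otimes> j) \<otimes> inv (inv b))"
      using ij b by (simp add: inv_mult_group m_assoc)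
    also have "\<dots> = \<phi> (inv i \<otimes> j)"
      using cl ij b unfolding class_function_def by blast
    finally have 1: "\<phi> (inv (i \<otimes> b) \<otimes> (j \<otimes> b)) = \<phi> (inv i \<otimes> j)" .
    have 2: "inv (i \<otimes> b) \<otimes> j = inv b \<otimes> (inv i \<otimes> j)" "inv i \<otimes> (j \<otimes> b) = inv i \<otimes> j \<otimes> b"
      using ij b by (simp_all add: inv_mult_group m_assoc)
    have "cnj l * cnj (c i) * (l * c j) * \<phi> (inv i \<otimes> j) = (cnj l * l) * (cnj (c i) * c j * \<phi> (inv i \<otimes> j))"
      by (simp add: algebra_simps)
    then have 3: "cnj l * cnj (c i) * (l * c j) * \<phi> (inv i \<otimes> j) = cnj (c i) * c j * \<phi> (inv i \<otimes> j)"
      by (simp only: ll mult_1_left)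
    show "(\<Sum>e\<in>{False, True}. \<Sum>f\<in>{False, True}. cnj (?c (i, e)) * ?c (j, f) * \<phi> (inv (?x (i, e)) \<otimes> ?x (j, f)))
      = cnj (c i) * c j * (5 * \<phi> (inv i \<otimes> j) + 2 * l * \<phi> (inv i \<otimes> j \<otimes> b) + 2 * cnj l * \<phi> (inv b \<otimes> (inv i \<otimes> j)))"
      using 3 by (simp add: 1 2) (auto simp: algebra_simps)
  qed
  finally have "gram G \<phi> ?J ?c ?x =
    gram G (\<lambda>x. 5 * \<phi> x + 2 * l * \<phi> (x \<otimes> b) + 2 * cnj l * \<phi> (inv b \<otimes> x)) S c (\<lambda>x. x)" .
  moreover have "gram G \<phi> ?J ?c ?x \<in> \<real>\<^sub>\<ge>\<^sub>0"
    using S b by (intro positive_definiteD[OF pd]) auto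
  ultimately show "gram G (\<lambda>x. 5 * \<phi> x + 2 * l * \<phi> (x \<otimes> b) + 2 * cnj l * \<phi> (inv b \<otimes> x)) S c (\<lambda>x. x) \<in> \<real>\<^sub>\<ge>\<^sub>0"
    by simp
qed

end

section \<open>Weak limits along asymptotically orthogonal sequences\<close>

context group
begin

text \<open>If convergence failed, infinitely many differences \<open>u\<^sub>m - u\<^sub>n\<close> in the group algebra, pairwise
  orthogonal with respect to \<open>\<phi>\<close>, would have a correlation with \<open>x\<^sup>-\<^sup>1\<close> bounded below.\<close>

lemma positive_definite_convergent:
  assumes pd: "positive_definite G \<phi>" and one: "\<phi> \<one> = 1"
    and u: "\<And>i::nat. u i \<in> carrier G"
    and ev: "\<And>i. \<forall>\<^sub>F j in sequentially. \<phi> (inv u i \<otimes> u j) = c"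
    and x: "x \<in> carrier G"
  shows "convergent (\<lambda>i. \<phi> (x \<otimes> u i))"
proof (rule ccontr)
  define W where "W i = \<phi> (x \<otimes> u i)" for i
  assume "\<not> convergent (\<lambda>i. \<phi> (x \<otimes> u i))"
  then have "\<not> Cauchy W" by (simp add: Cauchy_convergent_iff W_def[abs_def])
  then obtain e where e: "e > 0" and far: "\<And>N. \<exists>m\<ge>N. \<exists>n\<ge>N. e \<le> dist (W m) (W n)"
    unfolding Cauchy_def by (auto simp: not_less)
  define Good where "Good a b \<longleftrightarrow> \<phi> (inv u a \<otimes> u b) = c" for a b
  \<comment> \<open>Each pair is chosen so far out that all its inner products with members of the
    earlier pairs have reached the eventual value \<open>c\<close>, while its two values of
    \<open>W\<close> still differ by \<open>e\<close>.\<close>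
  have "\<exists>p :: nat \<Rightarrow> nat \<times> nat. \<forall>k. (\<forall>l<k. Good (fst (p l)) (fst (p k)) \<and> Good (fst (p l)) (snd (p k)) \<and>
      Good (snd (p l)) (fst (p k)) \<and> Good (snd (p l)) (snd (p k))) \<and> e \<le> dist (W (fst (p k))) (W (snd (p k)))"
  proof (rule dependent_wellorder_choice)
    fix k :: nat and f :: "nat \<Rightarrow> nat \<times> nat"
    have "\<forall>\<^sub>F N in sequentially. Good a N" for a
      using ev by (simp add: Good_def)
    then have "\<forall>\<^sub>F N in sequentially. \<forall>l\<in>{..<k}. \<forall>j\<ge>N. Good (fst (f l)) j \<and> Good (snd (f l)) j"
      by (intro eventually_ball_finite ballI eventually_all_ge_at_top eventually_conj) auto
    then obtain N where N: "\<And>l j. l < k \<Longrightarrow> j \<ge> N \<Longrightarrow> Good (fst (f l)) j \<and> Good (snd (f l)) j"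
      by (auto simp: eventually_sequentially)
    obtain m n where "m \<ge> N" "n \<ge> N" "e \<le> dist (W m) (W n)" using far by blast
    then show "\<exists>r. (\<forall>l<k. Good (fst (f l)) (fst r) \<and> Good (fst (f l)) (snd r) \<and>
      Good (snd (f l)) (fst r) \<and> Good (snd (f l)) (snd r)) \<and> e \<le> dist (W (fst r)) (W (snd r))"
      using N by (intro exI[of _ "(m, n)"]) auto
  qed auto
  then obtain p :: "nat \<Rightarrow> nat \<times> nat" where p: "\<forall>k. (\<forall>l<k. Good (fst (p l)) (fst (p k)) \<and> Good (fst (p l)) (snd (p k)) \<and>
      Good (snd (p l)) (fst (p k)) \<and> Good (snd (p l)) (snd (p k))) \<and> e \<le> dist (W (fst (p k))) (W (snd (p k)))" ..
  from p have good: "\<And>k l. l < k \<Longrightarrow> Good (fst (p l)) (fst (p k)) \<and> Good (fst (p l)) (snd (p k)) \<and>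
      Good (snd (p l)) (fst (p k)) \<and> Good (snd (p l)) (snd (p k))"
    and pe: "\<And>k. e \<le> dist (W (fst (p k))) (W (snd (p k)))"
    by auto
  define D where "D k = W (fst (p k)) - W (snd (p k))" for k
  \<comment> \<open>This phase rotates \<open>D k\<close> to its modulus, so the correlations of the
    differences add up without cancellation to at least \<open>n e\<close>.\<close>
  define ph where "ph k = cnj (sgn (D k))" for k
  define cc where "cc = (\<lambda>(k, b). if b then - ph k else ph k)"
  define xx where "xx = (\<lambda>(k, b). u (if b then snd (p k) else fst (p k)))"
  have lam: "cmod (ph k) \<le> 1" for k
    by (simp add: ph_def norm_sgn)
  have lamD: "ph k * D k = of_real (cmod (D k))" for k
  proof (cases "D k = 0")
    case False
    then show ?thesis
      using complex_norm_square[of "D k"]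
      by (simp add: ph_def sgn_eq field_simps power2_eq_square)
  qed simp
  have bound: "real n * e\<^sup>2 \<le> 4" if n: "n > 0" for n
  proof -
    let ?I = "{..<n} \<times> {False, True}"
    have "(\<Sum>i\<in>?I. cc i * \<phi> (x \<otimes> xx i)) = (\<Sum>k<n. ph k * D k)"
      unfolding sum.cartesian_product' by (simp add: cc_def xx_def D_def W_def algebra_simps)
    also have "\<dots> = of_real (\<Sum>k<n. cmod (D k))"
      by (simp add: lamD)
    finally have "cmod (\<Sum>i\<in>?I. cc i * \<phi> (x \<otimes> xx i)) = \<bar>\<Sum>k<n. cmod (D k)\<bar>"
      by (simp only: norm_of_real)
    moreover have "real n * e \<le> (\<Sum>k<n. cmod (D k))"
      using sum_mono[of "{..<n}" "\<lambda>_. e" "\<lambda>k. cmod (D k)"] pe by (simp add: D_def dist_norm)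
    ultimately have "(real n * e)\<^sup>2 \<le> (cmod (\<Sum>i\<in>?I. cc i * \<phi> (x \<otimes> xx i)))\<^sup>2"
      using e n by (intro power_mono) auto
    also have "\<dots> \<le> Re (gram G \<phi> ?I cc xx)"
      using x by (intro positive_definite_Cauchy_Schwarz[OF pd one]) (auto simp: xx_def u)
    also have "gram G \<phi> ?I cc xx = (\<Sum>k<n. \<Sum>l<n. \<Sum>a\<in>{False, True}. \<Sum>b\<in>{False, True}.
        cnj (cc (k, a)) * cc (l, b) * \<phi> (inv (xx (k, a)) \<otimes> xx (l, b)))"
      unfolding gram_def sum.cartesian_product' by (rule sum.cong[OF refl], rule sum.swap)
    also have "\<dots> = (\<Sum>k<n. \<Sum>l<n. if l = k then \<Sum>a\<in>{False, True}. \<Sum>b\<in>{False, True}.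
        cnj (cc (k, a)) * cc (k, b) * \<phi> (inv (xx (k, a)) \<otimes> xx (k, b)) else 0)"
    proof (intro sum.cong refl)
      fix k l
      show "(\<Sum>a\<in>{False, True}. \<Sum>b\<in>{False, True}. cnj (cc (k, a)) * cc (l, b) * \<phi> (inv (xx (k, a)) \<otimes> xx (l, b)))
        = (if l = k then \<Sum>a\<in>{False, True}. \<Sum>b\<in>{False, True}.
        cnj (cc (k, a)) * cc (k, b) * \<phi> (inv (xx (k, a)) \<otimes> xx (k, b)) else 0)"
      proof (cases "l = k")
        case False
        have *: "\<phi> (inv u a \<otimes> u b) = cnj c" if "Good b a" for a b
          using positive_definite_inv[OF pd, of "inv u b \<otimes> u a"] that u
          by (simp add: Good_def inv_mult_group)
        \<comment> \<open>For two different pairs all four inner products coincide, so the opposite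
          signs within a pair make the block cancel. For reversed order the common value is the
          conjugate of \<open>c\<close>.\<close>
        have "\<exists>z. \<forall>a b. \<phi> (inv (xx (k, a)) \<otimes> xx (l, b)) = z"
        proof (cases "k < l")
          case True
          then show ?thesis using good[OF True] by (intro exI[of _ c]) (auto simp: xx_def Good_def)
        next
          case 2: False
          then have "l < k" using False by simp
          from good[OF this] show ?thesis by (intro exI[of _ "cnj c"]) (auto simp: xx_def *)
        qed
        then obtain z where "\<And>a b. \<phi> (inv (xx (k, a)) \<otimes> xx (l, b)) = z" by blast
        then show ?thesis using False by (simp add: cc_def)
      qed simp
    qed
    also have "\<dots> = (\<Sum>k<n. \<Sum>a\<in>{False, True}. \<Sum>b\<in>{False, True}.
        cnj (cc (k, a)) * cc (k, b) * \<phi> (inv (xx (k, a)) \<otimes> xx (k, b)))"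
      by (intro sum.cong refl) (simp add: sum.delta)
    \<comment> \<open>A diagonal block has four terms of modulus at most 1. Hence
      \<open>(n e)^2 \<le> 4 n\<close>, which fails for large \<open>n\<close>.\<close>
    also have "Re \<dots> \<le> (\<Sum>k<n. 4)"
    proof -
      have "cmod (cnj (cc (k, a)) * cc (k, b) * \<phi> (inv (xx (k, a)) \<otimes> xx (k, b))) \<le> 1 * 1 * 1" for k a b
        unfolding norm_mult using lam[of k] u
        by (intro mult_mono positive_definite_norm_le[OF pd one]) (auto simp: cc_def xx_def)
      then have "Re (cnj (cc (k, a)) * cc (k, b) * \<phi> (inv (xx (k, a)) \<otimes> xx (k, b))) \<le> 1" for k a b
        unfolding mult_1 by (rule order_trans[OF complex_Re_le_cmod])
      then have "(\<Sum>a\<in>{False, True}. \<Sum>b\<in>{False, True}.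
        Re (cnj (cc (k, a)) * cc (k, b) * \<phi> (inv (xx (k, a)) \<otimes> xx (k, b)))) \<le> (\<Sum>a\<in>{False, True}. \<Sum>b\<in>{False, True}. 1)" for k
        by (intro sum_mono)
      then show ?thesis
        unfolding Re_sum by (intro sum_mono) simp
    qed
    finally have "real n * (real n * e\<^sup>2) \<le> real n * 4"
      by (simp add: power2_eq_square algebra_simps)
    then show ?thesis using n by simp
  qed
  obtain n :: nat where "4 / e\<^sup>2 < n" using reals_Archimedean2 by blast
  then have "4 < real n * e\<^sup>2" using e by (simp add: field_simps)
  moreover from this have "n > 0" by (cases n) auto
  ultimately show False using bound[of n] by simp
qed

text \<open>The limit \<open>W\<close> exists by \<open>positive_definite_convergent\<close>. Being
  a pointwise limit of perturbations by \<open>b i\<close>, the combination of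
  \<open>\<phi>\<close>, \<open>W\<close> and the adjoint of \<open>W\<close> is positive definite.
  Once \<open>W\<close> is a class function, \<open>character_dominates\<close> forces it to be a
  multiple of \<open>\<phi>\<close>, and the factor is read off at the identity.\<close>

lemma character_mult_limit:
  fixes b :: "nat \<Rightarrow> 'a"
  assumes \<phi>: "\<phi> \<in> characters G"
    and b: "\<And>i. b i \<in> carrier G"
    and ev: "\<And>y i. y \<in> carrier G \<Longrightarrow> \<forall>\<^sub>F j in sequentially. \<phi> (inv b i \<otimes> (inv y \<otimes> b j \<otimes> y)) = c"
    and d: "\<And>i. \<phi> (b i) = d"
    and x: "x \<in> carrier G"
  shows "(\<lambda>i. \<phi> (x \<otimes> b i)) \<longlonglongrightarrow> d * \<phi> x"
proof -
  have tr: "\<phi> \<in> traces G" using \<phi> characters_subset_traces by blast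
  then have pd: "positive_definite G \<phi>" and cl: "class_function G \<phi>" and one: "\<phi> \<one> = 1"
    by (auto simp: traces_iff)
  define W where "W z = lim (\<lambda>i. \<phi> (z \<otimes> b i))" for z
  have ev1: "\<forall>\<^sub>F j in sequentially. \<phi> (inv b i \<otimes> b j) = c" for i
    using ev[OF one_closed, of i] b by simp
  have W: "(\<lambda>i. \<phi> (z \<otimes> b i)) \<longlonglongrightarrow> W z" if "z \<in> carrier G" for z
    unfolding W_def using positive_definite_convergent[OF pd one b ev1 that] by (simp add: convergent_LIMSEQ_iff)
  have Wconj: "W (y \<otimes> z \<otimes> inv y) = W z" if y: "y \<in> carrier G" and z: "z \<in> carrier G" for y z
  proof -
    \<comment> \<open>Interleaving \<open>b\<close> with its conjugate by \<open>y\<close> gives a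
      sequence to which the convergence lemma still applies. Both subsequences must then have the
      same limit, which is conjugation invariance of \<open>W\<close>.\<close>
    define w where "w i = (if even i then b (i div 2) else inv y \<otimes> b (i div 2) \<otimes> y)" for i
    have wc: "w i \<in> carrier G" for i using b y by (simp add: w_def)
    have div2: "filterlim (\<lambda>j::nat. j div 2) sequentially sequentially"
      by (rule filterlim_at_top_div_const_nat) simp
    have e2: "\<forall>\<^sub>F j in sequentially. \<phi> (inv (w i) \<otimes> b j) = c \<and> \<phi> (inv (w i) \<otimes> (inv y \<otimes> b j \<otimes> y)) = c" for i
    proof (cases "even i")
      case True
      then show ?thesis
        using ev1[of "i div 2"] ev[OF y, of "i div 2"] by (simp add: w_def eventually_conj)
    next
      case False
      let ?i = "i div 2"
      have 1: "\<phi> (inv (inv y \<otimes> b ?i \<otimes> y) \<otimes> b j) = \<phi> (inv b ?i \<otimes> (inv (inv y) \<otimes> b j \<otimes> inv y))" for j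
        using class_function_commute[OF cl, of "inv y" "inv b ?i \<otimes> (y \<otimes> b j)"] y b
        by (simp add: inv_mult_group m_assoc)
      have 2: "\<phi> (inv (inv y \<otimes> b ?i \<otimes> y) \<otimes> (inv y \<otimes> b j \<otimes> y)) = \<phi> (inv b ?i \<otimes> b j)" for j
      proof -
        have "inv (inv y \<otimes> b ?i \<otimes> y) \<otimes> (inv y \<otimes> b j \<otimes> y) = inv y \<otimes> (inv b ?i \<otimes> b j) \<otimes> inv (inv y)"
          using y b inv_solve_left by (simp add: inv_mult_group m_assoc) (simp add: m_assoc[symmetric])
        then show ?thesis using cl y b by (metis class_function_def inv_closed m_closed)
      qed
      show ?thesis
        using ev1[of ?i] ev[OF inv_closed[OF y], of ?i] False
        by (simp add: w_def 1 2 eventually_conj)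
    qed
    have "\<forall>\<^sub>F j in sequentially. \<phi> (inv (w i) \<otimes> w j) = c" for i
      using eventually_compose_filterlim[OF e2[of i] div2] by eventually_elim (simp add: w_def[of j for j])
    from positive_definite_convergent[OF pd one wc this z]
    obtain L where L: "(\<lambda>i. \<phi> (z \<otimes> w i)) \<longlonglongrightarrow> L" by (auto simp: convergent_def)
    have "(\<lambda>i. \<phi> (z \<otimes> b i)) \<longlonglongrightarrow> L"
      using LIMSEQ_subseq_LIMSEQ[OF L, of "\<lambda>i. 2 * i"] by (simp add: strict_mono_def o_def w_def)
    then have "L = W z" using W[OF z] LIMSEQ_unique by blast
    have "(\<lambda>i. \<phi> (z \<otimes> (inv y \<otimes> b i \<otimes> y))) \<longlonglongrightarrow> L"
      using LIMSEQ_subseq_LIMSEQ[OF L, of "\<lambda>i. Suc (2 * i)"] by (simp add: strict_mono_def o_def w_def)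
    moreover have "\<phi> (z \<otimes> (inv y \<otimes> b i \<otimes> y)) = \<phi> (y \<otimes> z \<otimes> inv y \<otimes> b i)" for i
      using class_function_commute[OF cl, of "z \<otimes> inv y \<otimes> b i" y] y z b by (simp add: m_assoc)
    ultimately have "L = W (y \<otimes> z \<otimes> inv y)"
      using W[of "y \<otimes> z \<otimes> inv y"] y z LIMSEQ_unique by simp
    with \<open>L = W z\<close> show ?thesis by simp
  qed
  define W' where "W' z = cnj (W (inv z))" for z
  have clW: "class_function G W"
    using Wconj by (simp add: class_function_def)
  have clW': "class_function G W'"
    unfolding class_function_def
  proof (intro ballI)
    fix g h assume g: "g \<in> carrier G" "h \<in> carrier G"
    then have "inv (h \<otimes> g \<otimes> inv h) = h \<otimes> inv g \<otimes> inv h" by (simp add: inv_mult_group m_assoc)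
    then show "W' (h \<otimes> g \<otimes> inv h) = W' g" using Wconj[of h "inv g"] g by (simp add: W'_def)
  qed
  have W1: "W \<one> = d"
    using W[OF one_closed] b d by (simp add: LIMSEQ_const_iff)
  have "W x = W \<one> * \<phi> x"
  proof (rule character_dominates[OF \<phi> clW clW' _ _ _ x])
    fix l :: complex assume l: "cmod l = 1"
    have *: "(\<lambda>i. cnj (\<phi> (inv z \<otimes> b i))) \<longlonglongrightarrow> W' z" if "z \<in> carrier G" for z
      unfolding W'_def using W[of "inv z"] that by (intro tendsto_cnj) simp
    have **: "\<phi> (inv b i \<otimes> z) = cnj (\<phi> (inv z \<otimes> b i))" if "z \<in> carrier G" for i z
      using trace_inv[OF tr, of "inv z \<otimes> b i"] that b by (simp add: inv_mult_group)
    show "positive_definite G (\<lambda>x. 5 * \<phi> x + 2 * l * W x + 2 * cnj l * W' x)"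
    proof (rule positive_definite_limit[OF is_group positive_definite_perturb[OF pd cl b l]])
      fix z assume z: "z \<in> carrier G"
      show "(\<lambda>n. 5 * \<phi> z + 2 * l * \<phi> (z \<otimes> b n) + 2 * cnj l * \<phi> (inv b n \<otimes> z))
        \<longlonglongrightarrow> 5 * \<phi> z + 2 * l * W z + 2 * cnj l * W' z"
        unfolding **[OF z] by (intro tendsto_intros W z *)
    qed
  next
    show "W' \<one> = cnj (W \<one>)" by (simp add: W'_def)
    show "cmod (W \<one>) \<le> 1" unfolding W1 using trace_norm_le[OF tr b] d by metis
  qed
  then show ?thesis using W[OF x] W1 by simp
qed

text \<open>The vectors \<open>x i - d\<close> are orthogonal for \<open>\<phi>\<close>, so the sum
  of \<open>n\<close> of them has squared norm at most \<open>n\<close>. For \<open>\<psi>\<close>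
  its inner product with the identity is \<open>n (e - d)\<close>. Since
  \<open>(1 - t) \<psi>\<close> is dominated by \<open>\<phi>\<close>, Cauchy-Schwarz for
  \<open>\<psi>\<close> gives \<open>(1 - t) n^2 |e - d|^2 \<le> n\<close>.\<close>

lemma dominated_trace_value:
  fixes x :: "nat \<Rightarrow> 'a"
  assumes tr: "\<phi> \<in> traces G" "\<psi> \<in> traces G" "\<theta> \<in> traces G"
    and t: "0 < (t::real)" "t < 1"
    and eq: "\<And>g. g \<in> carrier G \<Longrightarrow> \<phi> g = of_real (1 - t) * \<psi> g + of_real t * \<theta> g"
    and x: "\<And>i. x i \<in> carrier G"
    and orth: "\<And>i j. i \<noteq> j \<Longrightarrow> \<phi> (inv x i \<otimes> x j) = cnj d * d"
    and d: "\<And>i. \<phi> (x i) = d" and e: "\<And>i. \<psi> (x i) = e"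
  shows "e = d"
proof (rule ccontr)
  assume "e \<noteq> d"
  have pd: "positive_definite G \<phi>" "positive_definite G \<psi>" "positive_definite G \<theta>"
    and one: "\<phi> \<one> = 1" "\<psi> \<one> = 1" using tr by (auto simp: traces_iff)
  have bound: "(1 - t) * real n * (cmod (e - d))\<^sup>2 \<le> 1" if n: "n > 0" for n
  proof -
    \<comment> \<open>Index \<open>n\<close> stands for the identity element with coefficient
      \<open>- n d\<close>, which collects the \<open>n\<close> subtracted constants.\<close>
    define c where "c i = (if i = n then - of_nat n * d else 1)" for i
    define y where "y i = (if i = n then \<one> else x i)" for i
    have yc: "y ` {..n} \<subseteq> carrier G" using x by (auto simp: y_def)
    have cy: "(\<Sum>j<n. c j * F (y j)) = (\<Sum>j<n. F (x j))" for F
      by (intro sum.cong refl) (auto simp: c_def y_def)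
    have ins: "{..n} = insert n {..<n}" by auto
    have "gram G \<phi> {..<n} c y = (\<Sum>i<n. \<Sum>j<n. cnj d * d + (if j = i then 1 - cnj d * d else 0))"
      unfolding gram_def by (intro sum.cong refl) (auto simp: c_def y_def orth x one)
    also have "\<dots> = of_nat n * of_nat n * (cnj d * d) + of_nat n * (1 - cnj d * d)"
      by (simp add: sum.distrib algebra_simps)
    finally have g: "gram G \<phi> {..<n} c y = of_nat n * of_nat n * (cnj d * d) + of_nat n * (1 - cnj d * d)" .
    have dd: "cnj d * d = of_real ((cmod d)\<^sup>2)"
      using complex_norm_square[of d] by (simp add: mult.commute)
    have "gram G \<phi> {..n} c y = of_real ((cmod (c n))\<^sup>2) * \<phi> \<one>
        + of_real (2 * Re (cnj (c n) * (\<Sum>j<n. c j * \<phi> (inv y n \<otimes> y j)))) + gram G \<phi> {..<n} c y"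
      unfolding ins by (rule gram_insert_pd[OF pd(1)]) (use yc ins in auto)
    also have "(\<Sum>j<n. c j * \<phi> (inv y n \<otimes> y j)) = (\<Sum>j<n. \<phi> (x j))"
      by (subst cy) (simp add: y_def x)
    also have "\<dots> = of_nat n * d" by (simp add: d)
    also have "cnj (c n) * (of_nat n * d) = of_real (- (real n * real n * (cmod d)\<^sup>2))"
      using dd by (simp add: c_def)
    also have "(cmod (c n))\<^sup>2 = real n * real n * (cmod d)\<^sup>2"
      by (simp add: c_def norm_mult power2_eq_square)
    finally have "gram G \<phi> {..n} c y = of_real (real n * (1 - (cmod d)\<^sup>2))"
      unfolding g dd one by (simp add: algebra_simps)
    then have "Re (gram G \<phi> {..n} c y) = real n * (1 - (cmod d)\<^sup>2)"
      by (simp only: Re_complex_of_real)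
    also have "\<dots> \<le> real n" using n by (simp add: algebra_simps)
    finally have 1: "Re (gram G \<phi> {..n} c y) \<le> real n" .
    have "gram G \<phi> {..n} c y = of_real (1 - t) * gram G \<psi> {..n} c y + of_real t * gram G \<theta> {..n} c y"
    proof -
      have "gram G \<phi> {..n} c y = (\<Sum>i\<in>{..n}. \<Sum>j\<in>{..n}. of_real (1 - t) * (cnj (c i) * c j * \<psi> (inv y i \<otimes> y j))
        + of_real t * (cnj (c i) * c j * \<theta> (inv y i \<otimes> y j)))"
        unfolding gram_def
        by (intro sum.cong refl, subst eq) (use x in \<open>auto simp: algebra_simps y_def\<close>)
      then show ?thesis by (simp only: gram_def sum.distrib sum_distrib_left)
    qed
    moreover have "Re (gram G \<theta> {..n} c y) \<ge> 0"
      using positive_definiteD[OF pd(3), of "{..n}" y c] yc by (simp add: complex_nonneg_Reals_iff)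
    ultimately have 2: "(1 - t) * Re (gram G \<psi> {..n} c y) \<le> real n"
      using 1 t by simp (smt (verit) mult_nonneg_nonneg)
    have "(\<Sum>i\<in>{..n}. c i * \<psi> (\<one> \<otimes> y i)) = (\<Sum>i\<in>{..n}. c i * \<psi> (y i))"
      by (intro sum.cong refl) (use x in \<open>auto simp: y_def\<close>)
    also have "\<dots> = c n * \<psi> (y n) + (\<Sum>i<n. \<psi> (x i))"
      unfolding ins cy[symmetric] by simp
    also have "\<dots> = of_nat n * (e - d)" by (simp add: c_def y_def one e algebra_simps)
    finally have "(cmod (of_nat n * (e - d)))\<^sup>2 \<le> Re (gram G \<psi> {..n} c y)"
      using positive_definite_Cauchy_Schwarz[OF pd(2) one(2) _ yc one_closed, of c] by simp
    then have "(1 - t) * (cmod (of_nat n * (e - d)))\<^sup>2 \<le> real n"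
      using 2 t by (smt (verit) mult_left_mono)
    moreover have "cmod (of_nat n * (e - d)) = real n * cmod (e - d)"
      by (simp only: norm_mult norm_of_nat)
    ultimately have "(1 - t) * (real n * cmod (e - d))\<^sup>2 \<le> real n"
      by (simp only:)
    then have "real n * ((1 - t) * real n * (cmod (e - d))\<^sup>2) \<le> real n * 1"
      by (simp add: power2_eq_square algebra_simps)
    then show ?thesis using n by simp
  qed
  define r where "r = (1 - t) * (cmod (e - d))\<^sup>2"
  have r: "r > 0" using t \<open>e \<noteq> d\<close> by (simp add: r_def)
  obtain n :: nat where "1 / r < n" using reals_Archimedean2 by blast
  then have "1 < real n * r" "n > 0" using r by (auto simp: field_simps intro: Nat.gr0I)
  with bound[of n] show False by (simp add: r_def algebra_simps)
qed

end

section \<open>Finitary even permutations\<close>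

lemma mem_alt_fin:
  "p \<in> carrier (alt_fin S) \<longleftrightarrow> p permutes S \<and> finite {x. p x \<noteq> x} \<and> evenperm p"
  by (simp add: alt_fin_def)

lemma permutation_of_finite_support:
  assumes "p permutes S" "finite {x. p x \<noteq> x}"
  shows "permutation p"
  using assms by (simp add: permutation permutes_bij)

lemma alt_fin_permutation: "p \<in> carrier (alt_fin S) \<Longrightarrow> permutation p"
  by (auto simp: mem_alt_fin intro: permutation_of_finite_support)

lemma alt_fin_bij: "p \<in> carrier (alt_fin S) \<Longrightarrow> bij p"
  using permutes_bij by (auto simp: mem_alt_fin)

lemma alt_fin_id: "id \<in> carrier (alt_fin S)"
  by (simp add: mem_alt_fin permutes_id evenperm_id)

lemma alt_fin_comp:
  assumes "p \<in> carrier (alt_fin S)" "q \<in> carrier (alt_fin S)"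
  shows "p \<circ> q \<in> carrier (alt_fin S)"
proof -
  have "{x. (p \<circ> q) x \<noteq> x} \<subseteq> {x. p x \<noteq> x} \<union> {x. q x \<noteq> x}" by auto
  then have "finite {x. (p \<circ> q) x \<noteq> x}"
    using assms by (auto simp: mem_alt_fin intro: finite_subset)
  then show ?thesis
    using assms evenperm_comp[OF alt_fin_permutation alt_fin_permutation, OF assms]
    by (simp add: mem_alt_fin permutes_compose)
qed

lemma alt_fin_inv:
  assumes "p \<in> carrier (alt_fin S)"
  shows "inv_into UNIV p \<in> carrier (alt_fin S)"
proof -
  have "{x. inv_into UNIV p x \<noteq> x} = {x. p x \<noteq> x}"
    using alt_fin_bij[OF assms] by (auto simp: bij_inv_eq_iff) (metis bij_inv_eq_iff)+
  then show ?thesis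
    using assms evenperm_inv[OF alt_fin_permutation[OF assms]]
    by (simp add: mem_alt_fin permutes_inv)
qed

lemma group_alt_fin: "group (alt_fin S)"
proof (rule groupI)
  fix p assume p: "p \<in> carrier (alt_fin S)"
  then have "inv_into UNIV p \<circ> p = id" using alt_fin_bij bij_is_inj inv_o_cancel by blast
  then show "\<exists>q\<in>carrier (alt_fin S). q \<otimes>\<^bsub>alt_fin S\<^esub> p = \<one>\<^bsub>alt_fin S\<^esub>"
    using alt_fin_inv[OF p] by (auto simp: alt_fin_def)
qed (use alt_fin_comp alt_fin_id in \<open>auto simp: alt_fin_def comp_assoc\<close>)

lemma mult_alt_fin: "p \<otimes>\<^bsub>alt_fin S\<^esub> q = p \<circ> q"
  by (simp add: alt_fin_def)

lemma one_alt_fin: "\<one>\<^bsub>alt_fin S\<^esub> = id"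
  by (simp add: alt_fin_def)

lemma inv_alt_fin:
  assumes "p \<in> carrier (alt_fin S)"
  shows "inv\<^bsub>alt_fin S\<^esub> p = inv_into UNIV p"
proof -
  interpret group "alt_fin S" by (rule group_alt_fin)
  have "inv_into UNIV p \<circ> p = id" using alt_fin_bij[OF assms] bij_is_inj inv_o_cancel by blast
  then show ?thesis
    using inv_equality[of "inv_into UNIV p" p] assms alt_fin_inv[OF assms]
    by (simp add: mult_alt_fin one_alt_fin)
qed

lemma alt_fin_image_subset: "p \<in> carrier (alt_fin S) \<Longrightarrow> X \<subseteq> S \<Longrightarrow> p ` X \<subseteq> S"
  by (auto simp: mem_alt_fin permutes_in_image)

lemma alt_fin_inv_apply:
  assumes "p \<in> carrier (alt_fin S)"
  shows "inv_into UNIV p (p x) = x" "p (inv_into UNIV p x) = x"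
  using alt_fin_bij[OF assms] by (simp_all add: bij_is_inj bij_is_surj surj_f_inv_f)

lemma transpose_comp_alt_fin:
  assumes "p permutes S" "finite {x. p x \<noteq> x}" "\<not> evenperm p" "a \<in> S" "b \<in> S" "a \<noteq> b"
  shows "p \<circ> Transposition.transpose a b \<in> carrier (alt_fin S)"
proof -
  have "{x. (p \<circ> Transposition.transpose a b) x \<noteq> x} \<subseteq> {a, b} \<union> {x. p x \<noteq> x}"
    by (auto simp: Transposition.transpose_def split: if_splits)
  then have "finite {x. (p \<circ> Transposition.transpose a b) x \<noteq> x}"
    using assms(2) by (auto intro: finite_subset)
  moreover have "evenperm (p \<circ> Transposition.transpose a b)"
    using evenperm_comp[OF permutation_of_finite_support[OF assms(1,2)], of "Transposition.transpose a b"] assms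
    by (simp add: permutation_swap_id evenperm_swap)
  ultimately show ?thesis
    using assms by (simp add: mem_alt_fin permutes_compose permutes_swap_id)
qed

section \<open>Even permutations with prescribed values on finite sets\<close>

text \<open>The complements of \<open>X\<close> and of \<open>f X\<close> in their union
  \<open>Y\<close> have equally many elements, so \<open>f\<close> completes to a permutation of
  \<open>Y\<close>. If that is odd, precomposing with a transposition of two points of
  \<open>S\<close> off \<open>X\<close> corrects the sign without touching \<open>X\<close>;
  infinity of \<open>S\<close> supplies these points.\<close>

lemma ex_alt_fin_extending:
  assumes S: "infinite S" and X: "finite X" "X \<subseteq> S" and f: "inj_on f X" "f ` X \<subseteq> S"
  shows "\<exists>p\<in>carrier (alt_fin S). \<forall>x\<in>X. p x = f x"
proof -
  define Y where "Y = X \<union> f ` X"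
  have Y: "finite Y" "Y \<subseteq> S" "X \<subseteq> Y" "f ` X \<subseteq> Y" using X f by (auto simp: Y_def)
  have "card (Y - X) = card (Y - f ` X)"
    using Y X f by (simp add: card_Diff_subset card_image)
  then obtain h where h: "bij_betw h (Y - X) (Y - f ` X)"
    using Y by (metis finite_Diff finite_same_card_bij)
  define p where "p x = (if x \<in> X then f x else if x \<in> Y then h x else x)" for x
  have "bij_betw p X (f ` X)"
    using f by (auto simp: bij_betw_def p_def inj_on_def)
  moreover have "bij_betw p (Y - X) (Y - f ` X)"
    using h by (rule bij_betw_cong[THEN iffD1, rotated]) (auto simp: p_def)
  ultimately have "bij_betw p (X \<union> (Y - X)) (f ` X \<union> (Y - f ` X))"
    by (rule bij_betw_combine) auto
  moreover have "X \<union> (Y - X) = Y" "f ` X \<union> (Y - f ` X) = Y" using Y by auto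
  ultimately have "p permutes Y"
    using Y by (intro bij_imp_permutes) (auto simp: p_def)
  then have p: "p permutes S" and fin: "finite {x. p x \<noteq> x}"
    using Y permutes_subset by (blast, auto intro: finite_subset[of _ Y] simp: permutes_def)
  have pX: "p x = f x" if "x \<in> X" for x using that by (simp add: p_def)
  show ?thesis
  proof (cases "evenperm p")
    case True
    then show ?thesis using p fin pX by (intro bexI[of _ p]) (auto simp: mem_alt_fin)
  next
    case False
    obtain a where a: "a \<in> S - X" using S X by (metis Diff_infinite_finite all_not_in_conv finite.emptyI)
    obtain b where b: "b \<in> S - insert a X" using S X
      by (metis Diff_infinite_finite all_not_in_conv finite.emptyI finite_insert)
    have "p \<circ> Transposition.transpose a b \<in> carrier (alt_fin S)"
      using a b by (intro transpose_comp_alt_fin p fin False) auto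
    moreover have "(p \<circ> Transposition.transpose a b) x = f x" if "x \<in> X" for x
      using that a b pX by (auto simp: Transposition.transpose_def)
    ultimately show ?thesis by blast
  qed
qed

text \<open>A greedy choice gives distinct points avoiding \<open>Z\<close> and mutually unrelated
  by \<open>R\<close>; this sequence is cut into blocks of length \<open>card X\<close>. The
  relation is empty when only disjoint copies are wanted. Taking \<open>R s t\<close> to be
  \<open>s = h t\<close> also keeps all copies apart from the translates of all copies by
  \<open>h\<close>.\<close>

lemma ex_block_sequence:
  assumes S: "infinite S" and X: "finite X" "X \<subseteq> S" and Z: "finite Z"
    and R: "\<And>F. finite F \<Longrightarrow> \<exists>s\<in>S - F. \<not> R s s \<and> (\<forall>t\<in>F. \<not> R s t \<and> \<not> R t s)"
  obtains p :: "nat \<Rightarrow> 'a \<Rightarrow> 'a"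
  where "\<And>i. p i \<in> carrier (alt_fin S)" "\<And>i. p i ` X \<inter> Z = {}"
    "\<And>i j. i \<noteq> j \<Longrightarrow> p i ` X \<inter> p j ` X = {}"
    "\<And>i j x y. x \<in> p i ` X \<Longrightarrow> y \<in> p j ` X \<Longrightarrow> \<not> R x y"
proof -
  have "\<exists>e :: nat \<Rightarrow> 'a. \<forall>n. e n \<in> S - (Z \<union> e ` {..<n}) \<and> \<not> R (e n) (e n) \<and>
      (\<forall>m<n. \<not> R (e n) (e m) \<and> \<not> R (e m) (e n))"
  proof (rule dependent_wellorder_choice)
    fix n :: nat and e :: "nat \<Rightarrow> 'a"
    obtain s where "s \<in> S - (Z \<union> e ` {..<n})" "\<not> R s s" "\<forall>t\<in>Z \<union> e ` {..<n}. \<not> R s t \<and> \<not> R t s"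
      using R[of "Z \<union> e ` {..<n}"] Z by auto
    then show "\<exists>s. s \<in> S - (Z \<union> e ` {..<n}) \<and> \<not> R s s \<and> (\<forall>m<n. \<not> R s (e m) \<and> \<not> R (e m) s)"
      by blast
  next
    fix r :: 'a and f g :: "nat \<Rightarrow> 'a" and n :: nat
    assume "\<And>m. m < n \<Longrightarrow> f m = g m"
    then have "f ` {..<n} = g ` {..<n}" "(\<forall>m<n. \<not> R r (f m) \<and> \<not> R (f m) r) = (\<forall>m<n. \<not> R r (g m) \<and> \<not> R (g m) r)"
      by auto
    then show "(r \<in> S - (Z \<union> f ` {..<n}) \<and> \<not> R r r \<and> (\<forall>m<n. \<not> R r (f m) \<and> \<not> R (f m) r))
      = (r \<in> S - (Z \<union> g ` {..<n}) \<and> \<not> R r r \<and> (\<forall>m<n. \<not> R r (g m) \<and> \<not> R (g m) r))"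
      by simp
  qed
  then obtain e :: "nat \<Rightarrow> 'a" where e: "\<forall>n. e n \<in> S - (Z \<union> e ` {..<n}) \<and> \<not> R (e n) (e n) \<and>
      (\<forall>m<n. \<not> R (e n) (e m) \<and> \<not> R (e m) (e n))" ..
  have eR: "\<not> R (e m) (e n)" for m n using e by (cases m n rule: linorder_cases) auto
  have einj: "e m = e n \<longleftrightarrow> m = n" for m n
  proof (cases m n rule: linorder_cases)
    case less then show ?thesis using e[rule_format, of n] by (metis Diff_iff UnCI imageI lessThan_iff)
  next
    case greater then show ?thesis using e[rule_format, of m] by (metis Diff_iff UnCI imageI lessThan_iff)
  qed simp
  define k where "k = card X"
  obtain \<beta> where \<beta>: "bij_betw \<beta> X {..<k}"
    using X unfolding k_def by (metis card_lessThan finite_lessThan finite_same_card_bij)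
  \<comment> \<open>The bijection \<open>\<beta>\<close> numbers \<open>X\<close> by 0, ...,
    \<open>k - 1\<close>, so division with remainder by \<open>k\<close> recovers the block and the
    position in it.\<close>
  define f where "f i x = e (i * k + \<beta> x)" for i x
  have key: "f i x = f j y \<longleftrightarrow> i = j \<and> x = y" if "x \<in> X" "y \<in> X" for i j x y
  proof -
    have b: "\<beta> x < k" "\<beta> y < k" using \<beta> that by (auto simp: bij_betw_def)
    have "i * k + \<beta> x = j * k + \<beta> y \<Longrightarrow> i = j \<and> \<beta> x = \<beta> y"
    proof -
      assume *: "i * k + \<beta> x = j * k + \<beta> y"
      have "(i * k + \<beta> x) div k = i" "(j * k + \<beta> y) div k = j" using b by auto
      then have "i = j" using * by simp
      then show ?thesis using * by simp
    qed
    moreover have "\<beta> x = \<beta> y \<longleftrightarrow> x = y" using \<beta> that by (auto simp: bij_betw_def inj_on_def)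
    ultimately show ?thesis by (auto simp: f_def einj)
  qed
  have "\<exists>p\<in>carrier (alt_fin S). \<forall>x\<in>X. p x = f i x" for i
    by (rule ex_alt_fin_extending[OF S X]) (use key e in \<open>auto simp: inj_on_def f_def\<close>)
  then obtain p where p: "\<And>i. p i \<in> carrier (alt_fin S)" "\<And>i x. x \<in> X \<Longrightarrow> p i x = f i x"
    by metis
  show ?thesis
  proof (rule that[of p])
    show "p i ` X \<inter> Z = {}" for i using e by (auto simp: p(2) f_def)
    show "i \<noteq> j \<Longrightarrow> p i ` X \<inter> p j ` X = {}" for i j using key by (auto simp: p(2))
    show "x \<in> p i ` X \<Longrightarrow> y \<in> p j ` X \<Longrightarrow> \<not> R x y" for i j x y
      using eR by (auto simp: p(2) f_def)
  qed (rule p(1))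
qed

text \<open>Each point of \<open>Z\<close> lies in at most one of the sets.\<close>

lemma disjoint_sequence_avoids_finite:
  fixes B :: "nat \<Rightarrow> 'a set"
  assumes "\<And>i j. i \<noteq> j \<Longrightarrow> B i \<inter> B j = {}" "finite Z"
  shows "\<forall>\<^sub>F i in sequentially. B i \<inter> Z = {}"
proof -
  have "\<forall>\<^sub>F i in sequentially. z \<notin> B i" for z
  proof (cases "\<exists>i. z \<in> B i")
    case True
    then obtain i where "z \<in> B i" by blast
    then have "z \<notin> B j" if "j > i" for j using assms(1)[of i j] that by auto
    then show ?thesis using eventually_gt_at_top[of i] by (rule eventually_mono[rotated])
  qed auto
  then have "\<forall>\<^sub>F i in sequentially. \<forall>z\<in>Z. z \<notin> B i"
    using assms(2) by (simp add: eventually_ball_finite)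
  then show ?thesis by eventually_elim auto
qed

section \<open>Groups with supports\<close>

text \<open>\<open>L X\<close> is the subgroup of elements supported on \<open>X\<close>, and \<open>P p\<close> is the even permutation \<open>p\<close>
  viewed as an element of \<open>N\<close>, which moves supports by \<open>p\<close>.\<close>

locale supported_group = group N for N (structure) +
  fixes S :: "'a set" and L :: "'a set \<Rightarrow> 'b set" and P :: "('a \<Rightarrow> 'a) \<Rightarrow> 'b"
  assumes infinite_S: "infinite S"
    and L_subgroup: "\<And>X. finite X \<Longrightarrow> X \<subseteq> S \<Longrightarrow> subgroup (L X) N"
    and L_mono: "\<And>X Y. X \<subseteq> Y \<Longrightarrow> L X \<subseteq> L Y"
    and L_cover: "\<And>n. n \<in> carrier N \<Longrightarrow> \<exists>X. finite X \<and> X \<subseteq> S \<and> n \<in> L X"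
    and L_commute: "\<And>X Y a b. finite X \<Longrightarrow> X \<subseteq> S \<Longrightarrow> finite Y \<Longrightarrow> Y \<subseteq> S \<Longrightarrow> X \<inter> Y = {} \<Longrightarrow>
        a \<in> L X \<Longrightarrow> b \<in> L Y \<Longrightarrow> a \<otimes> b = b \<otimes> a"
    and P_hom: "P \<in> hom (alt_fin S) N"
    and P_image: "\<And>p X n. p \<in> carrier (alt_fin S) \<Longrightarrow> finite X \<Longrightarrow> X \<subseteq> S \<Longrightarrow> n \<in> L X \<Longrightarrow>
        P p \<otimes> n \<otimes> inv P p \<in> L (p ` X)"
    and P_fix: "\<And>p X n. p \<in> carrier (alt_fin S) \<Longrightarrow> finite X \<Longrightarrow> X \<subseteq> S \<Longrightarrow> n \<in> L X \<Longrightarrow>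
        (\<And>x. x \<in> X \<Longrightarrow> p x = x) \<Longrightarrow> P p \<otimes> n = n \<otimes> P p"
begin

definition ad :: "('a \<Rightarrow> 'a) \<Rightarrow> 'b \<Rightarrow> 'b" where
  "ad p n = P p \<otimes> n \<otimes> inv P p"

lemma L_closed: "finite X \<Longrightarrow> X \<subseteq> S \<Longrightarrow> n \<in> L X \<Longrightarrow> n \<in> carrier N"
  by (rule subgroup.mem_carrier[OF L_subgroup])

lemma P_closed: "p \<in> carrier (alt_fin S) \<Longrightarrow> P p \<in> carrier N"
  using P_hom by (auto simp: hom_def)

lemma P_comp: "p \<in> carrier (alt_fin S) \<Longrightarrow> q \<in> carrier (alt_fin S) \<Longrightarrow> P (p \<circ> q) = P p \<otimes> P q"
  using P_hom by (auto simp: hom_def mult_alt_fin)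

lemma ad_closed: "p \<in> carrier (alt_fin S) \<Longrightarrow> n \<in> carrier N \<Longrightarrow> ad p n \<in> carrier N"
  by (simp add: ad_def P_closed)

lemma ad_L: "p \<in> carrier (alt_fin S) \<Longrightarrow> finite X \<Longrightarrow> X \<subseteq> S \<Longrightarrow> n \<in> L X \<Longrightarrow> ad p n \<in> L (p ` X)"
  by (simp add: ad_def P_image)

lemma conj_mult:
  "g \<in> carrier N \<Longrightarrow> a \<in> carrier N \<Longrightarrow> b \<in> carrier N \<Longrightarrow>
    g \<otimes> (a \<otimes> b) \<otimes> inv g = (g \<otimes> a \<otimes> inv g) \<otimes> (g \<otimes> b \<otimes> inv g)"
  using m_assoc[of "inv g" g "b \<otimes> inv g"] by (simp add: m_assoc)

lemma ad_mult:
  "p \<in> carrier (alt_fin S) \<Longrightarrow> a \<in> carrier N \<Longrightarrow> b \<in> carrier N \<Longrightarrow> ad p (a \<otimes> b) = ad p a \<otimes> ad p b"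
  using conj_mult by (simp add: ad_def P_closed)

lemma ad_inv:
  "p \<in> carrier (alt_fin S) \<Longrightarrow> a \<in> carrier N \<Longrightarrow> ad p (inv a) = inv (ad p a)"
  by (simp add: ad_def P_closed inv_mult_group m_assoc)

lemma ad_comp:
  "p \<in> carrier (alt_fin S) \<Longrightarrow> q \<in> carrier (alt_fin S) \<Longrightarrow> n \<in> carrier N \<Longrightarrow> ad (p \<circ> q) n = ad p (ad q n)"
  by (simp add: ad_def P_comp P_closed inv_mult_group m_assoc)

lemma ad_fix:
  assumes "p \<in> carrier (alt_fin S)" "finite X" "X \<subseteq> S" "n \<in> L X" "\<And>x. x \<in> X \<Longrightarrow> p x = x"
  shows "ad p n = n"
  using P_fix[OF assms] L_closed[OF assms(2-4)] P_closed[OF assms(1)]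
  by (simp add: ad_def m_assoc)

text \<open>The inverse of \<open>q\<close> composed with \<open>p\<close> fixes the support of
  \<open>n\<close> pointwise, hence commutes with \<open>n\<close>. So a copy of \<open>n\<close>
  depends only on where its support is sent.\<close>

lemma ad_agree:
  assumes p: "p \<in> carrier (alt_fin S)" and q: "q \<in> carrier (alt_fin S)"
    and X: "finite X" "X \<subseteq> S" "n \<in> L X" and eq: "\<And>x. x \<in> X \<Longrightarrow> p x = q x"
  shows "ad p n = ad q n"
proof -
  let ?r = "inv_into UNIV q \<circ> p"
  have r: "?r \<in> carrier (alt_fin S)" using alt_fin_comp alt_fin_inv p q by blast
  have "ad ?r n = n"
    using r X by (rule ad_fix) (simp add: eq alt_fin_inv_apply[OF q])
  moreover have "q \<circ> ?r = p" by (auto simp: alt_fin_inv_apply[OF q])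
  ultimately show ?thesis using ad_comp[OF q r L_closed[OF X]] by simp
qed

text \<open>A trace is invariant only under simultaneous conjugation of both factors. Gluing
  \<open>p\<close> on \<open>X\<close> to \<open>q\<close> on \<open>Y\<close> gives a single
  permutation that moves them independently, so the value on a product of disjoint copies does not
  depend on their position.\<close>

lemma ad_pair:
  assumes p: "p \<in> carrier (alt_fin S)" and q: "q \<in> carrier (alt_fin S)"
    and X: "finite X" "X \<subseteq> S" "a \<in> L X" and Y: "finite Y" "Y \<subseteq> S" "b \<in> L Y"
    and disj: "X \<inter> Y = {}" "p ` X \<inter> q ` Y = {}"
  obtains r where "r \<in> carrier (alt_fin S)" "ad r (a \<otimes> b) = ad p a \<otimes> ad q b"
proof -
  define f where "f x = (if x \<in> X then p x else q x)" for x
  have "inj p" "inj q" using alt_fin_bij bij_is_inj p q by blast+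
  then have inj: "inj_on p X" "inj_on q Y" by (auto intro: inj_on_subset)
  have fX: "f x = p x" if "x \<in> X" for x using that by (simp add: f_def)
  have fY: "f x = q x" if "x \<in> Y" for x using that disj(1) unfolding f_def by (metis disjoint_iff)
  have "inj_on f X" "inj_on f Y" using inj inj_on_cong[of X f p] inj_on_cong[of Y f q] fX fY by auto
  moreover have "f ` (X - Y) \<subseteq> p ` X" "f ` (Y - X) \<subseteq> q ` Y" using fX fY by auto
  then have "f ` (X - Y) \<inter> f ` (Y - X) = {}" using disj(2) by blast
  ultimately have "inj_on f (X \<union> Y)"
    unfolding inj_on_Un by blast
  moreover have "f ` (X \<union> Y) \<subseteq> S"
    using alt_fin_image_subset[OF p X(2)] alt_fin_image_subset[OF q Y(2)] by (auto simp: f_def)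
  ultimately obtain r where r: "r \<in> carrier (alt_fin S)" "\<forall>x\<in>X \<union> Y. r x = f x"
    using ex_alt_fin_extending[OF infinite_S, of "X \<union> Y" f] X Y by blast
  have "ad r a = ad p a" using r by (intro ad_agree[OF r(1) p X]) (auto simp: f_def)
  moreover have "ad r b = ad q b" using r disj by (intro ad_agree[OF r(1) q Y]) (auto simp: f_def)
  moreover have "a \<in> carrier N" "b \<in> carrier N" using L_closed X Y by auto
  ultimately show ?thesis using that r ad_mult by metis
qed

lemma ex_common_support:
  assumes "finite A" "A \<subseteq> carrier N"
  obtains X where "finite X" "X \<subseteq> S" "A \<subseteq> L X"
proof -
  obtain X where X: "\<And>n. n \<in> A \<Longrightarrow> finite (X n) \<and> X n \<subseteq> S \<and> n \<in> L (X n)"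
    using L_cover assms(2) by (metis subsetD)
  have "n \<in> L (\<Union>n\<in>A. X n)" if "n \<in> A" for n
    using L_mono[of "X n" "\<Union>n\<in>A. X n"] X that by blast
  then show ?thesis using that[of "\<Union>n\<in>A. X n"] X assms(1) by blast
qed

section \<open>Extremality as multiplicativity on disjoint supports\<close>

definition mult_on_disjoint :: "('b \<Rightarrow> complex) \<Rightarrow> bool" where
  "mult_on_disjoint \<phi> \<longleftrightarrow> (\<forall>X Y. \<forall>a\<in>L X. \<forall>b\<in>L Y. finite X \<longrightarrow> X \<subseteq> S \<longrightarrow> finite Y \<longrightarrow> Y \<subseteq> S \<longrightarrow>
     X \<inter> Y = {} \<longrightarrow> \<phi> (a \<otimes> b) = \<phi> a * \<phi> b)"

lemma mult_on_disjointD: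
  "mult_on_disjoint \<phi> \<Longrightarrow> finite X \<Longrightarrow> X \<subseteq> S \<Longrightarrow> finite Y \<Longrightarrow> Y \<subseteq> S \<Longrightarrow> X \<inter> Y = {} \<Longrightarrow>
    a \<in> L X \<Longrightarrow> b \<in> L Y \<Longrightarrow> \<phi> (a \<otimes> b) = \<phi> a * \<phi> b"
  unfolding mult_on_disjoint_def by blast

lemma ex_disjoint_copies:
  assumes Y: "finite Y" "Y \<subseteq> S" and Z: "finite Z"
  obtains p :: "nat \<Rightarrow> 'a \<Rightarrow> 'a"
  where "\<And>i. p i \<in> carrier (alt_fin S)" "\<And>i. p i ` Y \<inter> Z = {}"
    "\<And>i j. i \<noteq> j \<Longrightarrow> p i ` Y \<inter> p j ` Y = {}"
proof (rule ex_block_sequence[OF infinite_S Y Z, where R = "\<lambda>_ _. False"])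
  fix F :: "'a set" assume "finite F"
  then show "\<exists>s\<in>S - F. \<not> False \<and> (\<forall>t\<in>F. \<not> False \<and> \<not> False)"
    using infinite_S by (metis Diff_infinite_finite ex_in_conv finite.emptyI)
qed (use that in blast)

text \<open>The ambient group \<open>H\<close> is \<open>N\<close> itself or a semidirect product \<open>G \<ltimes> N\<close>.\<close>

lemma character_mult_on_disjoint:
  assumes H: "group H" and \<iota>: "\<iota> \<in> hom N H" and \<phi>: "\<phi> \<in> characters H"
    and disp: "\<And>y F. y \<in> carrier H \<Longrightarrow> finite F \<Longrightarrow> \<exists>Z. finite Z \<and>
      (\<forall>X b. finite X \<longrightarrow> X \<subseteq> S \<longrightarrow> X \<inter> Z = {} \<longrightarrow> b \<in> L X \<longrightarrow>
        (\<exists>q\<in>carrier (alt_fin S). q ` X \<inter> F = {} \<and>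
          inv\<^bsub>H\<^esub> y \<otimes>\<^bsub>H\<^esub> \<iota> b \<otimes>\<^bsub>H\<^esub> y = \<iota> (ad q b)))"
  shows "mult_on_disjoint (\<phi> \<circ> \<iota>)"
  unfolding mult_on_disjoint_def
proof (intro allI ballI impI)
  interpret H: group H by fact
  interpret \<iota>: group_hom N H \<iota> using H \<iota> by unfold_locales
  have tr: "\<phi> \<in> traces H" using \<phi> characters_subset_traces by blast
  have cl: "\<phi> (\<iota> (ad r n)) = \<phi> (\<iota> n)" if "r \<in> carrier (alt_fin S)" "n \<in> carrier N" for r n
    using tr that P_closed[OF that(1)] by (simp add: ad_def traces_iff class_function_def)
  fix X Y a b
  assume a: "a \<in> L X" and b: "b \<in> L Y" and X: "finite X" "X \<subseteq> S" and Y: "finite Y" "Y \<subseteq> S"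
    and disj: "X \<inter> Y = {}"
  have ac: "a \<in> carrier N" "b \<in> carrier N" using a b X Y L_closed by auto
  obtain p :: "nat \<Rightarrow> 'a \<Rightarrow> 'a" where p: "\<And>i. p i \<in> carrier (alt_fin S)" and pX: "\<And>i. p i ` Y \<inter> X = {}"
    and pp: "\<And>i j. i \<noteq> j \<Longrightarrow> p i ` Y \<inter> p j ` Y = {}"
    using ex_disjoint_copies[OF Y X(1)] by blast
  define B where "B i = \<iota> (ad (p i) b)" for i
  have Bc: "B i \<in> carrier H" for i using ad_closed[OF p ac(2)] by (simp add: B_def)
  \<comment> \<open>Any two disjoint copies of \<open>b\<close> can be carried simultaneously to the
    copies number 0 and 1, so all disjoint pairs have this one correlation.\<close>
  define c where "c = \<phi> (\<iota> (inv (ad (p 0) b) \<otimes> ad (p 1) b))"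
  have c: "\<phi> (\<iota> (inv (ad q b) \<otimes> ad r b)) = c"
    if qr: "q \<in> carrier (alt_fin S)" "r \<in> carrier (alt_fin S)" "q ` Y \<inter> r ` Y = {}" for q r
  proof -
    let ?q = "q \<circ> inv_into UNIV (p 0)" and ?r = "r \<circ> inv_into UNIV (p 1)"
    have qr': "?q \<in> carrier (alt_fin S)" "?r \<in> carrier (alt_fin S)"
      using alt_fin_comp alt_fin_inv p qr by blast+
    have im: "?q ` p 0 ` Y = q ` Y" "?r ` p 1 ` Y = r ` Y"
      by (simp_all add: image_image alt_fin_inv_apply[OF p])
    have sub: "p i ` Y \<subseteq> S" "finite (p i ` Y)" for i using alt_fin_image_subset[OF p Y(2)] Y by auto
    have "inv (ad (p 0) b) \<in> L (p 0 ` Y)"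
      using subgroup.m_inv_closed[OF L_subgroup[OF sub(2,1)]] ad_L[OF p Y b] by blast
    from ad_pair[OF qr' sub(2,1) this sub(2,1) ad_L[OF p Y b, of 1]]
    obtain s where s: "s \<in> carrier (alt_fin S)"
      "ad s (inv (ad (p 0) b) \<otimes> ad (p 1) b) = ad ?q (inv (ad (p 0) b)) \<otimes> ad ?r (ad (p 1) b)"
      using pp[of 0 1] qr(3) unfolding im by auto
    have "?q \<circ> p 0 = q" "?r \<circ> p 1 = r" by (auto simp: alt_fin_inv_apply[OF p])
    then have "ad ?q (inv (ad (p 0) b)) = inv (ad q b)" "ad ?r (ad (p 1) b) = ad r b"
      using ad_inv[OF qr'(1) ad_closed[OF p ac(2)]] ad_comp[OF qr'(1) p ac(2)] ad_comp[OF qr'(2) p ac(2)]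
      by metis+
    then show ?thesis
      using cl[OF s(1)] s(2) ad_closed[OF p ac(2)] by (metis c_def inv_closed m_closed)
  qed
  have "(\<lambda>i. \<phi> (\<iota> a \<otimes>\<^bsub>H\<^esub> B i)) \<longlonglongrightarrow> \<phi> (\<iota> b) * \<phi> (\<iota> a)"
  proof (rule H.character_mult_limit[OF \<phi> Bc])
    fix y i assume y: "y \<in> carrier H"
    obtain Z where Z: "finite Z" "\<And>X b. finite X \<Longrightarrow> X \<subseteq> S \<Longrightarrow> X \<inter> Z = {} \<Longrightarrow> b \<in> L X \<Longrightarrow>
        (\<exists>q\<in>carrier (alt_fin S). q ` X \<inter> p i ` Y = {} \<and> inv\<^bsub>H\<^esub> y \<otimes>\<^bsub>H\<^esub> \<iota> b \<otimes>\<^bsub>H\<^esub> y = \<iota> (ad q b))"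
      using disp[OF y, of "p i ` Y"] Y by auto
    have "\<forall>\<^sub>F j in sequentially. p j ` Y \<inter> Z = {}"
      using disjoint_sequence_avoids_finite[OF pp Z(1)] .
    then show "\<forall>\<^sub>F j in sequentially. \<phi> (inv\<^bsub>H\<^esub> B i \<otimes>\<^bsub>H\<^esub> (inv\<^bsub>H\<^esub> y \<otimes>\<^bsub>H\<^esub> B j \<otimes>\<^bsub>H\<^esub> y)) = c"
    proof eventually_elim
      case (elim j)
      obtain q where q: "q \<in> carrier (alt_fin S)" "q ` p j ` Y \<inter> p i ` Y = {}"
          "inv\<^bsub>H\<^esub> y \<otimes>\<^bsub>H\<^esub> B j \<otimes>\<^bsub>H\<^esub> y = \<iota> (ad q (ad (p j) b))"
        using Z(2)[OF _ alt_fin_image_subset[OF p Y(2)] elim ad_L[OF p Y b]] Y unfolding B_def by blast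
      have "inv\<^bsub>H\<^esub> B i \<otimes>\<^bsub>H\<^esub> (inv\<^bsub>H\<^esub> y \<otimes>\<^bsub>H\<^esub> B j \<otimes>\<^bsub>H\<^esub> y) = \<iota> (inv (ad (p i) b) \<otimes> ad (q \<circ> p j) b)"
        unfolding q(3) using ad_closed[OF p ac(2)] ad_closed[OF q(1)]
        by (simp add: B_def ad_comp[OF q(1) p ac(2)])
      then show ?case
        using c[OF p alt_fin_comp[OF q(1) p], of i j] q(2) by (auto simp: image_comp)
    qed
  next
    show "\<phi> (B i) = \<phi> (\<iota> b)" for i using cl[OF p ac(2)] by (simp add: B_def)
    show "\<iota> a \<in> carrier H" using ac by simp
  qed
  \<comment> \<open>All copies are disjoint from the support of \<open>a\<close>, so the products
    are conjugate to \<open>a b\<close>. The sequence is therefore constant, and its limit is its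
    value.\<close>
  moreover have "\<phi> (\<iota> a \<otimes>\<^bsub>H\<^esub> B i) = \<phi> (\<iota> (a \<otimes> b))" for i
  proof -
    obtain r where r: "r \<in> carrier (alt_fin S)" "ad r (a \<otimes> b) = ad id a \<otimes> ad (p i) b"
      using ad_pair[OF alt_fin_id p X a Y b disj, of i] pX[of i] by auto
    have "ad id a = a" using ad_fix[OF alt_fin_id X a] by simp
    then have "\<iota> a \<otimes>\<^bsub>H\<^esub> B i = \<iota> (ad r (a \<otimes> b))" using r ac ad_closed[OF p ac(2)] by (simp add: B_def)
    then show ?thesis using cl[OF r(1)] ac by simp
  qed
  ultimately show "(\<phi> \<circ> \<iota>) (a \<otimes> b) = (\<phi> \<circ> \<iota>) a * (\<phi> \<circ> \<iota>) b"
    by (simp add: LIMSEQ_const_iff mult.commute)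
qed

text \<open>Elements supported off the support of \<open>y\<close> commute with \<open>y\<close>, so
  conjugation does not displace them at all and the identity permutation serves as
  \<open>q\<close>.\<close>

lemma character_mult_on_disjoint_self:
  assumes "\<phi> \<in> characters N"
  shows "mult_on_disjoint \<phi>"
proof -
  have "mult_on_disjoint (\<phi> \<circ> (\<lambda>x. x))"
  proof (rule character_mult_on_disjoint[OF is_group _ assms])
    show "(\<lambda>x. x) \<in> hom N N" by (simp add: hom_def)
    fix y and F :: "'a set" assume y: "y \<in> carrier N" "finite F"
    obtain Y where Y: "finite Y" "Y \<subseteq> S" "y \<in> L Y" using L_cover y by blast
    have "\<exists>q\<in>carrier (alt_fin S). q ` X \<inter> F = {} \<and> inv y \<otimes> b \<otimes> y = ad q b"
      if X: "finite X" "X \<subseteq> S" "X \<inter> (Y \<union> F) = {}" "b \<in> L X" for X b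
    proof (rule bexI[OF _ alt_fin_id], intro conjI)
      have "b \<otimes> y = y \<otimes> b" using L_commute[OF X(1,2) Y(1,2)] X Y by blast
      then have "inv y \<otimes> b \<otimes> y = b" using y L_closed[OF X(1,2,4)] m_assoc[of "inv y" y b] by (simp add: m_assoc)
      then show "inv y \<otimes> b \<otimes> y = ad id b" using ad_fix[OF alt_fin_id X(1,2,4)] by simp
      show "id ` X \<inter> F = {}" using X by auto
    qed
    then show "\<exists>Z. finite Z \<and> (\<forall>X b. finite X \<longrightarrow> X \<subseteq> S \<longrightarrow> X \<inter> Z = {} \<longrightarrow> b \<in> L X \<longrightarrow>
        (\<exists>q\<in>carrier (alt_fin S). q ` X \<inter> F = {} \<and> inv y \<otimes> b \<otimes> y = ad q b))"
      using Y y by (intro exI[of _ "Y \<union> F"]) auto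
  qed
  then show ?thesis by (simp add: o_def)
qed

lemma trace_ad:
  "\<phi> \<in> traces N \<Longrightarrow> p \<in> carrier (alt_fin S) \<Longrightarrow> n \<in> carrier N \<Longrightarrow> \<phi> (ad p n) = \<phi> n"
  by (simp add: ad_def P_closed traces_iff class_function_def)

lemma character_of_mult_on_disjoint:
  assumes tr: "\<phi> \<in> traces N" and mult: "mult_on_disjoint \<phi>"
  shows "\<phi> \<in> characters N"
proof (rule charactersI[OF tr])
  fix \<psi> \<theta> t g
  assume *: "\<psi> \<in> traces N" "\<theta> \<in> traces N" "0 < (t::real)" "t < 1"
    "\<And>h. h \<in> carrier N \<Longrightarrow> \<phi> h = of_real (1 - t) * \<psi> h + of_real t * \<theta> h" and g: "g \<in> carrier N"
  obtain X where X: "finite X" "X \<subseteq> S" "g \<in> L X" using L_cover g by blast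
  obtain p :: "nat \<Rightarrow> 'a \<Rightarrow> 'a" where p: "\<And>i. p i \<in> carrier (alt_fin S)"
    and "\<And>i. p i ` X \<inter> {} = {}" and pp: "\<And>i j. i \<noteq> j \<Longrightarrow> p i ` X \<inter> p j ` X = {}"
    by (rule ex_disjoint_copies[OF X(1,2) finite.emptyI]) (rule that)
  have sub: "p i ` X \<subseteq> S" "finite (p i ` X)" for i using alt_fin_image_subset[OF p X(2)] X by auto
  show "\<psi> g = \<phi> g"
  proof (rule dominated_trace_value[OF tr *])
    show "ad (p i) g \<in> carrier N" for i using ad_closed[OF p g] .
    show "\<phi> (ad (p i) g) = \<phi> g" "\<psi> (ad (p i) g) = \<psi> g" for i
      using trace_ad[OF tr p g] trace_ad[OF *(1) p g] by auto
    fix i j :: nat assume "i \<noteq> j"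
    have "\<phi> (inv (ad (p i) g) \<otimes> ad (p j) g) = \<phi> (inv (ad (p i) g)) * \<phi> (ad (p j) g)"
      using pp[OF \<open>i \<noteq> j\<close>] ad_L[OF p X] subgroup.m_inv_closed[OF L_subgroup[OF sub(2,1)]]
      by (intro mult_on_disjointD[OF mult sub(2,1) sub(2,1)]) auto
    then show "\<phi> (inv (ad (p i) g) \<otimes> ad (p j) g) = cnj (\<phi> g) * \<phi> g"
      using trace_inv[OF tr] trace_ad[OF tr p g] ad_closed[OF p g] by simp
  qed auto
qed

end

section \<open>Enrichments\<close>

text \<open>The homomorphism may identify points of \<open>S\<close>; this is harmless because
  \<open>gram\<close> is indexed by a family and not by its values.\<close>

lemma (in group_hom) positive_definite_pullback:
  assumes "positive_definite H \<phi>"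
  shows "positive_definite G (\<lambda>x. \<phi> (h x))"
  unfolding positive_definite_iff_gram
proof (intro allI impI)
  fix S c assume S: "finite S" "S \<subseteq> carrier G"
  have "gram G (\<lambda>x. \<phi> (h x)) S c (\<lambda>x. x) = gram H \<phi> S c h"
    using S by (intro gram_cong) (simp add: subset_iff)
  also have "\<dots> \<in> \<real>\<^sub>\<ge>\<^sub>0"
    using S by (intro positive_definiteD[OF assms]) auto
  finally show "gram G (\<lambda>x. \<phi> (h x)) S c (\<lambda>x. x) \<in> \<real>\<^sub>\<ge>\<^sub>0" .
qed

lemma (in group_hom) trace_pullback:
  assumes "\<phi> \<in> traces H"
  shows "(\<lambda>x\<in>carrier G. \<phi> (h x)) \<in> traces G"
proof (rule G.restrict_in_traces)
  show "positive_definite G (\<lambda>x. \<phi> (h x))"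
    using assms by (intro positive_definite_pullback) (simp add: traces_iff)
  show "class_function G (\<lambda>x. \<phi> (h x))"
    using assms by (simp add: traces_iff class_function_def)
  show "\<phi> (h \<one>\<^bsub>G\<^esub>) = 1"
    using assms by (simp add: traces_iff)
qed

text \<open>On the carrier of a group such a \<open>w\<close> has no zeros, as its value at the
  identity is 1; so these are the homomorphisms into the nonzero complex numbers. Values off the
  carrier are irrelevant.\<close>

definition no_linear_character :: "('b, 'k) monoid_scheme \<Rightarrow> bool" where
  "no_linear_character N \<longleftrightarrow> (\<forall>w :: 'b \<Rightarrow> complex. w \<one>\<^bsub>N\<^esub> = 1 \<longrightarrow>
     (\<forall>x\<in>carrier N. \<forall>y\<in>carrier N. w (x \<otimes>\<^bsub>N\<^esub> y) = w x * w y) \<longrightarrow> (\<forall>n\<in>carrier N. w n = 1))"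

text \<open>The essential axiom is \<open>\<alpha>_ad\<close>: on a finite support, \<open>g\<close>
  acts as conjugation by any even permutation that agrees with left translation there. The action is
  thus locally inner although translation itself is not finitary.\<close>

locale enrichment = supported_group N "carrier G" L P + G: group G
  for G :: "('a, 'm) monoid_scheme" and N :: "('b, 'k) monoid_scheme" (structure) and L P +
  fixes \<alpha> :: "'a \<Rightarrow> 'b \<Rightarrow> 'b"
  assumes \<alpha>_hom: "\<And>g. g \<in> carrier G \<Longrightarrow> \<alpha> g \<in> hom N N"
    and \<alpha>_mult: "\<And>g h n. g \<in> carrier G \<Longrightarrow> h \<in> carrier G \<Longrightarrow> n \<in> carrier N \<Longrightarrow> \<alpha> (g \<otimes>\<^bsub>G\<^esub> h) n = \<alpha> g (\<alpha> h n)"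
    and \<alpha>_one: "\<And>n. n \<in> carrier N \<Longrightarrow> \<alpha> \<one>\<^bsub>G\<^esub> n = n"
    and \<alpha>_ad: "\<And>g X n p. g \<in> carrier G \<Longrightarrow> finite X \<Longrightarrow> X \<subseteq> carrier G \<Longrightarrow> n \<in> L X \<Longrightarrow>
        p \<in> carrier (alt_fin (carrier G)) \<Longrightarrow> (\<And>x. x \<in> X \<Longrightarrow> p x = g \<otimes>\<^bsub>G\<^esub> x) \<Longrightarrow>
        \<alpha> g n = P p \<otimes> n \<otimes> inv P p"
    and no_linear_character: "no_linear_character N"
begin

abbreviation "\<Gamma> \<equiv> semidirect_product G N \<alpha>"

definition \<iota> :: "'b \<Rightarrow> 'a \<times> 'b" where "\<iota> n = (\<one>\<^bsub>G\<^esub>, n)"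

lemma \<alpha>_closed: "g \<in> carrier G \<Longrightarrow> n \<in> carrier N \<Longrightarrow> \<alpha> g n \<in> carrier N"
  using \<alpha>_hom by (auto simp: hom_def)

lemma \<alpha>_m: "g \<in> carrier G \<Longrightarrow> n \<in> carrier N \<Longrightarrow> m \<in> carrier N \<Longrightarrow> \<alpha> g (n \<otimes> m) = \<alpha> g n \<otimes> \<alpha> g m"
  using \<alpha>_hom by (auto simp: hom_def)

lemma \<alpha>_group_hom: "g \<in> carrier G \<Longrightarrow> group_hom N N (\<alpha> g)"
  using \<alpha>_hom by unfold_locales

lemma \<alpha>_unit: "g \<in> carrier G \<Longrightarrow> \<alpha> g \<one> = \<one>"
  using group_hom.hom_one[OF \<alpha>_group_hom] .

lemma ex_\<alpha>_eq_ad: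
  assumes g: "g \<in> carrier G" and X: "finite X" "X \<subseteq> carrier G" "n \<in> L X"
  obtains q where "q \<in> carrier (alt_fin (carrier G))" "\<alpha> g n = ad q n" "\<And>x. x \<in> X \<Longrightarrow> q x = g \<otimes>\<^bsub>G\<^esub> x"
proof -
  have "inj_on (\<lambda>x. g \<otimes>\<^bsub>G\<^esub> x) X" using X(2) g by (auto simp: inj_on_def subset_iff)
  moreover have "(\<lambda>x. g \<otimes>\<^bsub>G\<^esub> x) ` X \<subseteq> carrier G" using X(2) g by auto
  ultimately obtain q where q: "q \<in> carrier (alt_fin (carrier G))" "\<forall>x\<in>X. q x = g \<otimes>\<^bsub>G\<^esub> x"
    using ex_alt_fin_extending[OF infinite_S X(1,2)] by blast
  then show ?thesis using that \<alpha>_ad[OF g X q(1)] by (simp add: ad_def)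
qed

lemma \<alpha>_L:
  assumes "g \<in> carrier G" "finite X" "X \<subseteq> carrier G" "n \<in> L X"
  shows "\<alpha> g n \<in> L ((\<lambda>x. g \<otimes>\<^bsub>G\<^esub> x) ` X)"
proof -
  obtain q where q: "q \<in> carrier (alt_fin (carrier G))" "\<alpha> g n = ad q n" "\<And>x. x \<in> X \<Longrightarrow> q x = g \<otimes>\<^bsub>G\<^esub> x"
    using ex_\<alpha>_eq_ad[OF assms] by blast
  have "q ` X = (\<lambda>x. g \<otimes>\<^bsub>G\<^esub> x) ` X" using q(3) by (rule image_cong[OF refl])
  then show ?thesis using ad_L[OF q(1) assms(2-4)] q(2) by simp
qed

text \<open>No invariance under \<open>G\<close> is assumed: \<open>\<alpha> g n\<close> is already
  conjugate to \<open>n\<close> inside \<open>N\<close>.\<close>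

lemma trace_\<alpha>:
  assumes "\<phi> \<in> traces N" "g \<in> carrier G" "n \<in> carrier N"
  shows "\<phi> (\<alpha> g n) = \<phi> n"
proof -
  obtain X where X: "finite X" "X \<subseteq> carrier G" "n \<in> L X" using L_cover assms by blast
  obtain q where "q \<in> carrier (alt_fin (carrier G))" "\<alpha> g n = ad q n"
    using ex_\<alpha>_eq_ad[OF assms(2) X] by blast
  then show ?thesis using trace_ad assms by simp
qed

lemma carrier_\<Gamma>: "carrier \<Gamma> = carrier G \<times> carrier N"
  by (simp add: semidirect_product_def)

lemma mult_\<Gamma>: "(g, n) \<otimes>\<^bsub>\<Gamma>\<^esub> (h, m) = (g \<otimes>\<^bsub>G\<^esub> h, n \<otimes> \<alpha> g m)"
  by (simp add: semidirect_product_def)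

lemma one_\<Gamma>: "\<one>\<^bsub>\<Gamma>\<^esub> = (\<one>\<^bsub>G\<^esub>, \<one>)"
  by (simp add: semidirect_product_def)

lemma group_\<Gamma>: "group \<Gamma>"
proof (rule groupI)
  fix x assume "x \<in> carrier \<Gamma>"
  then obtain g n where x: "x = (g, n)" "g \<in> carrier G" "n \<in> carrier N" by (auto simp: carrier_\<Gamma>)
  then have "(inv\<^bsub>G\<^esub> g, \<alpha> (inv\<^bsub>G\<^esub> g) (inv n)) \<otimes>\<^bsub>\<Gamma>\<^esub> x = \<one>\<^bsub>\<Gamma>\<^esub>"
    by (simp add: mult_\<Gamma> one_\<Gamma> \<alpha>_unit flip: \<alpha>_m)
  then show "\<exists>y\<in>carrier \<Gamma>. y \<otimes>\<^bsub>\<Gamma>\<^esub> x = \<one>\<^bsub>\<Gamma>\<^esub>"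
    using x by (intro bexI) (auto simp: carrier_\<Gamma> \<alpha>_closed)
qed (auto simp: carrier_\<Gamma> mult_\<Gamma> one_\<Gamma> \<alpha>_closed \<alpha>_one \<alpha>_m \<alpha>_mult m_assoc G.m_assoc)

sublocale \<Gamma>: group \<Gamma> by (rule group_\<Gamma>)

lemma inv_\<Gamma>:
  assumes "g \<in> carrier G" "n \<in> carrier N"
  shows "inv\<^bsub>\<Gamma>\<^esub> (g, n) = (inv\<^bsub>G\<^esub> g, \<alpha> (inv\<^bsub>G\<^esub> g) (inv n))"
  using assms by (intro \<Gamma>.inv_equality) (auto simp: carrier_\<Gamma> mult_\<Gamma> one_\<Gamma> \<alpha>_closed \<alpha>_unit simp flip: \<alpha>_m)

sublocale \<iota>: group_hom N \<Gamma> \<iota>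
  by unfold_locales (auto simp: hom_def carrier_\<Gamma> mult_\<Gamma> \<iota>_def \<alpha>_one)

sublocale proj: group_hom \<Gamma> G fst
  by unfold_locales (auto simp: hom_def carrier_\<Gamma> mult_\<Gamma>)

lemma conj_\<iota>:
  assumes "g \<in> carrier G" "n \<in> carrier N" "b \<in> carrier N"
  shows "inv\<^bsub>\<Gamma>\<^esub> (g, n) \<otimes>\<^bsub>\<Gamma>\<^esub> \<iota> b \<otimes>\<^bsub>\<Gamma>\<^esub> (g, n) = \<iota> (\<alpha> (inv\<^bsub>G\<^esub> g) (inv n \<otimes> b \<otimes> n))"
    and "(g, n) \<otimes>\<^bsub>\<Gamma>\<^esub> \<iota> b \<otimes>\<^bsub>\<Gamma>\<^esub> inv\<^bsub>\<Gamma>\<^esub> (g, n) = \<iota> (n \<otimes> \<alpha> g b \<otimes> inv n)"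
proof -
  have *: "\<alpha> g (\<alpha> (inv\<^bsub>G\<^esub> g) (inv n)) = inv n"
    using \<alpha>_mult[of g "inv\<^bsub>G\<^esub> g" "inv n"] assms by (simp add: \<alpha>_one)
  show "inv\<^bsub>\<Gamma>\<^esub> (g, n) \<otimes>\<^bsub>\<Gamma>\<^esub> \<iota> b \<otimes>\<^bsub>\<Gamma>\<^esub> (g, n) = \<iota> (\<alpha> (inv\<^bsub>G\<^esub> g) (inv n \<otimes> b \<otimes> n))"
    "(g, n) \<otimes>\<^bsub>\<Gamma>\<^esub> \<iota> b \<otimes>\<^bsub>\<Gamma>\<^esub> inv\<^bsub>\<Gamma>\<^esub> (g, n) = \<iota> (n \<otimes> \<alpha> g b \<otimes> inv n)"
    using assms * by (simp_all add: inv_\<Gamma> \<iota>_def mult_\<Gamma> \<alpha>_m \<alpha>_closed)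
qed

lemma conj_\<iota>_disjoint:
  assumes g: "g \<in> carrier G" and Y: "finite Y" "Y \<subseteq> carrier G" "n \<in> L Y"
    and X: "finite X" "X \<subseteq> carrier G" "b \<in> L X" and disj: "X \<inter> Y = {}"
  shows "inv\<^bsub>\<Gamma>\<^esub> (g, n) \<otimes>\<^bsub>\<Gamma>\<^esub> \<iota> b \<otimes>\<^bsub>\<Gamma>\<^esub> (g, n) = \<iota> (\<alpha> (inv\<^bsub>G\<^esub> g) b)"
proof -
  have "n \<in> carrier N" "b \<in> carrier N" using L_closed X Y by auto
  moreover from this have "inv n \<otimes> b \<otimes> n = b"
    using L_commute[OF X(1,2) Y(1,2) disj X(3) Y(3)] m_assoc[of "inv n" n b] by (simp add: m_assoc)
  ultimately show ?thesis using conj_\<iota>(1)[OF g] by simp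
qed

lemma character_\<Gamma>_mult_on_disjoint:
  assumes "\<phi> \<in> characters \<Gamma>"
  shows "mult_on_disjoint (\<phi> \<circ> \<iota>)"
proof (rule character_mult_on_disjoint[OF group_\<Gamma> \<iota>.homh assms])
  fix y and F :: "'a set" assume y: "y \<in> carrier \<Gamma>" and F: "finite F"
  obtain g n where gn: "y = (g, n)" "g \<in> carrier G" "n \<in> carrier N" using y by (auto simp: carrier_\<Gamma>)
  obtain Y where Y: "finite Y" "Y \<subseteq> carrier G" "n \<in> L Y" using L_cover gn by blast
  \<comment> \<open>Avoiding \<open>Y\<close> removes the effect of \<open>n\<close>. The remaining
    translation by the inverse of \<open>g\<close> sends a support into \<open>F\<close> only where
    it meets \<open>g F\<close>.\<close>
  let ?Z = "Y \<union> (\<lambda>x. g \<otimes>\<^bsub>G\<^esub> x) ` F"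
  have "\<exists>q\<in>carrier (alt_fin (carrier G)). q ` X \<inter> F = {} \<and>
      inv\<^bsub>\<Gamma>\<^esub> y \<otimes>\<^bsub>\<Gamma>\<^esub> \<iota> b \<otimes>\<^bsub>\<Gamma>\<^esub> y = \<iota> (ad q b)"
    if X: "finite X" "X \<subseteq> carrier G" "X \<inter> ?Z = {}" "b \<in> L X" for X b
  proof -
    obtain q where q: "q \<in> carrier (alt_fin (carrier G))" "\<alpha> (inv\<^bsub>G\<^esub> g) b = ad q b"
      "\<And>x. x \<in> X \<Longrightarrow> q x = inv\<^bsub>G\<^esub> g \<otimes>\<^bsub>G\<^esub> x"
      using ex_\<alpha>_eq_ad[OF G.inv_closed[OF gn(2)] X(1,2,4)] by blast
    have "q x \<notin> F" if "x \<in> X" for x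
    proof
      assume "q x \<in> F"
      then have "g \<otimes>\<^bsub>G\<^esub> q x \<in> ?Z" by blast
      moreover have "g \<otimes>\<^bsub>G\<^esub> q x = x"
        using q(3)[OF that] gn X(2) that G.m_assoc[of g "inv\<^bsub>G\<^esub> g" x] by (auto simp: subset_iff)
      ultimately show False using X(3) that by auto
    qed
    moreover have "inv\<^bsub>\<Gamma>\<^esub> y \<otimes>\<^bsub>\<Gamma>\<^esub> \<iota> b \<otimes>\<^bsub>\<Gamma>\<^esub> y = \<iota> (ad q b)"
      using conj_\<iota>_disjoint[OF gn(2) Y X(1,2,4)] X(3) q(2) gn(1) by auto
    ultimately show ?thesis using q(1) by (intro bexI[of _ q]) auto
  qed
  then show "\<exists>Z. finite Z \<and> (\<forall>X b. finite X \<longrightarrow> X \<subseteq> carrier G \<longrightarrow> X \<inter> Z = {} \<longrightarrow> b \<in> L X \<longrightarrow>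
      (\<exists>q\<in>carrier (alt_fin (carrier G)). q ` X \<inter> F = {} \<and>
        inv\<^bsub>\<Gamma>\<^esub> y \<otimes>\<^bsub>\<Gamma>\<^esub> \<iota> b \<otimes>\<^bsub>\<Gamma>\<^esub> y = \<iota> (ad q b)))"
    using Y F by (intro exI[of _ ?Z]) auto
qed

section \<open>Vanishing off the normal subgroup\<close>

text \<open>A product of \<open>k\<close> disjoint copies of \<open>b\<close> does it. Its purpose
  is to turn one value of modulus below 1 into arbitrarily small ones.\<close>

lemma trace_norm_power:
  assumes tr: "\<phi> \<in> traces N" and mult: "mult_on_disjoint \<phi>" and b: "b \<in> carrier N"
  shows "\<exists>c\<in>carrier N. cmod (\<phi> c) = cmod (\<phi> b) ^ k"
proof (induction k)
  case 0
  then show ?case using tr by (intro bexI[of _ \<one>]) (auto simp: traces_iff)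
next
  case (Suc k)
  then obtain c where c: "c \<in> carrier N" "cmod (\<phi> c) = cmod (\<phi> b) ^ k" by blast
  obtain X where X: "finite X" "X \<subseteq> carrier G" "c \<in> L X" using L_cover c by blast
  obtain Y where Y: "finite Y" "Y \<subseteq> carrier G" "b \<in> L Y" using L_cover b by blast
  obtain p :: "nat \<Rightarrow> 'a \<Rightarrow> 'a" where p: "\<And>i. p i \<in> carrier (alt_fin (carrier G))"
    and pX: "\<And>i. p i ` Y \<inter> X = {}" and "\<And>i j. i \<noteq> j \<Longrightarrow> p i ` Y \<inter> p j ` Y = {}"
    by (rule ex_disjoint_copies[OF Y(1,2) X(1)]) (rule that)
  have "\<phi> (c \<otimes> ad (p 0) b) = \<phi> c * \<phi> (ad (p 0) b)"
    using Y(1) pX by (intro mult_on_disjointD[OF mult X(1,2) _ alt_fin_image_subset[OF p Y(2)] _ X(3) ad_L[OF p Y]]) auto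
  then have "cmod (\<phi> (c \<otimes> ad (p 0) b)) = cmod (\<phi> b) ^ Suc k"
    using trace_ad[OF tr p b] c(2) by (simp add: norm_mult)
  then show ?case using c ad_closed[OF p b] by blast
qed

text \<open>Conjugating \<open>\<gamma> = (g, n)\<close> by translates of \<open>b\<close> that are disjoint from each other and from their
  shifts by \<open>g\<^sup>-\<^sup>1\<close> gives almost orthogonal elements on which \<open>\<phi>\<close> takes the same value.\<close>

lemma trace_outside_le:
  assumes tr: "\<phi> \<in> traces \<Gamma>" and mult: "mult_on_disjoint (\<phi> \<circ> \<iota>)"
    and g: "g \<in> carrier G" "g \<noteq> \<one>\<^bsub>G\<^esub>" and n: "n \<in> carrier N" and b: "b \<in> carrier N"
  shows "(cmod (\<phi> (g, n)))\<^sup>2 \<le> cmod (\<phi> (\<iota> b)) ^ 4"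
proof -
  have pd: "positive_definite \<Gamma> \<phi>" and one: "\<phi> \<one>\<^bsub>\<Gamma>\<^esub> = 1" and cl: "class_function \<Gamma> \<phi>"
    using tr by (auto simp: traces_iff)
  have trN: "(\<lambda>x\<in>carrier N. \<phi> (\<iota> x)) \<in> traces N"
    using \<iota>.trace_pullback[OF tr] .
  define \<gamma> where "\<gamma> = (g, n)"
  have \<gamma>: "\<gamma> \<in> carrier \<Gamma>" using g n by (simp add: \<gamma>_def carrier_\<Gamma>)
  define h where "h = inv\<^bsub>G\<^esub> g"
  have h: "h \<in> carrier G" "h \<noteq> \<one>\<^bsub>G\<^esub>" using g by (auto simp: h_def)
  obtain X where X: "finite X" "X \<subseteq> carrier G" "b \<in> L X" using L_cover b by blast
  obtain Y where Y: "finite Y" "Y \<subseteq> carrier G" "n \<in> L Y" using L_cover n by blast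
  \<comment> \<open>This feeds \<open>ex_block_sequence\<close> with the relation
    \<open>s = h t\<close>. That \<open>s\<close> is unrelated to itself uses that \<open>h\<close>
    is not the identity; the other exclusions remove finitely many points.\<close>
  have ex: "\<exists>s\<in>carrier G - F. \<not> s = h \<otimes>\<^bsub>G\<^esub> s \<and> (\<forall>t\<in>F. \<not> s = h \<otimes>\<^bsub>G\<^esub> t \<and> \<not> t = h \<otimes>\<^bsub>G\<^esub> s)" if F: "finite F" for F
  proof -
    have "infinite (carrier G - (F \<union> (\<lambda>t. h \<otimes>\<^bsub>G\<^esub> t) ` F \<union> (\<lambda>t. inv\<^bsub>G\<^esub> h \<otimes>\<^bsub>G\<^esub> t) ` F))"
      using infinite_S F by (intro Diff_infinite_finite) auto
    from infinite_imp_nonempty[OF this]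
    obtain s where s: "s \<in> carrier G" "s \<notin> F" "s \<notin> (\<lambda>t. h \<otimes>\<^bsub>G\<^esub> t) ` F" "s \<notin> (\<lambda>t. inv\<^bsub>G\<^esub> h \<otimes>\<^bsub>G\<^esub> t) ` F"
      by blast
    have "t \<noteq> h \<otimes>\<^bsub>G\<^esub> s" if "t \<in> F" for t
    proof
      assume "t = h \<otimes>\<^bsub>G\<^esub> s"
      then have "inv\<^bsub>G\<^esub> h \<otimes>\<^bsub>G\<^esub> t = s" using h s(1) by (simp add: G.m_assoc[symmetric])
      then show False using s(4) that by blast
    qed
    moreover have "s \<noteq> h \<otimes>\<^bsub>G\<^esub> s" using h s(1) by (simp add: G.l_cancel_one)
    ultimately show ?thesis using s by (intro bexI[of _ s]) auto
  qed
  obtain p :: "nat \<Rightarrow> 'a \<Rightarrow> 'a" where p: "\<And>i. p i \<in> carrier (alt_fin (carrier G))" and pY: "\<And>i. p i ` X \<inter> Y = {}"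
    and pp: "\<And>i j. i \<noteq> j \<Longrightarrow> p i ` X \<inter> p j ` X = {}"
    and ph: "\<And>i j x y. x \<in> p i ` X \<Longrightarrow> y \<in> p j ` X \<Longrightarrow> \<not> x = h \<otimes>\<^bsub>G\<^esub> y"
    by (rule ex_block_sequence[OF infinite_S X(1,2) Y(1) ex]) (assumption, rule that)
  define B where "B i = ad (p i) b" for i
  let ?h = "\<lambda>Z. (\<lambda>x. h \<otimes>\<^bsub>G\<^esub> x) ` Z"
  have px: "p i x \<in> carrier G" if "x \<in> X" for i x
    using alt_fin_image_subset[OF p X(2)] that by blast
  have sub: "finite (p i ` X)" "p i ` X \<subseteq> carrier G" "finite (?h (p i ` X))" "?h (p i ` X) \<subseteq> carrier G" for i
    using X px h by auto
  have BL: "B i \<in> L (p i ` X)" for i using ad_L[OF p X] by (simp add: B_def)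
  have Bc: "B i \<in> carrier N" for i using ad_closed[OF p b] by (simp add: B_def)
  have BLi: "inv (B i) \<in> L (p i ` X)" for i
    using subgroup.m_inv_closed[OF L_subgroup[OF sub(1,2)] BL] .
  have val: "\<phi> (\<iota> (B i)) = \<phi> (\<iota> b)" "\<phi> (\<iota> (inv (B i))) = cnj (\<phi> (\<iota> b))" for i
    using trace_ad[OF trN p b, of i] trace_inv[OF trN Bc[of i]] b Bc[of i] by (simp_all add: B_def)
  have \<alpha>val: "\<phi> (\<iota> (\<alpha> h x)) = \<phi> (\<iota> x)" if "x \<in> carrier N" for x
    using trace_\<alpha>[OF trN h(1) that] that h by (simp add: \<alpha>_closed)
  define x where "x i = \<iota> (B i) \<otimes>\<^bsub>\<Gamma>\<^esub> \<gamma> \<otimes>\<^bsub>\<Gamma>\<^esub> inv\<^bsub>\<Gamma>\<^esub> \<iota> (B i)" for i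
  have xc: "x i \<in> carrier \<Gamma>" for i using \<gamma> Bc by (simp add: x_def)
  have xval: "\<phi> (x i) = \<phi> \<gamma>" for i
    using cl \<gamma> Bc unfolding x_def class_function_def by simp
  \<comment> \<open>The quotient of two conjugates is a product of four elements: copy
    \<open>i\<close>, the \<open>h\<close>-translate of its inverse, the \<open>h\<close>-translate
    of copy \<open>j\<close>, and the inverse of copy \<open>j\<close>. Their supports are disjoint,
    so the value is a product of four factors of modulus \<open>|\<phi> (\<iota> b)|\<close>, two of
    them conjugated.\<close>
  have orth: "\<phi> (inv\<^bsub>\<Gamma>\<^esub> x i \<otimes>\<^bsub>\<Gamma>\<^esub> x j) = of_real (cmod (\<phi> (\<iota> b)) ^ 4)" if ij: "i \<noteq> j" for i j
  proof -
    have hB: "inv\<^bsub>\<Gamma>\<^esub> \<gamma> \<otimes>\<^bsub>\<Gamma>\<^esub> \<iota> (inv (B i)) \<otimes>\<^bsub>\<Gamma>\<^esub> \<gamma> = \<iota> (\<alpha> h (inv (B i)))"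
      "inv\<^bsub>\<Gamma>\<^esub> \<gamma> \<otimes>\<^bsub>\<Gamma>\<^esub> \<iota> (B j) \<otimes>\<^bsub>\<Gamma>\<^esub> \<gamma> = \<iota> (\<alpha> h (B j))"
      unfolding \<gamma>_def h_def
      by (rule conj_\<iota>_disjoint[OF g(1) Y sub(1,2) BLi pY] conj_\<iota>_disjoint[OF g(1) Y sub(1,2) BL pY])+
    have c: "\<iota> (B i) \<in> carrier \<Gamma>" "\<iota> (B j) \<in> carrier \<Gamma>" using Bc by auto
    have canc: "\<gamma> \<otimes>\<^bsub>\<Gamma>\<^esub> (inv\<^bsub>\<Gamma>\<^esub> \<gamma> \<otimes>\<^bsub>\<Gamma>\<^esub> z) = z" if "z \<in> carrier \<Gamma>" for z
      using \<Gamma>.m_assoc[of \<gamma> "inv\<^bsub>\<Gamma>\<^esub> \<gamma>" z] \<gamma> that by simp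
    have "inv\<^bsub>\<Gamma>\<^esub> x i \<otimes>\<^bsub>\<Gamma>\<^esub> x j = \<iota> (B i) \<otimes>\<^bsub>\<Gamma>\<^esub> ((inv\<^bsub>\<Gamma>\<^esub> \<gamma> \<otimes>\<^bsub>\<Gamma>\<^esub> \<iota> (inv (B i)) \<otimes>\<^bsub>\<Gamma>\<^esub> \<gamma>)
        \<otimes>\<^bsub>\<Gamma>\<^esub> (inv\<^bsub>\<Gamma>\<^esub> \<gamma> \<otimes>\<^bsub>\<Gamma>\<^esub> \<iota> (B j) \<otimes>\<^bsub>\<Gamma>\<^esub> \<gamma>)) \<otimes>\<^bsub>\<Gamma>\<^esub> inv\<^bsub>\<Gamma>\<^esub> \<iota> (B j)"
      using c \<gamma> Bc by (simp add: x_def \<Gamma>.inv_mult_group \<Gamma>.m_assoc canc)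
    also have "\<dots> = \<iota> (B i \<otimes> (\<alpha> h (inv (B i)) \<otimes> \<alpha> h (B j)) \<otimes> inv (B j))"
      unfolding hB using Bc h by (simp add: \<alpha>_closed)
    also have "\<phi> \<dots> = \<phi> (\<iota> (B i \<otimes> (\<alpha> h (inv (B i)) \<otimes> \<alpha> h (B j)))) * \<phi> (\<iota> (inv (B j)))"
    proof -
      let ?W = "p i ` X \<union> (?h (p i ` X) \<union> ?h (p j ` X))"
      have W: "finite ?W" "?W \<subseteq> carrier G" using sub by auto
      have "B i \<in> L ?W" using L_mono[of "p i ` X" ?W] BL by auto
      moreover have "\<alpha> h (inv (B i)) \<in> L ?W" using L_mono[of "?h (p i ` X)" ?W] \<alpha>_L[OF h(1) sub(1,2) BLi] by auto
      moreover have "\<alpha> h (B j) \<in> L ?W" using L_mono[of "?h (p j ` X)" ?W] \<alpha>_L[OF h(1) sub(1,2) BL] by auto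
      ultimately have "B i \<otimes> (\<alpha> h (inv (B i)) \<otimes> \<alpha> h (B j)) \<in> L ?W"
        using subgroup.m_closed[OF L_subgroup[OF W]] by blast
      moreover have "?W \<inter> p j ` X = {}" using pp[OF ij] ph by blast
      ultimately show ?thesis
        using mult_on_disjointD[OF mult W sub(1,2) _ _ BLi] by simp
    qed
    also have "\<phi> (\<iota> (B i \<otimes> (\<alpha> h (inv (B i)) \<otimes> \<alpha> h (B j)))) = \<phi> (\<iota> (B i)) * \<phi> (\<iota> (\<alpha> h (inv (B i)) \<otimes> \<alpha> h (B j)))"
    proof -
      let ?W = "?h (p i ` X) \<union> ?h (p j ` X)"
      have W: "finite ?W" "?W \<subseteq> carrier G" using sub by auto
      have "\<alpha> h (inv (B i)) \<in> L ?W" using L_mono[of "?h (p i ` X)" ?W] \<alpha>_L[OF h(1) sub(1,2) BLi] by auto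
      moreover have "\<alpha> h (B j) \<in> L ?W" using L_mono[of "?h (p j ` X)" ?W] \<alpha>_L[OF h(1) sub(1,2) BL] by auto
      ultimately have "\<alpha> h (inv (B i)) \<otimes> \<alpha> h (B j) \<in> L ?W"
        using subgroup.m_closed[OF L_subgroup[OF W]] by blast
      moreover have "p i ` X \<inter> ?W = {}" using ph by blast
      ultimately show ?thesis
        using mult_on_disjointD[OF mult sub(1,2) W _ BL] by simp
    qed
    also have "\<phi> (\<iota> (\<alpha> h (inv (B i)) \<otimes> \<alpha> h (B j))) = \<phi> (\<iota> (\<alpha> h (inv (B i)))) * \<phi> (\<iota> (\<alpha> h (B j)))"
    proof -
      have "?h (p i ` X) \<inter> ?h (p j ` X) = {}"
      proof (rule ccontr)
        assume "?h (p i ` X) \<inter> ?h (p j ` X) \<noteq> {}"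
        then obtain u v where "h \<otimes>\<^bsub>G\<^esub> u = h \<otimes>\<^bsub>G\<^esub> v" and uv: "u \<in> p i ` X" "v \<in> p j ` X" by blast
        then have "u = v" using h sub(2)[of i] sub(2)[of j] by (simp add: subset_iff)
        then show False using uv pp[OF ij] by blast
      qed
      from mult_on_disjointD[OF mult sub(3,4) sub(3,4) this \<alpha>_L[OF h(1) sub(1,2) BLi] \<alpha>_L[OF h(1) sub(1,2) BL]]
      show ?thesis by simp
    qed
    finally have "\<phi> (inv\<^bsub>\<Gamma>\<^esub> x i \<otimes>\<^bsub>\<Gamma>\<^esub> x j) = (\<phi> (\<iota> b) * cnj (\<phi> (\<iota> b)))\<^sup>2"
      using Bc by (simp add: \<alpha>val val power2_eq_square del: \<iota>.hom_inv)
    also have "\<dots> = of_real (cmod (\<phi> (\<iota> b)) ^ 4)"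
      unfolding complex_norm_square[symmetric] by simp
    finally show ?thesis .
  qed
  define r where "r = cmod (\<phi> (\<iota> b)) ^ 4"
  \<comment> \<open>The sum of \<open>m\<close> unit vectors with mutual inner products
    \<open>r\<close> has squared norm \<open>m^2 r + m (1 - r)\<close>, while its inner product with
    the identity is \<open>m \<phi> \<gamma>\<close>. Dividing Cauchy-Schwarz by \<open>m\<close>
    gives the bound.\<close>
  have bound: "real m * ((cmod (\<phi> \<gamma>))\<^sup>2 - r) \<le> 1" if m: "m > 0" for m :: nat
  proof -
    have "(cmod (\<Sum>i<m. 1 * \<phi> (\<one>\<^bsub>\<Gamma>\<^esub> \<otimes>\<^bsub>\<Gamma>\<^esub> x i)))\<^sup>2 \<le> Re (gram \<Gamma> \<phi> {..<m} (\<lambda>_. 1) x)"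
      by (rule \<Gamma>.positive_definite_Cauchy_Schwarz[OF pd one]) (use xc in auto)
    also have "(\<Sum>i<m. 1 * \<phi> (\<one>\<^bsub>\<Gamma>\<^esub> \<otimes>\<^bsub>\<Gamma>\<^esub> x i)) = of_nat m * \<phi> \<gamma>"
      by (simp add: xc xval)
    also have "gram \<Gamma> \<phi> {..<m} (\<lambda>_. 1) x = (\<Sum>i<m. \<Sum>j<m. of_real r + (if j = i then of_real (1 - r) else 0))"
      unfolding gram_def by (intro sum.cong refl) (auto simp: r_def orth xc one)
    also have "\<dots> = of_real (real m * real m * r + real m * (1 - r))"
      by (simp add: sum.distrib algebra_simps)
    finally have "real m * (real m * (cmod (\<phi> \<gamma>))\<^sup>2) \<le> real m * (real m * r + (1 - r))"
      by (simp add: norm_mult power2_eq_square algebra_simps)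
    then have "real m * (cmod (\<phi> \<gamma>))\<^sup>2 \<le> real m * r + (1 - r)" using m by simp
    moreover have "0 \<le> r" by (simp add: r_def)
    ultimately show ?thesis by (simp add: algebra_simps)
  qed
  show ?thesis
  proof (rule ccontr)
    assume "\<not> ?thesis"
    then have d: "0 < (cmod (\<phi> \<gamma>))\<^sup>2 - r" by (simp add: \<gamma>_def r_def)
    obtain m :: nat where "1 / ((cmod (\<phi> \<gamma>))\<^sup>2 - r) < m" using reals_Archimedean2 by blast
    then have "1 < real m * ((cmod (\<phi> \<gamma>))\<^sup>2 - r)" using d by (simp add: field_simps)
    moreover from this have "m > 0" by (cases m) auto
    ultimately show False using bound[of m] by simp
  qed
qed

text \<open>The bound of \<open>trace_outside_le\<close> holds for every element of \<open>N\<close>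
  in place of \<open>b\<close>, in particular for products of many disjoint copies of
  \<open>b\<close>, where it tends to 0.\<close>

lemma trace_vanishes_outside:
  assumes tr: "\<phi> \<in> traces \<Gamma>" and mult: "mult_on_disjoint (\<phi> \<circ> \<iota>)"
    and b: "b \<in> carrier N" "cmod (\<phi> (\<iota> b)) < 1"
    and g: "g \<in> carrier G" "g \<noteq> \<one>\<^bsub>G\<^esub>" and n: "n \<in> carrier N"
  shows "\<phi> (g, n) = 0"
proof (rule ccontr)
  assume "\<phi> (g, n) \<noteq> 0"
  then have v: "(cmod (\<phi> (g, n)))\<^sup>2 > 0" by simp
  define \<psi> where "\<psi> = (\<lambda>x\<in>carrier N. \<phi> (\<iota> x))"
  have \<psi>: "\<psi> \<in> traces N" unfolding \<psi>_def using \<iota>.trace_pullback[OF tr] .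
  have "mult_on_disjoint \<psi>"
    using mult L_closed unfolding mult_on_disjoint_def \<psi>_def by simp
  note pow = trace_norm_power[OF \<psi> this b(1)]
  obtain k where k: "cmod (\<phi> (\<iota> b)) ^ k < (cmod (\<phi> (g, n)))\<^sup>2"
    using real_arch_pow_inv[OF v b(2)] by blast
  obtain c where c: "c \<in> carrier N" "cmod (\<phi> (\<iota> c)) = cmod (\<phi> (\<iota> b)) ^ k"
    using pow[of k] b by (auto simp: \<psi>_def)
  have "cmod (\<phi> (\<iota> c)) \<le> 1" using \<Gamma>.trace_norm_le[OF tr \<iota>.hom_closed[OF c(1)]] .
  then have "cmod (\<phi> (\<iota> c)) ^ 4 \<le> cmod (\<phi> (\<iota> c))"
    using power_decreasing[of 1 4 "cmod (\<phi> (\<iota> c))"] by simp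
  then show False using trace_outside_le[OF tr mult g n c(1)] k c(2) by simp
qed

end

section \<open>The trace supported at the identity\<close>

context group
begin

lemma positive_definite_delta:
  "positive_definite G (\<lambda>g. if g = \<one> then 1 else 0)"
  unfolding positive_definite_iff_gram
proof (intro allI impI)
  fix S c assume S: "finite S" "S \<subseteq> carrier G"
  have "gram G (\<lambda>g. if g = \<one> then 1 else 0) S c (\<lambda>x. x) = (\<Sum>x\<in>S. \<Sum>y\<in>S. if y = x then cnj (c x) * c x else 0)"
    unfolding gram_def
  proof (intro sum.cong refl)
    fix x y assume "x \<in> S" "y \<in> S"
    then have "inv x \<otimes> y = \<one> \<longleftrightarrow> y = x" using S by (auto simp: inv_solve_left' subset_iff)
    then show "cnj (c x) * c y * (if inv x \<otimes> y = \<one> then 1 else 0) = (if y = x then cnj (c x) * c x else 0)"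
      by auto
  qed
  also have "\<dots> = (\<Sum>x\<in>S. cnj (c x) * c x)"
    using S by (simp add: sum.delta)
  also have "\<dots> = of_real (\<Sum>x\<in>S. (cmod (c x))\<^sup>2)"
    by (simp only: of_real_sum complex_norm_square mult.commute)
  finally show "gram G (\<lambda>g. if g = \<one> then 1 else 0) S c (\<lambda>x. x) \<in> \<real>\<^sub>\<ge>\<^sub>0"
    by (simp only: nonneg_Reals_of_real_iff) (simp add: sum_nonneg)
qed

lemma conj_eq_one_iff: "g \<in> carrier G \<Longrightarrow> h \<in> carrier G \<Longrightarrow> h \<otimes> g \<otimes> inv h = \<one> \<longleftrightarrow> g = \<one>"
  by (simp add: inv_solve_right')

lemma delta_one_trace: "delta_one G \<in> traces G"
  unfolding delta_one_def
  by (rule restrict_in_traces[OF positive_definite_delta]) (auto simp: class_function_def conj_eq_one_iff)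

lemma const_one_trace: "const_one G \<in> traces G"
  unfolding const_one_def
proof (rule restrict_in_traces)
  show "positive_definite G (\<lambda>g. 1)"
    unfolding positive_definite_iff_gram
  proof (intro allI impI)
    fix S :: "'a set" and c assume "finite S"
    have "gram G (\<lambda>g. 1) S c (\<lambda>x. x) = (\<Sum>x\<in>S. c x) * cnj (\<Sum>x\<in>S. c x)"
      by (simp add: gram_def sum_product sum_distrib_left sum_distrib_right mult.commute)
    then show "gram G (\<lambda>g. 1) S c (\<lambda>x. x) \<in> \<real>\<^sub>\<ge>\<^sub>0"
      unfolding complex_norm_square[symmetric] by (simp only: nonneg_Reals_of_real_iff zero_le_power2)
  qed
qed (auto simp: class_function_def)

text \<open>Infinitely many distinct conjugates of \<open>g\<close> are orthonormal for
  \<open>\<delta>\<close> and have value 0, while \<open>\<psi>\<close> is constant on them. So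
  \<open>dominated_trace_value\<close> applies with \<open>d = 0\<close>.\<close>

lemma delta_one_character_if_icc:
  assumes "icc G"
  shows "delta_one G \<in> characters G"
proof (rule charactersI[OF delta_one_trace])
  fix \<psi> \<theta> t g
  assume *: "\<psi> \<in> traces G" "\<theta> \<in> traces G" "0 < (t::real)" "t < 1"
    "\<And>h. h \<in> carrier G \<Longrightarrow> delta_one G h = of_real (1 - t) * \<psi> h + of_real t * \<theta> h" and g: "g \<in> carrier G"
  show "\<psi> g = delta_one G g"
  proof (cases "g = \<one>")
    case True
    then show ?thesis using * by (simp add: traces_iff delta_one_def)
  next
    case False
    then have "infinite ((\<lambda>h. h \<otimes> g \<otimes> inv h) ` carrier G)"
      using assms g unfolding icc_def by blast
    then obtain x :: "nat \<Rightarrow> 'a" where x: "inj x" "range x \<subseteq> (\<lambda>h. h \<otimes> g \<otimes> inv h) ` carrier G"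
      using infinite_countable_subset by blast
    have "\<exists>h\<in>carrier G. x i = h \<otimes> g \<otimes> inv h" for i using x(2) by auto
    then obtain h where h: "\<And>i. h i \<in> carrier G" "\<And>i. x i = h i \<otimes> g \<otimes> inv (h i)" by metis
    have xc: "x i \<in> carrier G" for i using h g by simp
    have "\<psi> g = 0"
    proof (rule dominated_trace_value[OF delta_one_trace *])
      show "x i \<in> carrier G" for i using xc .
      show "delta_one G (x i) = 0" for i
        using conj_eq_one_iff[OF g h(1)] False h xc by (simp add: delta_one_def)
      show "\<psi> (x i) = \<psi> g" for i
        using *(1) g h by (simp add: traces_iff class_function_def)
      show "delta_one G (inv x i \<otimes> x j) = cnj 0 * 0" if "i \<noteq> j" for i j
        using that x(1) xc inv_solve_left'[of \<one> "x i" "x j"] by (auto simp: delta_one_def inj_eq)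
    qed auto
    then show ?thesis using False g by (simp add: delta_one_def)
  qed
qed

text \<open>The average of \<open>\<delta> ((2 + l k)\<^sup>* x (2 + l k))\<close> over a finite conjugacy class of \<open>k \<noteq> 1\<close> is a class
  function dominated by \<open>\<delta>\<close>.\<close>

lemma icc_if_delta_one_character:
  assumes ch: "delta_one G \<in> characters G"
  shows "icc G"
proof (rule ccontr)
  assume "\<not> icc G"
  then obtain g where g: "g \<in> carrier G" "g \<noteq> \<one>" and fin: "finite ((\<lambda>h. h \<otimes> g \<otimes> inv h) ` carrier G)"
    by (auto simp: icc_def)
  define K where "K = (\<lambda>h. h \<otimes> g \<otimes> inv h) ` carrier G"
  define m where "m = card K"
  have K: "finite K" "K \<subseteq> carrier G" using fin g by (auto simp: K_def)
  have gK: "g \<in> K" unfolding K_def using g by (intro image_eqI[of _ _ \<one>]) auto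
  have oneK: "\<one> \<notin> K"
  proof
    assume "\<one> \<in> K"
    then obtain h where "h \<in> carrier G" "h \<otimes> g \<otimes> inv h = \<one>" unfolding K_def by force
    then show False using conj_eq_one_iff[OF g(1)] g(2) by blast
  qed
  have m: "m > 0" using K gK by (auto simp: m_def card_gt_0_iff)
  have Kconj: "h \<otimes> k \<otimes> inv h \<in> K" if "h \<in> carrier G" "k \<in> K" for h k
  proof -
    obtain u where u: "u \<in> carrier G" "k = u \<otimes> g \<otimes> inv u" using \<open>k \<in> K\<close> by (auto simp: K_def)
    then have "h \<otimes> k \<otimes> inv h = (h \<otimes> u) \<otimes> g \<otimes> inv (h \<otimes> u)"
      using that g by (simp add: m_assoc inv_mult_group)
    then show ?thesis unfolding K_def using u that by blast
  qed
  have Kconj_iff: "h \<otimes> k \<otimes> inv h \<in> K \<longleftrightarrow> k \<in> K" if "h \<in> carrier G" "k \<in> carrier G" for h k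
  proof
    assume "h \<otimes> k \<otimes> inv h \<in> K"
    from Kconj[OF inv_closed[OF that(1)] this]
    show "k \<in> K" using that m_assoc[of "inv h" h] by (simp add: m_assoc)
  qed (rule Kconj[OF that(1)])
  define \<delta> where "\<delta> = (\<lambda>g. if g = \<one> then 1 else 0 :: complex)"
  \<comment> \<open>This is the average over \<open>k \<in> K\<close> of
    \<open>\<delta> (x k)\<close>, because \<open>x k\<close> is the identity exactly when
    \<open>k\<close> is the inverse of \<open>x\<close>. It vanishes at the identity but not at the
    inverse of \<open>g\<close>, whereas extremality would make it the zero multiple of
    \<open>\<delta>\<close>.\<close>
  define \<psi> where "\<psi> x = (if inv x \<in> K then 1 / of_nat m else 0 :: complex)" for x
  define \<psi>' where "\<psi>' x = (if x \<in> K then 1 / of_nat m else 0 :: complex)" for x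
  have cl: "class_function G \<delta>" by (simp add: class_function_def \<delta>_def conj_eq_one_iff)
  have "\<psi> (inv g) = \<psi> \<one> * delta_one G (inv g)"
  proof (rule character_dominates[OF ch])
    have "inv (h \<otimes> x \<otimes> inv h) = h \<otimes> inv x \<otimes> inv h" if "h \<in> carrier G" "x \<in> carrier G" for h x
      using that by (simp add: inv_mult_group m_assoc)
    then show "class_function G \<psi>" by (auto simp: class_function_def \<psi>_def Kconj_iff)
    show "class_function G \<psi>'" by (auto simp: class_function_def \<psi>'_def Kconj_iff)
    show "\<psi>' \<one> = cnj (\<psi> \<one>)" "cmod (\<psi> \<one>) \<le> 1" using oneK by (auto simp: \<psi>_def \<psi>'_def)
    show "inv g \<in> carrier G" using g by simp
    fix l :: complex assume l: "cmod l = 1"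
    have "positive_definite G (\<lambda>x. of_real (1 / m) * (\<Sum>k\<in>K. 5 * \<delta> x + 2 * l * \<delta> (x \<otimes> k) + 2 * cnj l * \<delta> (inv k \<otimes> x)))"
      using K l cl positive_definite_delta unfolding \<delta>_def[symmetric]
      by (intro positive_definite_scale positive_definite_sum positive_definite_perturb) auto
    also have "?this \<longleftrightarrow> positive_definite G (\<lambda>x. 5 * delta_one G x + 2 * l * \<psi> x + 2 * cnj l * \<psi>' x)"
    proof (rule positive_definite_cong)
      fix x assume x: "x \<in> carrier G"
      have "x \<otimes> k = \<one> \<longleftrightarrow> k = inv x" "inv k \<otimes> x = \<one> \<longleftrightarrow> k = x" if "k \<in> K" for k
        using that K x by (auto simp: inv_solve_left' subset_iff intro: inv_equality[symmetric] inv_comm)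
      then have "(\<Sum>k\<in>K. 5 * \<delta> x + 2 * l * \<delta> (x \<otimes> k) + 2 * cnj l * \<delta> (inv k \<otimes> x)) =
          (\<Sum>k\<in>K. 5 * \<delta> x + (if k = inv x then 2 * l else 0) + (if k = x then 2 * cnj l else 0))"
        by (intro sum.cong refl) (auto simp: \<delta>_def)
      also have "\<dots> = of_nat m * (5 * \<delta> x) + (if inv x \<in> K then 2 * l else 0) + (if x \<in> K then 2 * cnj l else 0)"
        using K by (simp add: sum.distrib sum.delta' m_def)
      finally show "of_real (1 / m) * (\<Sum>k\<in>K. 5 * \<delta> x + 2 * l * \<delta> (x \<otimes> k) + 2 * cnj l * \<delta> (inv k \<otimes> x))
        = 5 * delta_one G x + 2 * l * \<psi> x + 2 * cnj l * \<psi>' x"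
        using m x by (simp add: \<psi>_def \<psi>'_def delta_one_def \<delta>_def field_simps)
    qed
    finally show "positive_definite G (\<lambda>x. 5 * delta_one G x + 2 * l * \<psi> x + 2 * cnj l * \<psi>' x)" .
  qed
  moreover have "\<psi> (inv g) \<noteq> 0" using gK g m by (simp add: \<psi>_def)
  moreover have "\<psi> \<one> = 0" using oneK by (simp add: \<psi>_def)
  ultimately show False by simp
qed

lemma delta_one_character_iff: "delta_one G \<in> characters G \<longleftrightarrow> icc G"
  using icc_if_delta_one_character delta_one_character_if_icc by blast

end

section \<open>The characters of an enrichment\<close>

context enrichment
begin

definition inflate :: "('a \<Rightarrow> complex) \<Rightarrow> 'a \<times> 'b \<Rightarrow> complex" where
  "inflate \<psi> = (\<lambda>x\<in>carrier \<Gamma>. \<psi> (fst x))"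

definition extend_zero :: "('b \<Rightarrow> complex) \<Rightarrow> 'a \<times> 'b \<Rightarrow> complex" where
  "extend_zero \<psi> = (\<lambda>x\<in>carrier \<Gamma>. if fst x = \<one>\<^bsub>G\<^esub> then \<psi> (snd x) else 0)"

definition deflate :: "('a \<times> 'b \<Rightarrow> complex) \<Rightarrow> 'a \<Rightarrow> complex" where
  "deflate \<phi> = (\<lambda>g\<in>carrier G. \<phi> (g, \<one>))"

definition restrict_N :: "('a \<times> 'b \<Rightarrow> complex) \<Rightarrow> 'b \<Rightarrow> complex" where
  "restrict_N \<phi> = (\<lambda>n\<in>carrier N. \<phi> (\<iota> n))"

lemma inflate_trace: "\<psi> \<in> traces G \<Longrightarrow> inflate \<psi> \<in> traces \<Gamma>"
  unfolding inflate_def by (rule proj.trace_pullback)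

lemma restrict_N_trace: "\<phi> \<in> traces \<Gamma> \<Longrightarrow> restrict_N \<phi> \<in> traces N"
  unfolding restrict_N_def by (rule \<iota>.trace_pullback)

lemma deflate_trace:
  assumes "\<phi> \<in> traces \<Gamma>"
  shows "deflate \<phi> \<in> traces G"
proof -
  interpret emb: group_hom G \<Gamma> "\<lambda>g. (g, \<one>)"
    by unfold_locales (auto simp: hom_def carrier_\<Gamma> mult_\<Gamma> \<alpha>_unit)
  show ?thesis unfolding deflate_def by (rule emb.trace_pullback[OF assms])
qed

text \<open>The Gram matrix is block diagonal with respect to the \<open>G\<close>-coordinate.
  Within a block, inversion in the semidirect product only introduces a twist by
  \<open>\<alpha>\<close>, under which \<open>\<psi>\<close> is invariant, so each block is a Gram
  matrix of \<open>\<psi>\<close>.\<close>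

lemma extend_zero_trace:
  assumes tr: "\<psi> \<in> traces N"
  shows "extend_zero \<psi> \<in> traces \<Gamma>"
  unfolding extend_zero_def
proof (rule \<Gamma>.restrict_in_traces)
  let ?e = "\<lambda>x. if fst x = \<one>\<^bsub>G\<^esub> then \<psi> (snd x) else 0"
  have pd: "positive_definite N \<psi>" using tr by (simp add: traces_iff)
  show "positive_definite \<Gamma> ?e"
    unfolding positive_definite_iff_gram
  proof (intro allI impI)
    fix S :: "('a \<times> 'b) set" and c :: "'a \<times> 'b \<Rightarrow> complex" assume S: "finite S" "S \<subseteq> carrier \<Gamma>"
    define F where "F s t = cnj (c s) * c t * \<psi> (inv (snd s) \<otimes> snd t)" for s t
    have "gram \<Gamma> ?e S c (\<lambda>x. x) = (\<Sum>s\<in>S. \<Sum>t\<in>S. if fst t = fst s then F s t else 0)"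
      unfolding gram_def
    proof (intro sum.cong refl)
      fix s t assume "s \<in> S" "t \<in> S"
      then have "s \<in> carrier \<Gamma>" "t \<in> carrier \<Gamma>" using S by auto
      then obtain g n h m where st: "s = (g, n)" "t = (h, m)" "g \<in> carrier G" "h \<in> carrier G" "n \<in> carrier N" "m \<in> carrier N"
        by (auto simp: carrier_\<Gamma>)
      have 1: "inv\<^bsub>\<Gamma>\<^esub> s \<otimes>\<^bsub>\<Gamma>\<^esub> t = (inv\<^bsub>G\<^esub> g \<otimes>\<^bsub>G\<^esub> h, \<alpha> (inv\<^bsub>G\<^esub> g) (inv n \<otimes> m))"
        using st by (simp add: inv_\<Gamma> mult_\<Gamma> \<alpha>_m)
      have 2: "inv\<^bsub>G\<^esub> g \<otimes>\<^bsub>G\<^esub> h = \<one>\<^bsub>G\<^esub> \<longleftrightarrow> h = g" using st by (auto simp: G.inv_solve_left')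
      show "cnj (c s) * c t * ?e (inv\<^bsub>\<Gamma>\<^esub> s \<otimes>\<^bsub>\<Gamma>\<^esub> t) = (if fst t = fst s then F s t else 0)"
        using trace_\<alpha>[OF tr, of "inv\<^bsub>G\<^esub> g" "inv n \<otimes> m"] st unfolding 1 by (simp add: 2 F_def)
    qed
    also have "\<dots> = (\<Sum>s\<in>S. \<Sum>t\<in>{t\<in>S. fst t = fst s}. F s t)"
      by (rule sum.cong[OF refl], rule sum.inter_filter[symmetric], rule S(1))
    also have "\<dots> = (\<Sum>g\<in>fst ` S. \<Sum>s\<in>{s\<in>S. fst s = g}. \<Sum>t\<in>{t\<in>S. fst t = fst s}. F s t)"
      by (rule sum.image_gen[OF S(1)])
    also have "\<dots> = (\<Sum>g\<in>fst ` S. gram N \<psi> {s\<in>S. fst s = g} c snd)"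
      unfolding gram_def F_def by (intro sum.cong refl) auto
    also have "\<dots> \<in> \<real>\<^sub>\<ge>\<^sub>0"
    proof -
      have "gram N \<psi> {s\<in>S. fst s = g} c snd \<in> \<real>\<^sub>\<ge>\<^sub>0" for g
        using S by (intro positive_definiteD[OF pd]) (auto simp: carrier_\<Gamma>)
      then show ?thesis by (auto simp: complex_nonneg_Reals_iff intro!: sum_nonneg)
    qed
    finally show "gram \<Gamma> ?e S c (\<lambda>x. x) \<in> \<real>\<^sub>\<ge>\<^sub>0" .
  qed
  show "class_function \<Gamma> ?e"
    unfolding class_function_def
  proof (intro ballI)
    fix x y assume "x \<in> carrier \<Gamma>" "y \<in> carrier \<Gamma>"
    then obtain g n h m where xy: "x = (g, n)" "y = (h, m)" "g \<in> carrier G" "h \<in> carrier G" "n \<in> carrier N" "m \<in> carrier N"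
      by (auto simp: carrier_\<Gamma>)
    have f: "fst (y \<otimes>\<^bsub>\<Gamma>\<^esub> x \<otimes>\<^bsub>\<Gamma>\<^esub> inv\<^bsub>\<Gamma>\<^esub> y) = h \<otimes>\<^bsub>G\<^esub> g \<otimes>\<^bsub>G\<^esub> inv\<^bsub>G\<^esub> h"
      using xy by (simp add: mult_\<Gamma> inv_\<Gamma>)
    show "?e (y \<otimes>\<^bsub>\<Gamma>\<^esub> x \<otimes>\<^bsub>\<Gamma>\<^esub> inv\<^bsub>\<Gamma>\<^esub> y) = ?e x"
    proof (cases "g = \<one>\<^bsub>G\<^esub>")
      case True
      then have "y \<otimes>\<^bsub>\<Gamma>\<^esub> x \<otimes>\<^bsub>\<Gamma>\<^esub> inv\<^bsub>\<Gamma>\<^esub> y = \<iota> (m \<otimes> \<alpha> h n \<otimes> inv m)"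
        using conj_\<iota>(2)[of h m n] xy by (simp add: \<iota>_def)
      moreover have "\<psi> (m \<otimes> \<alpha> h n \<otimes> inv m) = \<psi> n"
        using tr xy trace_\<alpha>[OF tr, of h n] \<alpha>_closed by (simp add: traces_iff class_function_def)
      ultimately show ?thesis using True xy by (simp add: \<iota>_def)
    next
      case False
      then show ?thesis unfolding f using G.conj_eq_one_iff xy by simp
    qed
  qed
  show "?e \<one>\<^bsub>\<Gamma>\<^esub> = 1" using tr by (simp add: one_\<Gamma> traces_iff)
qed

lemma restrict_N_extend_zero: "\<psi> \<in> extensional (carrier N) \<Longrightarrow> restrict_N (extend_zero \<psi>) = \<psi>"
  by (rule extensionalityI[of _ "carrier N"]) (auto simp: restrict_N_def extend_zero_def carrier_\<Gamma> \<iota>_def)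

lemma deflate_inflate: "\<psi> \<in> extensional (carrier G) \<Longrightarrow> deflate (inflate \<psi>) = \<psi>"
  by (rule extensionalityI[of _ "carrier G"]) (auto simp: deflate_def inflate_def carrier_\<Gamma>)

lemma restrict_N_inflate: "\<psi> \<in> traces G \<Longrightarrow> restrict_N (inflate \<psi>) = const_one N"
  by (auto simp: restrict_N_def inflate_def carrier_\<Gamma> \<iota>_def const_one_def traces_iff)

text \<open>This coincidence is the source of the identification of the two base points in the
  theorem.\<close>

lemma extend_zero_const_one: "extend_zero (const_one N) = inflate (delta_one G)"
  by (auto simp: extend_zero_def inflate_def const_one_def delta_one_def carrier_\<Gamma> fun_eq_iff)

lemma inflate_deflate:
  assumes tr: "\<phi> \<in> traces \<Gamma>" and one: "restrict_N \<phi> = const_one N"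
  shows "inflate (deflate \<phi>) = \<phi>"
proof (rule extensionalityI[of _ "carrier \<Gamma>"])
  show "inflate (deflate \<phi>) \<in> extensional (carrier \<Gamma>)" by (simp add: inflate_def)
  show "\<phi> \<in> extensional (carrier \<Gamma>)" using tr by (simp add: traces_iff)
  fix x assume "x \<in> carrier \<Gamma>"
  then obtain g n where x: "x = (g, n)" "g \<in> carrier G" "n \<in> carrier N" by (auto simp: carrier_\<Gamma>)
  \<comment> \<open>Undoing the action of \<open>g\<close> makes \<open>(g, n)\<close> the product
    of \<open>(g, \<one>)\<close> and \<open>\<iota> n'\<close>; the second factor has value 1 and
    can be cancelled.\<close>
  define n' where "n' = \<alpha> (inv\<^bsub>G\<^esub> g) n"
  have n': "n' \<in> carrier N" using x by (simp add: n'_def \<alpha>_closed)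
  have "\<phi> (\<iota> n') = 1" using fun_cong[OF one, of n'] n' by (simp add: restrict_N_def const_one_def)
  moreover have "(g, \<one>) \<otimes>\<^bsub>\<Gamma>\<^esub> \<iota> n' = x"
    using x \<alpha>_mult[of g "inv\<^bsub>G\<^esub> g" n] \<alpha>_closed by (simp add: mult_\<Gamma> \<iota>_def n'_def \<alpha>_one)
  moreover have "\<phi> ((g, \<one>) \<otimes>\<^bsub>\<Gamma>\<^esub> \<iota> n') = \<phi> (g, \<one>) * \<phi> (\<iota> n')"
  proof (rule \<Gamma>.positive_definite_mult_unit)
    show "(g, \<one>) \<in> carrier \<Gamma>" using x by (simp add: carrier_\<Gamma>)
  qed (use tr n' calculation(1) in \<open>auto simp: traces_iff\<close>)
  ultimately show "inflate (deflate \<phi>) x = \<phi> x"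
    using x by (simp add: inflate_def deflate_def carrier_\<Gamma>)
qed

text \<open>The number 1 is an extreme point of the closed unit disc.\<close>

lemma convex_combination_const_one:
  assumes "cmod z \<le> 1" "cmod w \<le> 1" "0 < (t::real)" "t < 1" "of_real (1 - t) * z + of_real t * w = 1"
  shows "z = 1"
proof -
  have "(1 - t) * Re z + t * Re w = 1"
    using arg_cong[OF assms(5), of Re] by simp
  moreover have "Re z \<le> 1" "Re w \<le> 1" using assms complex_Re_le_cmod order_trans by blast+
  moreover have "t * Re w \<le> t * 1" using calculation assms by (intro mult_left_mono) auto
  ultimately have "(1 - t) * 1 \<le> (1 - t) * Re z" by (simp add: algebra_simps)
  then have "1 \<le> Re z" using assms by (simp add: mult_le_cancel_left)
  moreover have "(Re z)\<^sup>2 + (Im z)\<^sup>2 \<le> 1"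
    using assms(1) power_le_one[of "cmod z" 2] by (simp add: cmod_power2)
  moreover from calculation have "1 \<le> (Re z)\<^sup>2" by (simp add: power_mono[of 1 "Re z" 2, simplified])
  ultimately have "(Im z)\<^sup>2 \<le> 0" "Re z = 1"
    using \<open>Re z \<le> 1\<close> zero_le_power2[of "Im z"] by auto
  then show ?thesis by (simp add: complex_eq_iff)
qed

text \<open>For the nontrivial direction, the components of a decomposition average to 1 on
  \<open>N\<close>. As 1 is extreme in the unit disc, they equal 1 there and are themselves
  inflated, so the decomposition descends to \<open>G\<close>.\<close>

lemma inflate_character_iff:
  assumes "\<psi> \<in> traces G"
  shows "inflate \<psi> \<in> characters \<Gamma> \<longleftrightarrow> \<psi> \<in> characters G"
proof
  assume ch: "inflate \<psi> \<in> characters \<Gamma>"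
  show "\<psi> \<in> characters G"
  proof (rule charactersI[OF assms])
    fix \<psi>1 \<psi>2 t g
    assume *: "\<psi>1 \<in> traces G" "\<psi>2 \<in> traces G" "0 < (t::real)" "t < 1"
      "\<And>h. h \<in> carrier G \<Longrightarrow> \<psi> h = of_real (1 - t) * \<psi>1 h + of_real t * \<psi>2 h" and g: "g \<in> carrier G"
    have "inflate \<psi>1 = inflate \<psi>2"
      by (rule charactersD[OF ch inflate_trace inflate_trace, OF *(1-4)])
        (auto simp: inflate_def carrier_\<Gamma> *(5))
    then have "deflate (inflate \<psi>1) = deflate (inflate \<psi>2)" by simp
    then have "\<psi>1 = \<psi>2" using * by (simp add: deflate_inflate traces_iff)
    then show "\<psi>1 g = \<psi> g" using *(5)[OF g] by (simp add: algebra_simps)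
  qed
next
  assume ch: "\<psi> \<in> characters G"
  show "inflate \<psi> \<in> characters \<Gamma>"
  proof (rule charactersI[OF inflate_trace[OF assms]])
    fix \<psi>1 \<psi>2 t x
    assume *: "\<psi>1 \<in> traces \<Gamma>" "\<psi>2 \<in> traces \<Gamma>" "0 < (t::real)" "t < 1"
      "\<And>h. h \<in> carrier \<Gamma> \<Longrightarrow> inflate \<psi> h = of_real (1 - t) * \<psi>1 h + of_real t * \<psi>2 h" and x: "x \<in> carrier \<Gamma>"
    have "\<psi>1 (\<iota> n) = 1" if "n \<in> carrier N" for n
    proof (rule convex_combination_const_one[OF _ _ *(3,4)])
      show "cmod (\<psi>1 (\<iota> n)) \<le> 1" "cmod (\<psi>2 (\<iota> n)) \<le> 1" using \<Gamma>.trace_norm_le * that by auto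
      show "of_real (1 - t) * \<psi>1 (\<iota> n) + of_real t * \<psi>2 (\<iota> n) = 1"
        using *(5)[of "\<iota> n"] that assms by (simp add: inflate_def \<iota>_def traces_iff carrier_\<Gamma>)
    qed
    then have r1: "restrict_N \<psi>1 = const_one N" by (auto simp: restrict_N_def const_one_def fun_eq_iff)
    have "deflate \<psi>1 = deflate \<psi>2"
    proof (rule charactersD[OF ch deflate_trace deflate_trace, OF *(1-4)])
      fix g assume "g \<in> carrier G"
      then show "\<psi> g = of_real (1 - t) * deflate \<psi>1 g + of_real t * deflate \<psi>2 g"
        using *(5)[of "(g, \<one>)"] by (simp add: inflate_def deflate_def carrier_\<Gamma>)
    qed
    moreover have "\<psi> g = of_real (1 - t) * deflate \<psi>1 g + of_real t * deflate \<psi>2 g" if "g \<in> carrier G" for g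
      using *(5)[of "(g, \<one>)"] that by (simp add: inflate_def deflate_def carrier_\<Gamma>)
    ultimately have "\<psi> g = deflate \<psi>1 g" if "g \<in> carrier G" for g using that by (simp add: algebra_simps)
    then have "inflate \<psi> x = inflate (deflate \<psi>1) x" using x by (auto simp: inflate_def carrier_\<Gamma>)
    then show "\<psi>1 x = inflate \<psi> x" using inflate_deflate[OF *(1) r1] by simp
  qed
qed

text \<open>If all values were unimodular, \<open>positive_definite_mult_unit\<close> would make the
  trace a linear character of \<open>N\<close>.\<close>

lemma ex_norm_less_one:
  assumes tr: "\<phi> \<in> traces N" and ne: "\<phi> \<noteq> const_one N"
  shows "\<exists>b\<in>carrier N. cmod (\<phi> b) < 1"
proof (rule ccontr)
  assume "\<not> ?thesis"
  then have "cmod (\<phi> b) = 1" if "b \<in> carrier N" for b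
    using trace_norm_le[OF tr that] that by force
  then have "\<phi> (x \<otimes> y) = \<phi> x * \<phi> y" if "x \<in> carrier N" "y \<in> carrier N" for x y
    using tr that by (intro positive_definite_mult_unit) (auto simp: traces_iff)
  then have "\<phi> n = 1" if "n \<in> carrier N" for n
    using no_linear_character tr that unfolding no_linear_character_def by (simp add: traces_iff)
  then have "\<phi> = const_one N"
    using tr by (intro extensionalityI[of _ "carrier N"]) (auto simp: const_one_def traces_iff)
  then show False using ne by simp
qed

lemma mult_on_disjoint_cong:
  assumes "\<And>n. n \<in> carrier N \<Longrightarrow> \<phi> n = \<psi> n"
  shows "mult_on_disjoint \<phi> \<longleftrightarrow> mult_on_disjoint \<psi>"
  unfolding mult_on_disjoint_def using assms L_closed by (auto 4 4)

lemma mult_on_disjoint_restrict_N: "mult_on_disjoint (\<phi> \<circ> \<iota>) \<longleftrightarrow> mult_on_disjoint (restrict_N \<phi>)"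
  by (rule mult_on_disjoint_cong) (simp add: restrict_N_def)

lemma eq_extend_zero:
  assumes tr: "\<phi> \<in> traces \<Gamma>" and mult: "mult_on_disjoint (restrict_N \<phi>)" and ne: "restrict_N \<phi> \<noteq> const_one N"
  shows "extend_zero (restrict_N \<phi>) = \<phi>"
proof (rule extensionalityI[of _ "carrier \<Gamma>"])
  show "extend_zero (restrict_N \<phi>) \<in> extensional (carrier \<Gamma>)" by (simp add: extend_zero_def)
  show "\<phi> \<in> extensional (carrier \<Gamma>)" using tr by (simp add: traces_iff)
  obtain b where b: "b \<in> carrier N" "cmod (\<phi> (\<iota> b)) < 1"
    using ex_norm_less_one[OF restrict_N_trace[OF tr] ne] by (auto simp: restrict_N_def)
  fix x assume "x \<in> carrier \<Gamma>"
  then obtain g n where x: "x = (g, n)" "g \<in> carrier G" "n \<in> carrier N" by (auto simp: carrier_\<Gamma>)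
  show "extend_zero (restrict_N \<phi>) x = \<phi> x"
    using x trace_vanishes_outside[OF tr mult[folded mult_on_disjoint_restrict_N] b x(2) _ x(3)]
    by (auto simp: extend_zero_def restrict_N_def carrier_\<Gamma> \<iota>_def)
qed

text \<open>Extremality of \<open>\<psi>\<close> forces the components of a decomposition to
  restrict to \<open>\<psi>\<close> on \<open>N\<close>. Vanishing off \<open>N\<close> holds for
  arbitrary traces with such a restriction, so nothing more needs to be known about the
  components.\<close>

lemma extend_zero_character:
  assumes ch: "\<psi> \<in> characters N" and ne: "\<psi> \<noteq> const_one N"
  shows "extend_zero \<psi> \<in> characters \<Gamma>"
proof -
  have tr: "\<psi> \<in> traces N" using ch characters_subset_traces by blast
  show ?thesis
  proof (rule charactersI[OF extend_zero_trace[OF tr]])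
    fix \<psi>1 \<psi>2 t x
    assume *: "\<psi>1 \<in> traces \<Gamma>" "\<psi>2 \<in> traces \<Gamma>" "0 < (t::real)" "t < 1"
      "\<And>h. h \<in> carrier \<Gamma> \<Longrightarrow> extend_zero \<psi> h = of_real (1 - t) * \<psi>1 h + of_real t * \<psi>2 h" and x: "x \<in> carrier \<Gamma>"
    have eq: "\<psi> n = of_real (1 - t) * restrict_N \<psi>1 n + of_real t * restrict_N \<psi>2 n" if "n \<in> carrier N" for n
      using *(5)[of "\<iota> n"] that by (simp add: extend_zero_def restrict_N_def \<iota>_def carrier_\<Gamma>)
    have "restrict_N \<psi>1 = restrict_N \<psi>2"
      by (rule charactersD[OF ch restrict_N_trace restrict_N_trace, OF *(1-4) eq])
    then have "\<psi> n = restrict_N \<psi>1 n" if "n \<in> carrier N" for n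
      using eq[OF that] by (simp add: algebra_simps)
    then have r: "restrict_N \<psi>1 = \<psi>"
      using tr by (intro extensionalityI[of _ "carrier N"]) (auto simp: traces_iff restrict_N_def)
    show "\<psi>1 x = extend_zero \<psi> x"
      using eq_extend_zero[OF *(1)] character_mult_on_disjoint_self[OF ch] ne unfolding r by simp
  qed
qed

text \<open>Extremality does not pass to a subgroup for formal reasons. It passes through
  multiplicativity on disjoint supports, which restricts and which implies extremality on
  \<open>N\<close>.\<close>

lemma restrict_N_character:
  assumes ch: "\<phi> \<in> characters \<Gamma>"
  shows "restrict_N \<phi> \<in> characters N"
  using character_\<Gamma>_mult_on_disjoint[OF ch] restrict_N_trace ch characters_subset_traces
  by (intro character_of_mult_on_disjoint) (auto simp: mult_on_disjoint_restrict_N)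

lemma const_one_character: "const_one N \<in> characters N"
  by (rule character_of_mult_on_disjoint[OF const_one_trace])
    (use L_closed in \<open>auto simp: mult_on_disjoint_def const_one_def\<close>)

lemma character_\<Gamma>_cases:
  assumes "\<phi> \<in> characters \<Gamma>"
  shows "(restrict_N \<phi> = const_one N \<and> deflate \<phi> \<in> characters G \<and> inflate (deflate \<phi>) = \<phi>) \<or>
    (restrict_N \<phi> \<in> characters N - {const_one N} \<and> extend_zero (restrict_N \<phi>) = \<phi>)"
proof -
  have tr: "\<phi> \<in> traces \<Gamma>" using assms characters_subset_traces by blast
  show ?thesis
  proof (cases "restrict_N \<phi> = const_one N")
    case True
    then show ?thesis
      using inflate_deflate[OF tr True] inflate_character_iff[OF deflate_trace[OF tr]] assms by simp
  next
    case False
    then show ?thesis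
      using eq_extend_zero[OF tr] restrict_N_character[OF assms] character_mult_on_disjoint_self by blast
  qed
qed

end

section \<open>Gluing spaces of characters\<close>

lemma topspace_disjoint_union: "topspace (disjoint_union_topology X Y) = topspace X <+> topspace Y"
proof
  show "topspace (disjoint_union_topology X Y) \<subseteq> topspace X <+> topspace Y"
    using openin_disjoint_union_topology[of X Y "topspace (disjoint_union_topology X Y)"] by simp
  have "Inl -` (topspace X <+> topspace Y) = topspace X" "Inr -` (topspace X <+> topspace Y) = topspace Y"
    by auto
  then have "openin (disjoint_union_topology X Y) (topspace X <+> topspace Y)"
    by (simp add: openin_disjoint_union_topology)
  then show "topspace X <+> topspace Y \<subseteq> topspace (disjoint_union_topology X Y)"
    by (rule openin_subset)
qed

lemma closedin_disjoint_union:
  assumes "closedin (disjoint_union_topology X Y) C"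
  shows "closedin X (Inl -` C)" "closedin Y (Inr -` C)" "C \<subseteq> topspace X <+> topspace Y"
proof -
  have C: "C \<subseteq> topspace X <+> topspace Y" and o: "openin (disjoint_union_topology X Y) ((topspace X <+> topspace Y) - C)"
    using assms by (simp_all add: closedin_def topspace_disjoint_union)
  have "Inl -` ((topspace X <+> topspace Y) - C) = topspace X - Inl -` C"
    "Inr -` ((topspace X <+> topspace Y) - C) = topspace Y - Inr -` C" by auto
  moreover have "Inl -` C \<subseteq> topspace X" "Inr -` C \<subseteq> topspace Y" using C by auto
  ultimately show "closedin X (Inl -` C)" "closedin Y (Inr -` C)" "C \<subseteq> topspace X <+> topspace Y"
    using o C by (simp_all add: openin_disjoint_union_topology closedin_def)
qed

lemma continuous_map_disjoint_union:
  assumes "continuous_map X Z f" "continuous_map Y Z g"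
  shows "continuous_map (disjoint_union_topology X Y) Z (case_sum f g)"
  unfolding continuous_map_def
proof (intro conjI allI impI)
  show "case_sum f g \<in> topspace (disjoint_union_topology X Y) \<rightarrow> topspace Z"
    using assms by (auto simp: topspace_disjoint_union continuous_map_def)
  fix U assume U: "openin Z U"
  let ?V = "{x \<in> topspace (disjoint_union_topology X Y). case_sum f g x \<in> U}"
  have "Inl -` ?V = {x \<in> topspace X. f x \<in> U}" "Inr -` ?V = {x \<in> topspace Y. g x \<in> U}"
    by (auto simp: topspace_disjoint_union)
  then show "openin (disjoint_union_topology X Y) ?V"
    using assms U by (auto simp: openin_disjoint_union_topology topspace_disjoint_union continuous_map_def)
qed

lemma topspace_identify_points:
  assumes "a \<in> topspace X" "b \<in> topspace X"
  shows "topspace (identify_points X a b) = topspace X // identify_rel (topspace X) a b"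
proof
  let ?r = "identify_rel (topspace X) a b"
  show "topspace (identify_points X a b) \<subseteq> topspace X // ?r"
    using openin_identify_points[of X a b "topspace (identify_points X a b)"] by simp
  have "{x \<in> topspace X. ?r `` {x} \<in> topspace X // ?r} = topspace X" by (auto intro: quotientI)
  then have "openin (identify_points X a b) (topspace X // ?r)"
    by (simp add: openin_identify_points)
  then show "topspace X // ?r \<subseteq> topspace (identify_points X a b)" by (rule openin_subset)
qed

text \<open>A quotient map whose fibres are exactly the equivalence classes induces an injective
  quotient map on the set of classes, that is, a homeomorphism.\<close>

lemma homeomorphic_space_identify_points:
  assumes q: "quotient_map X Y q" and ab: "a \<in> topspace X" "b \<in> topspace X"
    and ker: "\<And>x y. x \<in> topspace X \<Longrightarrow> y \<in> topspace X \<Longrightarrow> q x = q y \<longleftrightarrow> (x, y) \<in> identify_rel (topspace X) a b"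
  shows "Y homeomorphic_space identify_points X a b"
proof -
  let ?r = "identify_rel (topspace X) a b" and ?Q = "identify_points X a b"
  have eq: "equiv (topspace X) ?r" by (rule equiv_identify_rel[OF ab])
  have top: "topspace ?Q = topspace X // ?r" by (rule topspace_identify_points[OF ab])
  \<comment> \<open>The chosen representative does not matter, since \<open>q\<close> is constant on
    each class.\<close>
  define h where "h C = q (SOME x. x \<in> C)" for C
  have h: "h (?r `` {x}) = q x" if x: "x \<in> topspace X" for x
  proof -
    have "x \<in> ?r `` {x}" using eq x by (rule equiv_class_self)
    then have "(SOME y. y \<in> ?r `` {x}) \<in> ?r `` {x}" by (rule someI)
    then have *: "(x, SOME y. y \<in> ?r `` {x}) \<in> ?r" by simp
    then have "(SOME y. y \<in> ?r `` {x}) \<in> topspace X" using eq ab by (auto simp: identify_rel_def)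
    from ker[OF x this] * have "q x = q (SOME y. y \<in> ?r `` {x})" by blast
    then show ?thesis unfolding h_def by (rule sym)
  qed
  have "quotient_map ?Q Y h"
    unfolding quotient_map_def
  proof (intro conjI allI impI)
    have "h ` topspace ?Q = q ` topspace X"
      unfolding top quotient_def using h by (auto simp: image_iff)
    then show "h ` topspace ?Q = topspace Y" using q by (simp add: quotient_map_def)
    fix U assume U: "U \<subseteq> topspace Y"
    have "{x \<in> topspace X. ?r `` {x} \<in> {C \<in> topspace ?Q. h C \<in> U}} = {x \<in> topspace X. q x \<in> U}"
      unfolding top using h by (auto intro: quotientI)
    then have "openin ?Q {C \<in> topspace ?Q. h C \<in> U} \<longleftrightarrow> openin X {x \<in> topspace X. q x \<in> U}"
      unfolding openin_identify_points by (auto simp: top)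
    also have "\<dots> \<longleftrightarrow> openin Y U" using q U by (simp add: quotient_map_def)
    finally show "openin ?Q {C \<in> topspace ?Q. h C \<in> U} = openin Y U" .
  qed
  moreover have "inj_on h (topspace ?Q)"
  proof (rule inj_onI)
    fix C D assume "C \<in> topspace ?Q" "D \<in> topspace ?Q" and hCD: "h C = h D"
    then obtain x y where xy: "x \<in> topspace X" "y \<in> topspace X" "C = ?r `` {x}" "D = ?r `` {y}"
      unfolding top by (metis quotientE)
    then have "(x, y) \<in> ?r" using hCD h ker by simp
    then show "C = D" using equiv_class_eq[OF eq] xy by simp
  qed
  ultimately have "homeomorphic_map ?Q Y h"
    unfolding homeomorphic_map_def ..
  then have "?Q homeomorphic_space Y" by (rule homeomorphic_map_imp_homeomorphic_space)
  then show ?thesis using homeomorphic_space_sym by blast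
qed

section \<open>Pointwise convergence on sets of characters\<close>

lemma trace_of_character: "\<phi> \<in> characters K \<Longrightarrow> \<phi> \<in> traces K"
  using characters_subset_traces by blast

lemma extensional_character: "\<psi> \<in> characters K \<Longrightarrow> \<psi> \<in> extensional (carrier K)"
  by (auto simp: characters_def traces_iff)

lemma topspace_character_space: "topspace (character_space G) = characters G"
  by (auto simp: character_space_def characters_def traces_def PiE_def)

lemma continuous_map_character_space_eval:
  assumes "g \<in> carrier G"
  shows "continuous_map (character_space G) euclidean (\<lambda>\<phi>. \<phi> g)"
  unfolding character_space_def
  using continuous_map_product_projection[OF assms] continuous_map_from_subtopology by fastforce

lemma continuous_map_into_character_space:
  assumes "f ` topspace X \<subseteq> characters G"
    and "\<And>g. g \<in> carrier G \<Longrightarrow> continuous_map X euclidean (\<lambda>x. f x g)"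
  shows "continuous_map X (character_space G) f"
  unfolding character_space_def continuous_map_in_subtopology continuous_map_componentwise
  using assms extensional_character by (fastforce simp: image_subset_iff)

lemma closedin_character_eval:
  assumes "\<And>g. g \<in> A \<Longrightarrow> g \<in> carrier G"
  shows "closedin (character_space G) {\<phi> \<in> characters G. \<forall>g\<in>A. \<phi> g = c}"
\<comment> \<open>An intersection over the empty family would be the whole type and not the set of
  characters, hence the separate case.\<close>
proof (cases "A = {}")
  case True
  then show ?thesis using closedin_topspace[of "character_space G"] by (simp add: topspace_character_space)
next
  case False
  have "closedin (character_space G) {\<phi> \<in> characters G. \<phi> g = c}" if "g \<in> A" for g
    using closedin_continuous_map_preimage[OF continuous_map_character_space_eval[OF assms[OF that]], of "{c}"]
    by (simp add: topspace_character_space)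
  then have "closedin (character_space G) (\<Inter>g\<in>A. {\<phi> \<in> characters G. \<phi> g = c})"
    using False by (intro closedin_Inter) auto
  moreover have "(\<Inter>g\<in>A. {\<phi> \<in> characters G. \<phi> g = c}) = {\<phi> \<in> characters G. \<forall>g\<in>A. \<phi> g = c}"
    using False by auto
  ultimately show ?thesis by simp
qed

context enrichment
begin

definition factoring :: "('a \<times> 'b \<Rightarrow> complex) set" where
  "factoring = {\<phi> \<in> characters \<Gamma>. \<forall>x\<in>\<iota> ` carrier N. \<phi> x = 1}"

text \<open>In the ICC case the inflation of \<open>delta_one G\<close> satisfies this condition
  too, so the set then overlaps \<open>factoring\<close>.\<close>

definition vanishing :: "('a \<times> 'b \<Rightarrow> complex) set" where
  "vanishing = {\<phi> \<in> characters \<Gamma>. \<forall>x\<in>{x \<in> carrier \<Gamma>. fst x \<noteq> \<one>\<^bsub>G\<^esub>}. \<phi> x = 0}"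

lemma closedin_factoring: "closedin (character_space \<Gamma>) factoring"
  unfolding factoring_def by (rule closedin_character_eval) auto

lemma closedin_vanishing: "closedin (character_space \<Gamma>) vanishing"
  unfolding vanishing_def by (rule closedin_character_eval) auto

lemma factoring_iff: "\<phi> \<in> factoring \<longleftrightarrow> \<phi> \<in> characters \<Gamma> \<and> restrict_N \<phi> = const_one N"
  by (auto simp: factoring_def restrict_N_def const_one_def fun_eq_iff)

lemma inflate_image: "inflate ` characters G = factoring"
proof
  show "inflate ` characters G \<subseteq> factoring"
    by (auto simp: factoring_iff inflate_character_iff restrict_N_inflate trace_of_character)
  show "factoring \<subseteq> inflate ` characters G"
  proof
    fix \<phi> assume "\<phi> \<in> factoring"
    then have *: "\<phi> \<in> characters \<Gamma>" "restrict_N \<phi> = const_one N" by (auto simp: factoring_iff)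
    then show "\<phi> \<in> inflate ` characters G"
      using character_\<Gamma>_cases[OF *(1)] by (auto intro: image_eqI[of _ _ "deflate \<phi>"])
  qed
qed

lemma eq_extend_zero_vanishing:
  assumes "\<phi> \<in> vanishing"
  shows "extend_zero (restrict_N \<phi>) = \<phi>"
proof (rule extensionalityI[of _ "carrier \<Gamma>"])
  show "\<phi> \<in> extensional (carrier \<Gamma>)"
    using assms trace_of_character by (auto simp: vanishing_def traces_iff)
  fix x assume "x \<in> carrier \<Gamma>"
  then show "extend_zero (restrict_N \<phi>) x = \<phi> x"
    using assms by (auto simp: extend_zero_def restrict_N_def \<iota>_def vanishing_def carrier_\<Gamma>)
qed (simp add: extend_zero_def)

lemma continuous_map_restrict_N: "continuous_map (character_space \<Gamma>) (character_space N) restrict_N"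
proof (rule continuous_map_into_character_space)
  show "restrict_N ` topspace (character_space \<Gamma>) \<subseteq> characters N"
    using restrict_N_character by (auto simp: topspace_character_space)
  show "continuous_map (character_space \<Gamma>) euclidean (\<lambda>\<phi>. restrict_N \<phi> n)" if "n \<in> carrier N" for n
    using continuous_map_character_space_eval[of "\<iota> n" \<Gamma>] that by (simp add: restrict_N_def)
qed

lemma continuous_map_deflate:
  "continuous_map (subtopology (character_space \<Gamma>) factoring) (character_space G) deflate"
proof (rule continuous_map_into_character_space)
  show "deflate ` topspace (subtopology (character_space \<Gamma>) factoring) \<subseteq> characters G"
    by (auto simp: topspace_character_space factoring_iff dest!: character_\<Gamma>_cases)
  show "continuous_map (subtopology (character_space \<Gamma>) factoring) euclidean (\<lambda>\<phi>. deflate \<phi> g)"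
    if "g \<in> carrier G" for g
    using continuous_map_character_space_eval[of "(g, \<one>)" \<Gamma>] that
    by (auto simp: deflate_def carrier_\<Gamma> intro: continuous_map_from_subtopology)
qed

lemma continuous_map_inflate: "continuous_map (character_space G) (character_space \<Gamma>) inflate"
proof (rule continuous_map_into_character_space)
  show "inflate ` topspace (character_space G) \<subseteq> characters \<Gamma>"
    using inflate_image by (auto simp: topspace_character_space factoring_iff)
  show "continuous_map (character_space G) euclidean (\<lambda>\<psi>. inflate \<psi> x)" if "x \<in> carrier \<Gamma>" for x
    using continuous_map_character_space_eval[of "fst x" G] that by (auto simp: inflate_def carrier_\<Gamma>)
qed

lemma continuous_map_extend_zero:
  assumes "extend_zero ` T \<subseteq> characters \<Gamma>"
  shows "continuous_map (subtopology (character_space N) T) (character_space \<Gamma>) extend_zero"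
proof (rule continuous_map_into_character_space)
  show "extend_zero ` topspace (subtopology (character_space N) T) \<subseteq> characters \<Gamma>"
    using assms by (auto simp: topspace_character_space)
  fix x assume x: "x \<in> carrier \<Gamma>"
  show "continuous_map (subtopology (character_space N) T) euclidean (\<lambda>\<psi>. extend_zero \<psi> x)"
  proof (cases "fst x = \<one>\<^bsub>G\<^esub>")
    case True
    then show ?thesis
      using continuous_map_character_space_eval[of "snd x" N] x
      by (auto simp: extend_zero_def carrier_\<Gamma> intro: continuous_map_from_subtopology)
  next
    case False
    then show ?thesis using x by (simp add: extend_zero_def)
  qed
qed

text \<open>The parameter \<open>T\<close> covers both cases: all characters of \<open>N\<close> if
  \<open>G\<close> is ICC, all but the constant one otherwise. The map is closed because on each of
  the closed sets \<open>factoring\<close> and \<open>vanishing\<close> it has a continuous inverse,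
  \<open>deflate\<close> or \<open>restrict_N\<close>; compactness plays no part.\<close>

lemma glue_quotient_map:
  assumes T: "T \<subseteq> characters N" and ext: "extend_zero ` T = vanishing"
  shows "continuous_map (disjoint_union_topology (character_space G) (subtopology (character_space N) T))
      (character_space \<Gamma>) (case_sum inflate extend_zero)"
    and "closed_map (disjoint_union_topology (character_space G) (subtopology (character_space N) T))
      (character_space \<Gamma>) (case_sum inflate extend_zero)"
    and "case_sum inflate extend_zero ` topspace (disjoint_union_topology (character_space G) (subtopology (character_space N) T))
      = characters \<Gamma>"
proof -
  let ?D = "disjoint_union_topology (character_space G) (subtopology (character_space N) T)"
  have top: "topspace (subtopology (character_space N) T) = T"
    using T by (auto simp: topspace_character_space)
  have ext': "extend_zero ` T \<subseteq> characters \<Gamma>" using ext by (auto simp: vanishing_def)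
  show "continuous_map ?D (character_space \<Gamma>) (case_sum inflate extend_zero)"
    by (intro continuous_map_disjoint_union continuous_map_inflate continuous_map_extend_zero ext')
  have inT: "\<psi> \<in> extensional (carrier N)" if "\<psi> \<in> T" for \<psi>
    using that T by (auto simp: characters_def traces_iff)
  have inG: "\<psi> \<in> extensional (carrier G)" if "\<psi> \<in> characters G" for \<psi>
    using that by (auto simp: characters_def traces_iff)
  show "closed_map ?D (character_space \<Gamma>) (case_sum inflate extend_zero)"
    unfolding closed_map_def
  proof (intro allI impI)
    fix C assume "closedin ?D C"
    note C = closedin_disjoint_union[OF this]
    have C2: "Inr -` C \<subseteq> T" using C(3) by (auto simp: top)
    have C1: "Inl -` C \<subseteq> characters G" using C(3) by (auto simp: topspace_character_space)
    have "inflate ` (Inl -` C) = {\<phi> \<in> factoring. deflate \<phi> \<in> Inl -` C}"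
    proof (intro equalityI subsetI)
      fix \<phi> assume "\<phi> \<in> inflate ` (Inl -` C)"
      then show "\<phi> \<in> {\<phi> \<in> factoring. deflate \<phi> \<in> Inl -` C}"
        using inflate_image C1 inG deflate_inflate by auto
    next
      fix \<phi> assume "\<phi> \<in> {\<phi> \<in> factoring. deflate \<phi> \<in> Inl -` C}"
      then show "\<phi> \<in> inflate ` (Inl -` C)"
        by (intro image_eqI[of _ _ "deflate \<phi>"]) (auto simp: factoring_iff inflate_deflate trace_of_character)
    qed
    also have "\<dots> = {\<phi> \<in> topspace (subtopology (character_space \<Gamma>) factoring). deflate \<phi> \<in> Inl -` C}"
      by (auto simp: topspace_character_space factoring_def)
    finally have "closedin (subtopology (character_space \<Gamma>) factoring) (inflate ` (Inl -` C))"
      using closedin_continuous_map_preimage[OF continuous_map_deflate C(1)] by simp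
    then have 1: "closedin (character_space \<Gamma>) (inflate ` (Inl -` C))"
      using closedin_factoring by (rule closedin_trans_full)
    \<comment> \<open>This part of \<open>C\<close> is closed only relative to \<open>T\<close>. A
      set \<open>C'\<close> closed among all characters of \<open>N\<close> can be pulled back along
      \<open>restrict_N\<close>, and intersecting with \<open>vanishing\<close> restores the
      condition of lying in \<open>T\<close>.\<close>
    obtain C' where C': "closedin (character_space N) C'" "Inr -` C = C' \<inter> T"
      using C(2) by (auto simp: closedin_subtopology)
    have "extend_zero ` (Inr -` C) = vanishing \<inter> {\<phi> \<in> topspace (character_space \<Gamma>). restrict_N \<phi> \<in> C'}"
    proof (intro equalityI subsetI)
      fix \<phi> assume "\<phi> \<in> extend_zero ` (Inr -` C)"
      then obtain \<psi> where \<psi>: "\<psi> \<in> Inr -` C" "\<phi> = extend_zero \<psi>" by blast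
      then have "\<psi> \<in> C'" "\<psi> \<in> T" using C' by blast+
      then show "\<phi> \<in> vanishing \<inter> {\<phi> \<in> topspace (character_space \<Gamma>). restrict_N \<phi> \<in> C'}"
        using ext ext' restrict_N_extend_zero[OF inT] \<psi>(2) by (auto simp: topspace_character_space)
    next
      fix \<phi> assume "\<phi> \<in> vanishing \<inter> {\<phi> \<in> topspace (character_space \<Gamma>). restrict_N \<phi> \<in> C'}"
      then obtain \<psi> where \<psi>: "\<psi> \<in> T" "\<phi> = extend_zero \<psi>" "restrict_N \<phi> \<in> C'" using ext by blast
      then have "\<psi> \<in> Inr -` C" using C'(2) restrict_N_extend_zero[OF inT] by auto
      then show "\<phi> \<in> extend_zero ` (Inr -` C)" using \<psi>(2) by blast
    qed
    then have 2: "closedin (character_space \<Gamma>) (extend_zero ` (Inr -` C))"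
      using closedin_Int[OF closedin_vanishing closedin_continuous_map_preimage[OF continuous_map_restrict_N C'(1)]]
      by simp
    have "case_sum inflate extend_zero ` C = inflate ` (Inl -` C) \<union> extend_zero ` (Inr -` C)"
    proof -
      have "C = Inl ` (Inl -` C) \<union> Inr ` (Inr -` C)"
        by (auto simp: image_iff) (metis sum.exhaust)
      then have "case_sum inflate extend_zero ` C = case_sum inflate extend_zero ` (Inl ` (Inl -` C) \<union> Inr ` (Inr -` C))"
        by simp
      then show ?thesis by (simp only: image_Un image_image sum.case)
    qed
    then show "closedin (character_space \<Gamma>) (case_sum inflate extend_zero ` C)"
      using closedin_Un[OF 1 2] by simp
  qed
  have "case_sum inflate extend_zero ` topspace ?D = inflate ` characters G \<union> extend_zero ` T"
    unfolding topspace_disjoint_union top Plus_def topspace_character_space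
    by (simp only: image_Un image_image sum.case)
  also have "\<dots> = characters \<Gamma>"
  proof
    show "inflate ` characters G \<union> extend_zero ` T \<subseteq> characters \<Gamma>"
      using ext' inflate_image by (auto simp: factoring_iff)
    show "characters \<Gamma> \<subseteq> inflate ` characters G \<union> extend_zero ` T"
    proof
      fix \<phi> assume ch: "\<phi> \<in> characters \<Gamma>"
      consider "restrict_N \<phi> = const_one N" | "extend_zero (restrict_N \<phi>) = \<phi>"
        using character_\<Gamma>_cases[OF ch] by blast
      then show "\<phi> \<in> inflate ` characters G \<union> extend_zero ` T"
      proof cases
        case 1
        then show ?thesis unfolding inflate_image using ch by (simp add: factoring_iff)
      next
        case 2
        have "\<phi> x = 0" if "x \<in> carrier \<Gamma>" "fst x \<noteq> \<one>\<^bsub>G\<^esub>" for x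
          using fun_cong[OF 2, of x] that by (simp add: extend_zero_def)
        then have "\<phi> \<in> vanishing" using ch by (simp add: vanishing_def)
        then show ?thesis unfolding ext by blast
      qed
    qed
  qed
  finally show "case_sum inflate extend_zero ` topspace ?D = characters \<Gamma>" .
qed

lemma extend_zero_in_vanishing: "extend_zero \<psi> \<in> characters \<Gamma> \<Longrightarrow> extend_zero \<psi> \<in> vanishing"
  by (simp add: vanishing_def extend_zero_def)

text \<open>Restriction to \<open>N\<close> turns an inflation into the constant 1, which determines
  \<open>\<psi>\<close>; deflating then determines \<open>\<theta>\<close>.\<close>

lemma extend_zero_eq_inflate_iff:
  assumes \<psi>: "\<psi> \<in> characters N" and \<theta>: "\<theta> \<in> characters G"
  shows "inflate \<theta> = extend_zero \<psi> \<longleftrightarrow> \<theta> = delta_one G \<and> \<psi> = const_one N"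
proof
  assume eq: "inflate \<theta> = extend_zero \<psi>"
  have "\<theta> \<in> traces G" using \<theta> characters_subset_traces by blast
  then have "\<psi> = const_one N"
    using eq restrict_N_inflate restrict_N_extend_zero[OF extensional_character[OF \<psi>]] by metis
  moreover from this have "deflate (inflate \<theta>) = deflate (inflate (delta_one G))"
    using eq extend_zero_const_one by simp
  then have "\<theta> = delta_one G"
    using deflate_inflate[OF extensional_character[OF \<theta>]] deflate_inflate[of "delta_one G"]
    by (simp add: delta_one_def)
  ultimately show "\<theta> = delta_one G \<and> \<psi> = const_one N" by simp
qed (simp add: extend_zero_const_one)

lemma inflate_inj:
  "\<psi> \<in> characters G \<Longrightarrow> \<theta> \<in> characters G \<Longrightarrow> inflate \<psi> = inflate \<theta> \<longleftrightarrow> \<psi> = \<theta>"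
  using deflate_inflate extensional_character by metis

lemma extend_zero_inj:
  "\<psi> \<in> characters N \<Longrightarrow> \<theta> \<in> characters N \<Longrightarrow> extend_zero \<psi> = extend_zero \<theta> \<longleftrightarrow> \<psi> = \<theta>"
  using restrict_N_extend_zero extensional_character by metis

text \<open>Here \<open>delta_one G\<close> is a character, so the extension by zero of the constant
  1 is one as well. The glued map is onto from the full disjoint union and fails to be injective
  only at the two base points.\<close>

theorem character_space_icc:
  assumes "icc G"
  shows "character_space \<Gamma> homeomorphic_space
    identify_points (disjoint_union_topology (character_space G) (character_space N))
      (Inl (delta_one G)) (Inr (const_one N))"
proof -
  have \<delta>: "delta_one G \<in> characters G" using assms by (simp add: G.delta_one_character_iff)
  have ext: "extend_zero ` characters N = vanishing"
  proof
    have "extend_zero \<psi> \<in> characters \<Gamma>" if "\<psi> \<in> characters N" for \<psi>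
    proof (cases "\<psi> = const_one N")
      case True
      then show ?thesis
        using \<delta> by (simp add: extend_zero_const_one inflate_character_iff G.delta_one_trace)
    qed (rule extend_zero_character[OF that])
    then show "extend_zero ` characters N \<subseteq> vanishing" using extend_zero_in_vanishing by blast
    show "vanishing \<subseteq> extend_zero ` characters N"
    proof
      fix \<phi> assume \<phi>: "\<phi> \<in> vanishing"
      then have "restrict_N \<phi> \<in> characters N" by (simp add: restrict_N_character vanishing_def)
      then show "\<phi> \<in> extend_zero ` characters N"
        using eq_extend_zero_vanishing[OF \<phi>] by (metis imageI)
    qed
  qed
  have sub: "subtopology (character_space N) (characters N) = character_space N"
    using subtopology_topspace[of "character_space N"] by (simp add: topspace_character_space)
  note glue = glue_quotient_map[OF order_refl ext, unfolded sub]
  show ?thesis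
  proof (rule homeomorphic_space_identify_points)
    show "quotient_map (disjoint_union_topology (character_space G) (character_space N)) (character_space \<Gamma>)
        (case_sum inflate extend_zero)"
      using glue by (intro continuous_closed_imp_quotient_map) (simp_all add: topspace_character_space)
    show "Inl (delta_one G) \<in> topspace (disjoint_union_topology (character_space G) (character_space N))"
      "Inr (const_one N) \<in> topspace (disjoint_union_topology (character_space G) (character_space N))"
      using \<delta> const_one_character by (auto simp: topspace_disjoint_union topspace_character_space)
    fix x y assume "x \<in> topspace (disjoint_union_topology (character_space G) (character_space N))"
      "y \<in> topspace (disjoint_union_topology (character_space G) (character_space N))"
    then show "case_sum inflate extend_zero x = case_sum inflate extend_zero y \<longleftrightarrow>
      (x, y) \<in> identify_rel (topspace (disjoint_union_topology (character_space G) (character_space N)))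
        (Inl (delta_one G)) (Inr (const_one N))"
      unfolding topspace_disjoint_union topspace_character_space
      using extend_zero_eq_inflate_iff inflate_inj extend_zero_inj
      by (cases x; cases y) (auto simp: identify_rel_def eq_commute[of "extend_zero _" "inflate _"])
  qed
qed

text \<open>Here the extension by zero of the constant 1 is not a character, being the inflation of
  \<open>delta_one G\<close>. Without that point the glued map is injective.\<close>

theorem character_space_not_icc:
  assumes "\<not> icc G"
  shows "character_space \<Gamma> homeomorphic_space
    disjoint_union_topology (character_space G) (subtopology (character_space N) (characters N - {const_one N}))"
proof -
  let ?T = "characters N - {const_one N}"
  have \<delta>: "delta_one G \<notin> characters G" using assms by (simp add: G.delta_one_character_iff)
  have ext: "extend_zero ` ?T = vanishing"
  proof
    show "extend_zero ` ?T \<subseteq> vanishing" using extend_zero_character extend_zero_in_vanishing by blast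
    show "vanishing \<subseteq> extend_zero ` ?T"
    proof
      fix \<phi> assume \<phi>: "\<phi> \<in> vanishing"
      then have ch: "\<phi> \<in> characters \<Gamma>" by (simp add: vanishing_def)
      have "restrict_N \<phi> \<noteq> const_one N"
      proof
        assume "restrict_N \<phi> = const_one N"
        then have "\<phi> = inflate (delta_one G)"
          using eq_extend_zero_vanishing[OF \<phi>] extend_zero_const_one by simp
        then show False using ch \<delta> inflate_character_iff[OF G.delta_one_trace] by simp
      qed
      then have "restrict_N \<phi> \<in> ?T" using restrict_N_character[OF ch] by simp
      then show "\<phi> \<in> extend_zero ` ?T"
        using eq_extend_zero_vanishing[OF \<phi>] by (metis imageI)
    qed
  qed
  note glue = glue_quotient_map[OF Diff_subset ext]
  let ?D = "disjoint_union_topology (character_space G) (subtopology (character_space N) ?T)"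
  have "inj_on (case_sum inflate extend_zero) (topspace ?D)"
  proof (rule inj_onI)
    fix x y assume xy: "x \<in> topspace ?D" "y \<in> topspace ?D"
      "case_sum inflate extend_zero x = case_sum inflate extend_zero y"
    then show "x = y"
      unfolding topspace_disjoint_union topspace_subtopology topspace_character_space
      using extend_zero_eq_inflate_iff inflate_inj extend_zero_inj
      by (cases x; cases y) (auto simp: eq_commute[of "extend_zero _" "inflate _"])
  qed
  then have "homeomorphic_map ?D (character_space \<Gamma>) (case_sum inflate extend_zero)"
    using glue by (intro bijective_closed_imp_homeomorphic_map) (simp_all add: topspace_character_space)
  then have "?D homeomorphic_space character_space \<Gamma>" by (rule homeomorphic_map_imp_homeomorphic_space)
  then show ?thesis using homeomorphic_space_sym by blast
qed

end

section \<open>The alternating enrichment\<close>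

abbreviation transp :: "'a \<Rightarrow> 'a \<Rightarrow> 'a \<Rightarrow> 'a" where
  "transp \<equiv> Transposition.transpose"

definition alt_supported :: "'a set \<Rightarrow> 'a set \<Rightarrow> ('a \<Rightarrow> 'a) set" where
  "alt_supported S X = {p \<in> carrier (alt_fin S). \<forall>x. x \<notin> X \<longrightarrow> p x = x}"

lemma alt_supported_maps:
  assumes "p \<in> alt_supported S X" "x \<in> X"
  shows "p x \<in> X"
proof (rule ccontr)
  assume "p x \<notin> X"
  then have "p (p x) = p x" using assms by (simp add: alt_supported_def)
  moreover have "inj p" using assms alt_fin_bij bij_is_inj by (auto simp: alt_supported_def)
  ultimately have "p x = x" by (simp add: inj_eq)
  then show False using \<open>p x \<notin> X\<close> assms by simp
qed

lemma alt_supported_commute: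
  assumes p: "p \<in> carrier (alt_fin S)" and n: "n \<in> alt_supported S X" and fixX: "\<And>x. x \<in> X \<Longrightarrow> p x = x"
  shows "p \<circ> n = n \<circ> p"
proof
  fix x
  have n': "n y = y" if "y \<notin> X" for y using n that by (simp add: alt_supported_def)
  show "(p \<circ> n) x = (n \<circ> p) x"
  proof (cases "x \<in> X")
    case True
    then show ?thesis using alt_supported_maps[OF n True] fixX by simp
  next
    case False
    have "inj p" using p alt_fin_bij bij_is_inj by blast
    then have "p x \<notin> X" using fixX[of "p x"] False by (auto simp: inj_eq)
    then show ?thesis using False n' by simp
  qed
qed

lemma alt_supported_conj_image:
  assumes p: "p \<in> carrier (alt_fin S)" and n: "n \<in> alt_supported S X"
  shows "p \<circ> n \<circ> inv_into UNIV p \<in> alt_supported S (p ` X)"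
proof -
  have "n (inv_into UNIV p x) = inv_into UNIV p x" if "x \<notin> p ` X" for x
  proof -
    have "inv_into UNIV p x \<notin> X" using that alt_fin_inv_apply(2)[OF p, of x] by (metis imageI)
    then show ?thesis using n by (simp add: alt_supported_def)
  qed
  then show ?thesis
    using alt_fin_comp[OF alt_fin_comp[OF p] alt_fin_inv[OF p], of n] n alt_fin_inv_apply(2)[OF p]
    by (simp add: alt_supported_def)
qed

lemma alt_conj_carrier:
  assumes "p \<in> carrier (alt_fin S)" "n \<in> carrier (alt_fin S)"
  shows "p \<otimes>\<^bsub>alt_fin S\<^esub> n \<otimes>\<^bsub>alt_fin S\<^esub> inv\<^bsub>alt_fin S\<^esub> p = p \<circ> n \<circ> inv_into UNIV p"
  by (simp add: mult_alt_fin inv_alt_fin[OF assms(1)])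

lemma supported_group_alt_fin:
  assumes "infinite S"
  shows "supported_group (alt_fin S) S (alt_supported S) (\<lambda>p. p)"
proof -
  interpret group "alt_fin S" by (rule group_alt_fin)
  show ?thesis
  proof (intro supported_group.intro supported_group_axioms.intro)
    show "group (alt_fin S)" by (rule group_alt_fin)
    show "infinite S" by fact
    show "alt_supported S X \<subseteq> alt_supported S Y" if "X \<subseteq> Y" for X Y
      using that by (auto simp: alt_supported_def)
    show "(\<lambda>p. p) \<in> hom (alt_fin S) (alt_fin S)" by (simp add: hom_def)
  next
    fix X :: "'a set"
    show "subgroup (alt_supported S X) (alt_fin S)"
    proof (rule subgroupI)
      fix p assume p: "p \<in> alt_supported S X"
      then have pc: "p \<in> carrier (alt_fin S)" by (simp add: alt_supported_def)
      have "inv_into UNIV p x = x" if "x \<notin> X" for x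
        using alt_fin_inv_apply(1)[OF pc, of x] p that by (simp add: alt_supported_def)
      then show "inv\<^bsub>alt_fin S\<^esub> p \<in> alt_supported S X"
        using alt_fin_inv[OF pc] by (simp add: inv_alt_fin[OF pc] alt_supported_def)
    next
      show "alt_supported S X \<noteq> {}" using alt_fin_id[of S] by (auto simp: alt_supported_def intro!: exI[of _ id])
    qed (use alt_fin_comp in \<open>auto simp: alt_supported_def mult_alt_fin\<close>)
  next
    fix p assume "p \<in> carrier (alt_fin S)"
    then show "\<exists>X. finite X \<and> X \<subseteq> S \<and> p \<in> alt_supported S X"
      by (intro exI[of _ "{x. p x \<noteq> x}"]) (auto simp: alt_supported_def mem_alt_fin permutes_def)
  next
    fix X Y :: "'a set" and a b
    assume "X \<inter> Y = {}" "a \<in> alt_supported S X" "b \<in> alt_supported S Y"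
    then show "a \<otimes>\<^bsub>alt_fin S\<^esub> b = b \<otimes>\<^bsub>alt_fin S\<^esub> a"
      unfolding mult_alt_fin
      by (intro alt_supported_commute[of _ S _ Y]) (auto simp: alt_supported_def)
  next
    fix p X n assume *: "p \<in> carrier (alt_fin S)" "n \<in> alt_supported S X"
    then show "p \<otimes>\<^bsub>alt_fin S\<^esub> n \<otimes>\<^bsub>alt_fin S\<^esub> inv\<^bsub>alt_fin S\<^esub> p \<in> alt_supported S (p ` X)"
      using alt_supported_conj_image[OF *] alt_conj_carrier[OF *(1)] by (simp add: alt_supported_def)
    show "p \<otimes>\<^bsub>alt_fin S\<^esub> n = n \<otimes>\<^bsub>alt_fin S\<^esub> p" if "\<And>x. x \<in> X \<Longrightarrow> p x = x"
      using alt_supported_commute[OF * that] by (simp add: mult_alt_fin)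
  qed
qed

lemma transp_comp_bij:
  assumes "bij p"
  shows "p \<circ> transp a b \<circ> inv_into UNIV p = transp (p a) (p b)"
proof
  fix x
  obtain y where y: "x = p y" using assms by (metis bij_pointE)
  then show "(p \<circ> transp a b \<circ> inv_into UNIV p) x = transp (p a) (p b) x"
    using assms by (simp add: bij_is_inj transpose_apply_commute inv_f_f transpose_def inj_eq)
qed

lemma transp_pair_alt_fin:
  assumes "a \<in> S" "b \<in> S" "c \<in> S" "d \<in> S" "a \<noteq> b" "c \<noteq> d"
  shows "transp a b \<circ> transp c d \<in> carrier (alt_fin S)"
proof (rule transpose_comp_alt_fin)
  show "transp a b permutes S" using assms by (simp add: permutes_swap_id)
  show "finite {x. transp a b x \<noteq> x}"
    by (rule finite_subset[of _ "{a, b}"]) (auto simp: Transposition.transpose_def)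
qed (use assms in \<open>simp_all add: evenperm_swap\<close>)

text \<open>The nontrivial elements \<open>k\<^sub>1 k\<^sub>2 = k\<^sub>3\<close> of a Klein four-group are conjugate, so a multiplicative
  function takes a value \<open>z\<close> with \<open>z\<^sup>2 = z\<close> on them; these elements generate the group.\<close>

lemma alt_fin_perfect:
  fixes w :: "('a \<Rightarrow> 'a) \<Rightarrow> complex"
  assumes S: "infinite S"
    and mult: "\<And>p q. p \<in> carrier (alt_fin S) \<Longrightarrow> q \<in> carrier (alt_fin S) \<Longrightarrow> w (p \<circ> q) = w p * w q"
    and one: "w id = 1" and n: "n \<in> carrier (alt_fin S)"
  shows "w n = 1"
proof -
  have inv: "w p * w (inv_into UNIV p) = 1" if p: "p \<in> carrier (alt_fin S)" for p
  proof -
    have "p \<circ> inv_into UNIV p = id" using alt_fin_inv_apply(2)[OF p] by auto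
    then show ?thesis using mult[OF p alt_fin_inv[OF p]] one by simp
  qed
  have conj: "w (p \<circ> q \<circ> inv_into UNIV p) = w q" if pq: "p \<in> carrier (alt_fin S)" "q \<in> carrier (alt_fin S)" for p q
    using mult[OF alt_fin_comp[OF pq] alt_fin_inv[OF pq(1)]] mult[OF pq] inv[OF pq(1)] by simp
  have klein: "w (transp a b \<circ> transp c d) = w (transp a c \<circ> transp b d)"
    if "a \<in> S" "b \<in> S" "c \<in> S" "d \<in> S" "distinct [a, b, c, d]" for a b c d
  proof -
    \<comment> \<open>The transposition of \<open>b\<close> and \<open>c\<close> is odd, but an even
      permutation with the same values on these four points conjugates in the same way.\<close>
    have "\<exists>p\<in>carrier (alt_fin S). \<forall>x\<in>{a, b, c, d}. p x = transp b c x"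
      using that by (intro ex_alt_fin_extending[OF S]) (auto simp: Transposition.transpose_def inj_on_def)
    then obtain p where p0: "p \<in> carrier (alt_fin S)" "\<forall>x\<in>{a, b, c, d}. p x = transp b c x" by blast
    then have p: "p \<in> carrier (alt_fin S)" "p a = a" "p b = c" "p c = b" "p d = d"
      using that(5) by (auto simp: Transposition.transpose_def)
    have inj: "inv_into UNIV p \<circ> p = id" using alt_fin_inv_apply(1)[OF p(1)] by auto
    have "p \<circ> (transp a b \<circ> transp c d) \<circ> inv_into UNIV p
      = (p \<circ> transp a b \<circ> inv_into UNIV p) \<circ> (p \<circ> transp c d \<circ> inv_into UNIV p)"
      using alt_fin_inv_apply(1)[OF p(1)] by (auto simp: fun_eq_iff)
    also have "\<dots> = transp a c \<circ> transp b d"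
      using transp_comp_bij[OF alt_fin_bij[OF p(1)]] p(2-) by simp
    finally show ?thesis
      using conj[OF p(1) transp_pair_alt_fin, of a b c d] that by simp
  qed
  have disj: "w (transp a b \<circ> transp c d) = 1"
    if abcd: "a \<in> S" "b \<in> S" "c \<in> S" "d \<in> S" "distinct [a, b, c, d]" for a b c d
  proof -
    let ?k1 = "transp a b \<circ> transp c d" and ?k2 = "transp a c \<circ> transp b d"
      and ?k3 = "transp a d \<circ> transp b c"
    have alt: "?k1 \<in> carrier (alt_fin S)" "?k2 \<in> carrier (alt_fin S)"
      using abcd by (auto intro: transp_pair_alt_fin)
    have k: "?k1 \<circ> ?k2 = ?k3" using abcd(5) by (auto simp: fun_eq_iff Transposition.transpose_def)
    have 12: "w ?k2 = w ?k1" using klein[of a b c d] abcd by simp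
    \<comment> \<open>The same conjugacy, with the roles of \<open>c\<close> and \<open>d\<close>
      exchanged.\<close>
    have "w ?k3 = w (transp a b \<circ> transp d c)"
      using klein[of a b d c] abcd by auto
    then have 13: "w ?k3 = w ?k1" by (simp add: transpose_commute)
    have "w ?k1 * w ?k1 = w ?k1" using mult[OF alt] 12 13 k by simp
    moreover have "w ?k1 \<noteq> 0" using inv[OF alt(1)] by auto
    ultimately show ?thesis by simp
  qed
  have pair: "w (transp a b \<circ> transp c d) = 1"
    if abcd: "a \<in> S" "b \<in> S" "c \<in> S" "d \<in> S" "a \<noteq> b" "c \<noteq> d" for a b c d
  proof -
    have "infinite (S - {a, b, c, d})" using S by simp
    from infinite_imp_nonempty[OF this] obtain e where e: "e \<in> S - {a, b, c, d}" by (meson ex_in_conv)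
    have "infinite (S - {a, b, c, d, e})" using S by simp
    from infinite_imp_nonempty[OF this] obtain f where f: "f \<in> S - {a, b, c, d, e}" by (meson ex_in_conv)
    \<comment> \<open>The two transpositions may overlap. A transposition of two fresh points
      bridges them, leaving two products of disjoint transpositions.\<close>
    have "transp a b \<circ> transp c d = (transp a b \<circ> transp e f) \<circ> (transp e f \<circ> transp c d)"
      by (simp add: fun_eq_iff)
    moreover have "w (transp a b \<circ> transp e f) = 1" "w (transp e f \<circ> transp c d) = 1"
      using abcd e f by (auto intro!: disj)
    moreover have "transp a b \<circ> transp e f \<in> carrier (alt_fin S)" "transp e f \<circ> transp c d \<in> carrier (alt_fin S)"
      using abcd e f by (auto intro!: transp_pair_alt_fin)
    ultimately show ?thesis using mult by simp
  qed
  define X where "X = {x. n x \<noteq> x}"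
  have X: "finite X" "X \<subseteq> S" "n permutes X"
    using n by (auto simp: X_def mem_alt_fin permutes_def)
  \<comment> \<open>The function \<open>w\<close> is controlled only on even permutations, while the
    induction adds one transposition at a time. For odd \<open>n\<close> the statement is therefore
    about all products with one more transposition.\<close>
  have "(evenperm n \<longrightarrow> w n = 1) \<and> (\<not> evenperm n \<longrightarrow> (\<forall>a\<in>S. \<forall>b\<in>S. a \<noteq> b \<longrightarrow> w (transp a b \<circ> n) = 1))"
    using X(3,1)
  proof (induction rule: permutes_induct)
    case id
    then show ?case using one by (simp add: id_def)
  next
    case (swap a b p)
    have S': "a \<in> S" "b \<in> S" using swap.hyps X by auto
    have pX: "p permutes X" and ab: "a \<noteq> b" using swap.hyps by auto
    have p: "p permutes S" using permutes_subset[OF pX X(2)] .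
    have "{x. p x \<noteq> x} \<subseteq> X" using pX by (auto simp: permutes_def)
    then have pfin: "finite {x. p x \<noteq> x}" using X(1) finite_subset by blast
    have even: "evenperm (transp a b \<circ> p) \<longleftrightarrow> \<not> evenperm p"
      using evenperm_comp[of "transp a b" p] permutation_of_finite_support[OF p pfin] ab
      by (simp add: permutation_swap_id evenperm_swap)
    show ?case
    proof (cases "evenperm p")
      case True
      then have "p \<in> carrier (alt_fin S)" using p pfin by (simp add: mem_alt_fin)
      then have "w (transp c d \<circ> (transp a b \<circ> p)) = 1" if "c \<in> S" "d \<in> S" "c \<noteq> d" for c d
        using mult[OF transp_pair_alt_fin[OF that(1,2) S' that(3) ab]] pair[OF that(1,2) S' that(3) ab]
          swap.IH True by (simp add: comp_assoc)
      then show ?thesis using even True by blast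
    next
      case False
      then show ?thesis using even swap.IH ab S' by blast
    qed
  qed
  then show ?thesis using n by (simp add: mem_alt_fin)
qed

lemma no_linear_character_alt_fin:
  assumes "infinite S"
  shows "no_linear_character (alt_fin S)"
proof (rule ccontr)
  assume "\<not> ?thesis"
  then obtain w n where "w \<one>\<^bsub>alt_fin S\<^esub> = (1 :: complex)"
    "\<forall>x\<in>carrier (alt_fin S). \<forall>y\<in>carrier (alt_fin S). w (x \<otimes>\<^bsub>alt_fin S\<^esub> y) = w x * w y"
    "n \<in> carrier (alt_fin S)" "w n \<noteq> 1"
    unfolding no_linear_character_def by blast
  then show False using alt_fin_perfect[OF assms, of w n] by (simp add: mult_alt_fin one_alt_fin)
qed

section \<open>Translation acting on even permutations\<close>

theorem enrichment_alternating:
  assumes G: "group G" and inf: "infinite (carrier G)"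
  shows "enrichment G (alt_fin (carrier G)) (alt_supported (carrier G)) (\<lambda>p. p)
    (\<lambda>g p. left_mult G g \<circ> p \<circ> left_mult G (inv\<^bsub>G\<^esub> g))"
proof -
  interpret G: group G by fact
  let ?S = "carrier G"
  interpret supported_group "alt_fin ?S" ?S "alt_supported ?S" "\<lambda>p. p"
    by (rule supported_group_alt_fin[OF inf])
  let ?\<alpha> = "\<lambda>g p. left_mult G g \<circ> p \<circ> left_mult G (inv\<^bsub>G\<^esub> g)"
  have inv_left: "left_mult G (inv\<^bsub>G\<^esub> g) \<circ> left_mult G g = id" if "g \<in> ?S" for g
    using that by (auto simp: left_mult_def fun_eq_iff G.m_assoc[symmetric])
  have left_comp: "left_mult G (g \<otimes>\<^bsub>G\<^esub> h) = left_mult G g \<circ> left_mult G h" if "g \<in> ?S" "h \<in> ?S" for g h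
    using that by (auto simp: left_mult_def fun_eq_iff G.m_assoc)
  have ad: "?\<alpha> g n = p \<circ> n \<circ> inv_into UNIV p"
    if g: "g \<in> ?S" and n: "X \<subseteq> ?S" "n \<in> alt_supported ?S X" and p: "p \<in> carrier (alt_fin ?S)"
      "\<And>x. x \<in> X \<Longrightarrow> p x = g \<otimes>\<^bsub>G\<^esub> x" for g X n p
  proof
    fix x
    note pp = alt_fin_inv_apply[OF p(1)]
    have n': "n y = y" if "y \<notin> X" for y using n that by (simp add: alt_supported_def)
    show "?\<alpha> g n x = (p \<circ> n \<circ> inv_into UNIV p) x"
    proof (cases "inv_into UNIV p x \<in> X")
      case True
      define y where "y = inv_into UNIV p x"
      have y: "y \<in> X" "x = p y" using True pp by (auto simp: y_def)
      then have "x = g \<otimes>\<^bsub>G\<^esub> y" "y \<in> ?S" using p n by auto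
      then have "left_mult G (inv\<^bsub>G\<^esub> g) x = y" using g by (simp add: left_mult_def G.m_assoc[symmetric])
      moreover have "n y \<in> X" using alt_supported_maps[OF n(2) y(1)] .
      then have "left_mult G g (n y) = p (n y)" using p n by (auto simp: left_mult_def)
      ultimately show ?thesis using pp y by simp
    next
      case False
      have "left_mult G (inv\<^bsub>G\<^esub> g) x \<notin> X"
      proof
        assume *: "left_mult G (inv\<^bsub>G\<^esub> g) x \<in> X"
        then have "x \<in> ?S" using n by (auto simp: left_mult_def split: if_splits)
        then have "p (left_mult G (inv\<^bsub>G\<^esub> g) x) = x"
          using p(2)[OF *] g by (simp add: left_mult_def G.m_assoc[symmetric])
        then show False using False * pp(1) by metis
      qed
      moreover have "left_mult G g (left_mult G (inv\<^bsub>G\<^esub> g) x) = x"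
        using g by (auto simp: left_mult_def G.m_assoc[symmetric])
      ultimately show ?thesis using False n' pp(2) by simp
    qed
  qed
  \<comment> \<open>Left translation has infinite support, so the parity of its conjugate cannot be
    computed factor by factor. Replacing it by an even permutation that agrees with it on the
    support of \<open>n\<close> settles finiteness and parity together.\<close>
  have closed: "?\<alpha> g n \<in> carrier (alt_fin ?S)" if g: "g \<in> ?S" and n: "n \<in> carrier (alt_fin ?S)" for g n
  proof -
    obtain X where X: "finite X" "X \<subseteq> ?S" "n \<in> alt_supported ?S X" using L_cover n by blast
    have "inj_on (\<lambda>x. g \<otimes>\<^bsub>G\<^esub> x) X" using X(2) g by (auto simp: inj_on_def subset_iff)
    moreover have "(\<lambda>x. g \<otimes>\<^bsub>G\<^esub> x) ` X \<subseteq> ?S" using X(2) g by auto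
    ultimately obtain q where q: "q \<in> carrier (alt_fin ?S)" "\<forall>x\<in>X. q x = g \<otimes>\<^bsub>G\<^esub> x"
      using ex_alt_fin_extending[OF inf X(1,2)] by blast
    then have "?\<alpha> g n = q \<circ> n \<circ> inv_into UNIV q" using ad[OF g X(2,3)] by blast
    then show ?thesis using alt_fin_comp alt_fin_inv q(1) n by metis
  qed
  show ?thesis
  proof
    fix g assume g: "g \<in> ?S"
    show "?\<alpha> g \<in> hom (alt_fin ?S) (alt_fin ?S)"
    proof (rule homI)
      fix p q
      have "left_mult G (inv\<^bsub>G\<^esub> g) (left_mult G g x) = x" for x using inv_left[OF g] by (metis comp_apply id_apply)
      then show "?\<alpha> g (p \<otimes>\<^bsub>alt_fin ?S\<^esub> q) = ?\<alpha> g p \<otimes>\<^bsub>alt_fin ?S\<^esub> ?\<alpha> g q"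
        by (simp add: mult_alt_fin fun_eq_iff)
    qed (rule closed[OF g])
  next
    fix g h n assume "g \<in> ?S" "h \<in> ?S"
    then show "?\<alpha> (g \<otimes>\<^bsub>G\<^esub> h) n = ?\<alpha> g (?\<alpha> h n)"
      by (simp add: G.inv_mult_group left_comp comp_assoc)
  next
    fix n assume "n \<in> carrier (alt_fin ?S)"
    then have "n permutes ?S" by (simp add: mem_alt_fin)
    then show "?\<alpha> \<one>\<^bsub>G\<^esub> n = n"
      by (auto simp: left_mult_def fun_eq_iff permutes_in_image permutes_not_in)
  next
    fix g X n p assume "g \<in> ?S" "finite X" "X \<subseteq> ?S" "n \<in> alt_supported ?S X" "p \<in> carrier (alt_fin ?S)"
      "\<And>x. x \<in> X \<Longrightarrow> p x = g \<otimes>\<^bsub>G\<^esub> x"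
    then show "?\<alpha> g n = p \<otimes>\<^bsub>alt_fin ?S\<^esub> n \<otimes>\<^bsub>alt_fin ?S\<^esub> inv\<^bsub>alt_fin ?S\<^esub> p"
      using ad alt_conj_carrier[of p ?S n] by (simp add: alt_supported_def)
  next
    show "no_linear_character (alt_fin ?S)" by (rule no_linear_character_alt_fin[OF inf])
  qed
qed

section \<open>Determinants over a finite index set\<close>

lemma det_on_cong:
  assumes "\<And>x y. x \<in> X \<Longrightarrow> y \<in> X \<Longrightarrow> A x y = B x y"
  shows "det_on X A = det_on X B"
  unfolding det_on_def
  by (intro sum.cong refl arg_cong2[where f = "(*)"] prod.cong assms)
    (auto simp: permutes_in_image)

text \<open>A permutation that moves a point off \<open>X0\<close> meets an off-diagonal zero there,
  so only permutations of \<open>X0\<close> contribute, with diagonal factors 1 elsewhere.\<close>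

lemma det_on_extend:
  assumes X: "finite X" "X0 \<subseteq> X"
    and A: "\<And>x y. x \<in> X \<Longrightarrow> y \<in> X \<Longrightarrow> x \<notin> X0 \<or> y \<notin> X0 \<Longrightarrow> A x y = (if x = y then 1 else 0)"
  shows "det_on X A = det_on X0 A"
  unfolding det_on_def
proof (rule sum.mono_neutral_cong_right)
  show "finite {p. p permutes X}" using X by (simp add: finite_permutations)
  show "{p. p permutes X0} \<subseteq> {p. p permutes X}" using X permutes_subset by auto
  show "\<forall>p\<in>{p. p permutes X} - {p. p permutes X0}. of_int (sign p) * (\<Prod>x\<in>X. A x (p x)) = 0"
  proof
    fix p assume p: "p \<in> {p. p permutes X} - {p. p permutes X0}"
    have "\<exists>x\<in>X - X0. p x \<noteq> x"
    proof (rule ccontr)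
      assume "\<not> ?thesis"
      then have "p permutes X0" using p X by (auto simp: permutes_def)
      then show False using p by simp
    qed
    then obtain x where x: "x \<in> X" "x \<notin> X0" "p x \<noteq> x" by blast
    then have "A x (p x) = 0" using A[of x "p x"] p by (auto simp: permutes_in_image)
    then have "(\<Prod>x\<in>X. A x (p x)) = 0" using X x by (intro prod_zero) auto
    then show "of_int (sign p) * (\<Prod>x\<in>X. A x (p x)) = 0" by simp
  qed
  fix p assume "p \<in> {p. p permutes X0}"
  then have p: "p permutes X0" by simp
  have "(\<Prod>x\<in>X. A x (p x)) = (\<Prod>x\<in>X0. A x (p x))"
    using X p A by (intro prod.mono_neutral_right) (auto simp: permutes_not_in)
  then show "of_int (sign p) * (\<Prod>x\<in>X. A x (p x)) = of_int (sign p) * (\<Prod>x\<in>X0. A x (p x))"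
    by simp
qed

lemma det_on_singleton: "det_on {z} A = A z z"
  by (simp add: det_on_def permutes_sing sign_id)

text \<open>The usual argument that the determinant equals its negative proves nothing in
  characteristic 2. Instead, composition with the transposition matches the even terms with the odd
  ones, and matched terms cancel.\<close>

lemma det_on_identical_rows:
  assumes X: "finite X" and ab: "a \<in> X" "b \<in> X" "a \<noteq> b" and rows: "\<And>y. y \<in> X \<Longrightarrow> A a y = A b y"
  shows "det_on X A = (0 :: 'f::field)"
proof -
  let ?t = "transp a b"
  let ?F = "\<lambda>p. of_int (sign p) * (\<Prod>x\<in>X. A x (p x)) :: 'f"
  let ?E = "{p. p permutes X \<and> evenperm p}" and ?O = "{p. p permutes X \<and> \<not> evenperm p}"
  have t: "?t permutes X" using ab by (simp add: permutes_swap_id)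
  have perm: "permutation p" if "p permutes X" for p
    using that X permutation_permutes by blast
  have ev: "evenperm (p \<circ> ?t) \<longleftrightarrow> \<not> evenperm p" if "p permutes X" for p
    using evenperm_comp[OF perm[OF that], of ?t] ab by (simp add: permutation_swap_id evenperm_swap)
  have tt: "p \<circ> ?t \<circ> ?t = p" for p :: "'a \<Rightarrow> 'a" by (simp add: fun_eq_iff)
  have fin: "finite ?E" "finite ?O" using finite_permutations[OF X] by (auto intro: finite_subset[rotated])
  have img: "(\<lambda>p. p \<circ> ?t) ` ?E = ?O"
  proof (intro equalityI subsetI)
    fix q assume "q \<in> ?O"
    then have q: "q permutes X" "\<not> evenperm q" by auto
    have "q \<circ> ?t \<in> ?E" using q ev[OF q(1)] permutes_compose[OF t q(1)] by simp
    then show "q \<in> (\<lambda>p. p \<circ> ?t) ` ?E" by (rule rev_image_eqI) (simp only: tt)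
  next
    fix q assume "q \<in> (\<lambda>p. p \<circ> ?t) ` ?E"
    then show "q \<in> ?O" using ev permutes_compose[OF t] by auto
  qed
  have inj: "inj_on (\<lambda>p. p \<circ> ?t) ?E" by (rule inj_onI) (metis tt)
  have F: "?F (p \<circ> ?t) = - ?F p" if p: "p \<in> ?E" for p
  proof -
    have pX: "p permutes X" using p by simp
    have "(\<Prod>x\<in>X. A x (p x)) = (\<Prod>x\<in>X. A (?t x) (p (?t x)))"
      using prod.permute[OF t, of "\<lambda>x. A x (p x)"] by (simp add: o_def)
    also have "\<dots> = (\<Prod>x\<in>X. A x (p (?t x)))"
    proof (rule prod.cong[OF refl])
      fix x assume "x \<in> X"
      then have "p (?t x) \<in> X" using pX t by (simp add: permutes_in_image)
      then show "A (?t x) (p (?t x)) = A x (p (?t x))"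
        using rows[of "p (?t x)"] by (auto simp: Transposition.transpose_def split: if_splits)
    qed
    finally show ?thesis using p ev[OF pX] by (simp add: sign_def)
  qed
  have "det_on X A = sum ?F (?E \<union> ?O)"
    unfolding det_on_def by (rule sum.cong) auto
  also have "\<dots> = sum ?F ?E + sum ?F ?O"
    using fin by (intro sum.union_disjoint) auto
  also have "sum ?F ?O = (\<Sum>p\<in>?E. ?F (p \<circ> ?t))"
    unfolding img[symmetric] by (subst sum.reindex[OF inj]) simp
  also have "\<dots> = - sum ?F ?E"
    using F by (simp add: sum_negf[symmetric])
  finally show ?thesis by simp
qed

lemma det_on_add_row:
  assumes X: "finite X" and ab: "a \<in> X" "b \<in> X" "a \<noteq> b"
  shows "det_on X (\<lambda>x y. if x = a then A x y + c * A b y else A x y) = det_on X A"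
proof -
  let ?B = "\<lambda>x y. if x = a then A b y else A x y"
  have split: "(\<Prod>x\<in>X. if x = a then f x else g x) = f a * (\<Prod>x\<in>X - {a}. g x)" for f g :: "'a \<Rightarrow> 'b"
    using X ab(1) by (subst prod.remove[of _ a]) (auto intro!: prod.cong)
  have "of_int (sign p) * (\<Prod>x\<in>X. if x = a then A x (p x) + c * A b (p x) else A x (p x))
      = of_int (sign p) * (\<Prod>x\<in>X. A x (p x)) + c * (of_int (sign p) * (\<Prod>x\<in>X. if x = a then A b (p x) else A x (p x)))" for p
    unfolding split using prod.remove[OF X ab(1), of "\<lambda>x. A x (p x)"] by (simp add: algebra_simps)
  then have "det_on X (\<lambda>x y. if x = a then A x y + c * A b y else A x y) = det_on X A + c * det_on X ?B"
    unfolding det_on_def by (simp add: sum.distrib sum_distrib_left)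
  moreover have "det_on X ?B = 0"
    by (rule det_on_identical_rows[OF X ab]) (use ab in auto)
  ultimately show ?thesis by simp
qed

lemma det_on_add_rows:
  assumes X: "finite X" and z: "z \<in> X" "u z = 0"
  shows "det_on X (\<lambda>x y. A x y + u x * A z y) = det_on X A"
proof -
  \<comment> \<open>The rows are changed one at a time; row \<open>z\<close> never changes because
    \<open>z \<notin> W\<close>, so the same multiple of it is available throughout.\<close>
  have "det_on X (\<lambda>x y. A x y + (if x \<in> W then u x else 0) * A z y) = det_on X A" if "finite W" "W \<subseteq> X - {z}" for W
    using that
  proof (induction W)
    case (insert a W)
    let ?B = "\<lambda>x y. A x y + (if x \<in> W then u x else 0) * A z y"
    have "det_on X (\<lambda>x y. A x y + (if x \<in> insert a W then u x else 0) * A z y)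
      = det_on X (\<lambda>x y. if x = a then ?B x y + u a * ?B z y else ?B x y)"
      by (rule det_on_cong) (use insert in auto)
    also have "\<dots> = det_on X ?B"
      using insert z by (intro det_on_add_row[OF X]) auto
    finally show ?case using insert by simp
  qed simp
  from this[of "X - {z}"] have "det_on X (\<lambda>x y. A x y + (if x \<in> X - {z} then u x else 0) * A z y) = det_on X A"
    using X by simp
  moreover have "det_on X (\<lambda>x y. A x y + u x * A z y) = det_on X (\<lambda>x y. A x y + (if x \<in> X - {z} then u x else 0) * A z y)"
    by (rule det_on_cong) (use z in auto)
  ultimately show ?thesis by simp
qed

lemma det_on_permutation_matrix:
  assumes X: "finite X" and p: "p permutes X"
  shows "det_on X (\<lambda>x y. if x = p y then 1 else 0) = (of_int (sign p) :: 'f::field)"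
proof -
  let ?q = "inv_into UNIV p"
  let ?F = "\<lambda>q. of_int (sign q) * (\<Prod>x\<in>X. if x = p (q x) then 1 else 0) :: 'f"
  have q: "?q permutes X" using p by (rule permutes_inv)
  have "?F q = 0" if "q \<in> {q. q permutes X} - {?q}" for q
  proof -
    have "\<exists>x\<in>X. x \<noteq> p (q x)"
    proof (rule ccontr)
      assume "\<not> ?thesis"
      then have "p (q x) = x" for x
        using that p by (cases "x \<in> X") (auto simp: permutes_not_in)
      then have "q x = ?q x" for x using permutes_inverses(2)[OF p] by metis
      then show False using that by auto
    qed
    then have "(\<Prod>x\<in>X. if x = p (q x) then 1 else 0) = (0 :: 'f)" using X by (intro prod_zero) auto
    then show ?thesis by simp
  qed
  then have "det_on X (\<lambda>x y. if x = p y then 1 else 0) = sum ?F {?q}"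
    unfolding det_on_def using q finite_permutations[OF X] by (intro sum.mono_neutral_right) auto
  also have "\<dots> = of_int (sign p)"
  proof -
    have "permutation p" using p X permutation_permutes by blast
    then show ?thesis using permutes_inverses(1)[OF p] sign_inverse[of p] by simp
  qed
  finally show ?thesis .
qed

section \<open>Linear maps acting within finitely many coordinates\<close>

lemma free_space_0: "(\<lambda>x. 0) \<in> free_space S"
  by (simp add: free_space_def)

lemma free_space_add:
  assumes "u \<in> free_space S" "v \<in> free_space S"
  shows "(\<lambda>x. u x + v x) \<in> free_space S"
proof -
  have "{x. u x + v x \<noteq> 0} \<subseteq> {x. u x \<noteq> 0} \<union> {x. v x \<noteq> 0}" by auto
  then show ?thesis
    using assms finite_subset[of "{x. u x + v x \<noteq> 0}" "{x. u x \<noteq> 0} \<union> {x. v x \<noteq> 0}"]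
    by (auto simp: free_space_def)
qed

lemma free_space_scale:
  assumes "v \<in> free_space S"
  shows "(\<lambda>x. c * v x) \<in> free_space S"
proof -
  have "{x. c * v x \<noteq> 0} \<subseteq> {x. v x \<noteq> 0}" by auto
  then show ?thesis
    using assms finite_subset[of "{x. c * v x \<noteq> 0}" "{x. v x \<noteq> 0}"]
    by (auto simp: free_space_def)
qed

lemma free_space_diff:
  assumes "u \<in> free_space S" "v \<in> free_space S"
  shows "(\<lambda>x. u x - v x) \<in> free_space S"
  using free_space_add[OF assms(1) free_space_scale[OF assms(2), of "-1"]] by simp

lemma free_space_basis: "y \<in> S \<Longrightarrow> basis_vector y \<in> free_space S"
  by (simp add: free_space_def basis_vector_def)

lemma free_space_outside: "v \<in> free_space S \<Longrightarrow> x \<notin> S \<Longrightarrow> v x = 0"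
  by (auto simp: free_space_def)

lemma free_space_mono: "X \<subseteq> S \<Longrightarrow> free_space X \<subseteq> free_space S"
  by (auto simp: free_space_def)

lemma free_space_induct [consumes 1, case_names zero basis add scale]:
  fixes v :: "'a \<Rightarrow> 'f::field"
  assumes "v \<in> free_space S"
    and zero: "P (\<lambda>x. 0)" and basis: "\<And>y. y \<in> S \<Longrightarrow> P (basis_vector y)"
    and add: "\<And>u v. u \<in> free_space S \<Longrightarrow> v \<in> free_space S \<Longrightarrow> P u \<Longrightarrow> P v \<Longrightarrow> P (\<lambda>x. u x + v x)"
    and scale: "\<And>c v. v \<in> free_space S \<Longrightarrow> P v \<Longrightarrow> P (\<lambda>x. c * v x)"
  shows "P v"
proof -
  have "P (\<lambda>x. if x \<in> W then v x else 0) \<and> (\<lambda>x. if x \<in> W then v x else 0) \<in> free_space S"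
    if "finite W" "W \<subseteq> S" for W
    using that
  proof (induction W)
    case empty
    then show ?case using zero free_space_0 by simp
  next
    case (insert y W)
    have "(\<lambda>x. if x \<in> insert y W then v x else 0)
      = (\<lambda>x. (if x \<in> W then v x else 0) + v y * basis_vector y x)"
      using insert by (auto simp: fun_eq_iff basis_vector_def)
    moreover have y: "y \<in> S" and W: "P (\<lambda>x. if x \<in> W then v x else 0)"
      "(\<lambda>x. if x \<in> W then v x else 0) \<in> free_space S"
      using insert by auto
    note sc = free_space_scale[OF free_space_basis[OF y], of "v y"]
    have "P (\<lambda>x. v y * basis_vector y x)" by (rule scale[OF free_space_basis[OF y] basis[OF y]])
    then have "P (\<lambda>x. (if x \<in> W then v x else 0) + v y * basis_vector y x)"
      by (rule add[OF W(2) sc W(1)])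
    ultimately show ?case using free_space_add[OF W(2) sc] by simp
  qed
  from this[of "{x. v x \<noteq> 0}"] have "P (\<lambda>x. if x \<in> {x. v x \<noteq> 0} then v x else 0)"
    using assms(1) by (auto simp: free_space_def)
  moreover have "(\<lambda>x. if x \<in> {x. v x \<noteq> 0} then v x else 0) = v" by auto
  ultimately show ?thesis by simp
qed

lemma free_linear_add:
  "linear_on_free_space S T \<Longrightarrow> u \<in> free_space S \<Longrightarrow> v \<in> free_space S \<Longrightarrow>
    T (\<lambda>x. u x + v x) = (\<lambda>x. T u x + T v x)"
  by (simp add: linear_on_free_space_def)

lemma free_linear_scale:
  "linear_on_free_space S T \<Longrightarrow> v \<in> free_space S \<Longrightarrow> T (\<lambda>x. c * v x) = (\<lambda>x. c * T v x)"
  by (simp add: linear_on_free_space_def)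

lemma free_linear_zero: "linear_on_free_space S T \<Longrightarrow> T (\<lambda>x. 0) = (\<lambda>x. 0)"
  using free_linear_scale[OF _ free_space_0, of S T 0] by simp

lemma free_linear_diff:
  assumes "linear_on_free_space S T" "u \<in> free_space S" "v \<in> free_space S"
  shows "T (\<lambda>x. u x - v x) = (\<lambda>x. T u x - T v x)"
  using free_linear_add[OF assms(1,2) free_space_scale[OF assms(3), of "-1"]] free_linear_scale[OF assms(1,3), of "-1"]
  by simp

text \<open>A form of the condition that \<open>T - 1\<close> has all its matrix entries in the
  block of \<open>X\<close>: its image is supported on \<open>X\<close>, and it kills vectors
  vanishing on \<open>X\<close>. It composes and inverts more easily than a statement about
  entries.\<close>

definition acts_within :: "'a set \<Rightarrow> 'a set \<Rightarrow> (('a \<Rightarrow> 'f::field) \<Rightarrow> ('a \<Rightarrow> 'f)) \<Rightarrow> bool" where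
  "acts_within S X T \<longleftrightarrow> (\<forall>v\<in>free_space S. (\<forall>x. x \<notin> X \<longrightarrow> T v x = v x) \<and>
     ((\<forall>x\<in>X. v x = 0) \<longrightarrow> T v = v))"

lemma acts_withinD:
  assumes "acts_within S X T" "v \<in> free_space S"
  shows "x \<notin> X \<Longrightarrow> T v x = v x" and "(\<And>x. x \<in> X \<Longrightarrow> v x = 0) \<Longrightarrow> T v = v"
  using assms unfolding acts_within_def by blast+

lemma acts_within_mono: "acts_within S X T \<Longrightarrow> X \<subseteq> Y \<Longrightarrow> acts_within S Y T"
  unfolding acts_within_def by (meson subsetD)

text \<open>The displacement \<open>T v - v\<close> depends only on the coordinates of
  \<open>v\<close> in \<open>X\<close>, by linearity applied to \<open>u - v\<close>.\<close>

lemma acts_within_diff: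
  assumes lin: "linear_on_free_space S T" and T: "acts_within S X T"
    and uv: "u \<in> free_space S" "v \<in> free_space S" "\<And>x. x \<in> X \<Longrightarrow> u x = v x"
  shows "T u x - u x = T v x - v x"
proof -
  have "T (\<lambda>x. u x - v x) = (\<lambda>x. u x - v x)"
    by (rule acts_withinD(2)[OF T free_space_diff[OF uv(1,2)]]) (simp add: uv)
  then have "T u x - T v x = u x - v x"
    using free_linear_diff[OF lin uv(1,2)] by (metis (no_types))
  then show ?thesis by (simp add: algebra_simps)
qed

lemma acts_within_iff_nontrivial_entries:
  assumes lin: "linear_on_free_space S T" and T: "T ` free_space S \<subseteq> free_space S" and X: "X \<subseteq> S"
  shows "acts_within S X T \<longleftrightarrow> nontrivial_entries S T \<subseteq> X \<times> X"
proof
  assume aw: "acts_within S X T"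
  have "matrix_entry T x y = (if x = y then 1 else 0)" if "x \<in> S" "y \<in> S" "x \<notin> X \<or> y \<notin> X" for x y
  proof -
    have "T (basis_vector y) x = basis_vector y x"
      using that(3)
    proof
      assume "x \<notin> X"
      then show ?thesis by (rule acts_withinD(1)[OF aw free_space_basis[OF that(2)]])
    next
      assume "y \<notin> X"
      then have "T (basis_vector y) = basis_vector y"
        by (intro acts_withinD(2)[OF aw free_space_basis[OF that(2)]]) (auto simp: basis_vector_def)
      then show ?thesis by simp
    qed
    then show ?thesis by (simp add: matrix_entry_def basis_vector_def)
  qed
  then show "nontrivial_entries S T \<subseteq> X \<times> X"
    unfolding nontrivial_entries_def by (intro subrelI) blast
next
  assume ne: "nontrivial_entries S T \<subseteq> X \<times> X"
  have e: "T (basis_vector y) x = basis_vector y x" if "y \<in> S" "x \<notin> X \<or> y \<notin> X" for x y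
  proof (cases "x \<in> S")
    case True
    then have "(x, y) \<notin> nontrivial_entries S T" using ne that by blast
    then show ?thesis using True that by (auto simp: nontrivial_entries_def matrix_entry_def basis_vector_def)
  next
    case False
    then show ?thesis
      using T free_space_basis[OF that(1)] free_space_outside[of _ S x] by (metis image_subset_iff)
  qed
  have 1: "T v x = v x" if "v \<in> free_space S" "x \<notin> X" for v x
    using that(1) by (induction v rule: free_space_induct)
      (use that(2) lin in \<open>auto simp: free_linear_zero free_linear_add free_linear_scale e\<close>)
  have 2: "T v = v" if v: "v \<in> free_space S" "\<forall>x\<in>X. v x = 0" for v
  proof -
    have "v \<in> free_space (S - X)" using v by (auto simp: free_space_def)
    then show ?thesis
    proof (induction v rule: free_space_induct)
      case (basis y)
      then show ?case using e by (auto simp: fun_eq_iff)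
    next
      case (add u v)
      have "u \<in> free_space S" "v \<in> free_space S" using add free_space_mono[of "S - X" S] by auto
      then show ?case using free_linear_add[OF lin] add by simp
    next
      case (scale c v)
      then show ?case using free_space_mono[of "S - X" S] lin by (auto simp: free_linear_scale)
    qed (rule free_linear_zero[OF lin])
  qed
  show "acts_within S X T" unfolding acts_within_def using 1 2 by blast
qed

definition gl_within :: "'a set \<Rightarrow> 'a set \<Rightarrow> (('a \<Rightarrow> 'f::field) \<Rightarrow> ('a \<Rightarrow> 'f)) set" where
  "gl_within S X = {T \<in> Bij (free_space S). linear_on_free_space S T \<and> acts_within S X T}"

lemma gl_withinD:
  assumes "T \<in> gl_within S X"
  shows "T \<in> Bij (free_space S)" "linear_on_free_space S T" "acts_within S X T"
    "v \<in> free_space S \<Longrightarrow> T v \<in> free_space S" "inj_on T (free_space S)" "T \<in> extensional (free_space S)"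
  using assms by (auto simp: gl_within_def Bij_def bij_betw_def)

lemma mult_BijGroup:
  "T \<in> Bij S \<Longrightarrow> U \<in> Bij S \<Longrightarrow> T \<otimes>\<^bsub>BijGroup S\<^esub> U = compose S T U"
  by (simp add: BijGroup_def)

lemma carrier_BijGroup: "carrier (BijGroup S) = Bij S"
  by (simp add: BijGroup_def)

lemma one_BijGroup: "\<one>\<^bsub>BijGroup S\<^esub> = (\<lambda>x\<in>S. x)"
  by (simp add: BijGroup_def)

lemma gl_within_mult:
  assumes T: "T \<in> gl_within S X" and U: "U \<in> gl_within S X"
  shows "T \<otimes>\<^bsub>BijGroup (free_space S)\<^esub> U \<in> gl_within S X"
    and "v \<in> free_space S \<Longrightarrow> (T \<otimes>\<^bsub>BijGroup (free_space S)\<^esub> U) v = T (U v)"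
proof -
  note T' = gl_withinD[OF T] and U' = gl_withinD[OF U]
  have eq: "T \<otimes>\<^bsub>BijGroup (free_space S)\<^esub> U = compose (free_space S) T U"
    using T'(1) U'(1) by (rule mult_BijGroup)
  show app: "(T \<otimes>\<^bsub>BijGroup (free_space S)\<^esub> U) v = T (U v)" if "v \<in> free_space S" for v
    using that by (simp add: eq compose_def)
  have "linear_on_free_space S (compose (free_space S) T U)"
    unfolding linear_on_free_space_def
    by (auto simp: compose_def free_space_add free_space_scale free_linear_add[OF U'(2)] free_linear_scale[OF U'(2)]
        free_linear_add[OF T'(2) U'(4) U'(4)] free_linear_scale[OF T'(2) U'(4)])
  moreover have "acts_within S X (compose (free_space S) T U)"
    unfolding acts_within_def
  proof (intro ballI conjI allI impI)
    fix v :: "'a \<Rightarrow> 'b" assume v: "v \<in> free_space S"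
    show "compose (free_space S) T U v x = v x" if "x \<notin> X" for x
      using v that acts_withinD(1)[OF T'(3) U'(4)[OF v] that] acts_withinD(1)[OF U'(3) v that]
      by (simp add: compose_def)
    show "compose (free_space S) T U v = v" if "\<forall>x\<in>X. v x = 0"
      using v that acts_withinD(2)[OF T'(3) v] acts_withinD(2)[OF U'(3) v] by (simp add: compose_def)
  qed
  ultimately show "T \<otimes>\<^bsub>BijGroup (free_space S)\<^esub> U \<in> gl_within S X"
    unfolding eq gl_within_def using T'(1) U'(1) by (simp add: compose_Bij)
qed

lemma one_gl_within: "\<one>\<^bsub>BijGroup (free_space S)\<^esub> \<in> gl_within S X"
  unfolding one_BijGroup gl_within_def
  by (auto simp: id_Bij linear_on_free_space_def acts_within_def free_space_add free_space_scale)

lemma inv_BijGroup_apply: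
  assumes "T \<in> Bij S" "v \<in> S"
  shows "T ((inv\<^bsub>BijGroup S\<^esub> T) v) = v" "(inv\<^bsub>BijGroup S\<^esub> T) v \<in> S" "(inv\<^bsub>BijGroup S\<^esub> T) (T v) = v"
proof -
  have bij: "bij_betw T S S" using assms by (simp add: Bij_def)
  then have Tv: "T v \<in> S" using assms by (auto simp: bij_betw_def)
  show "T ((inv\<^bsub>BijGroup S\<^esub> T) v) = v" "(inv\<^bsub>BijGroup S\<^esub> T) v \<in> S" "(inv\<^bsub>BijGroup S\<^esub> T) (T v) = v"
    using bij assms Tv
    by (auto simp: inv_BijGroup bij_betw_def f_inv_into_f inv_into_into inv_into_f_f)
qed

lemma gl_within_inv:
  assumes T: "T \<in> gl_within S X"
  shows "inv\<^bsub>BijGroup (free_space S)\<^esub> T \<in> gl_within S X"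
proof -
  let ?V = "free_space S"
  let ?I = "inv\<^bsub>BijGroup ?V\<^esub> T"
  interpret B: group "BijGroup ?V" by (rule group_BijGroup)
  note T' = gl_withinD[OF T]
  note I = inv_BijGroup_apply[OF T'(1)]
  have I_eq: "?I w = v" if "v \<in> ?V" "w = T v" for v w
    using I(3)[OF that(1)] that(2) by simp
  have "?I \<in> Bij ?V" using B.inv_closed[of T] T'(1) by (simp add: carrier_BijGroup)
  moreover have "linear_on_free_space S ?I"
    unfolding linear_on_free_space_def
  proof (intro conjI ballI allI)
    fix u v :: "'a \<Rightarrow> 'b" assume u: "u \<in> ?V" and v: "v \<in> ?V"
    show "?I (\<lambda>x. u x + v x) = (\<lambda>x. ?I u x + ?I v x)"
      by (rule I_eq[OF free_space_add[OF I(2)[OF u] I(2)[OF v]]])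
        (simp add: free_linear_add[OF T'(2) I(2)[OF u] I(2)[OF v]] I(1)[OF u] I(1)[OF v])
  next
    fix c :: 'b and v :: "'a \<Rightarrow> 'b" assume v: "v \<in> ?V"
    show "?I (\<lambda>x. c * v x) = (\<lambda>x. c * ?I v x)"
      by (rule I_eq[OF free_space_scale[OF I(2)[OF v]]])
        (simp add: free_linear_scale[OF T'(2) I(2)[OF v]] I(1)[OF v])
  qed
  moreover have "acts_within S X ?I"
    unfolding acts_within_def
  proof (intro ballI conjI allI impI)
    fix v :: "'a \<Rightarrow> 'b" assume v: "v \<in> ?V"
    show "?I v x = v x" if "x \<notin> X" for x
      using acts_withinD(1)[OF T'(3) I(2)[OF v] that] I(1)[OF v] by simp
    show "?I v = v" if "\<forall>x\<in>X. v x = 0"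
      using acts_withinD(2)[OF T'(3) v] that by (intro I_eq[OF v]) simp
  qed
  ultimately show ?thesis by (simp add: gl_within_def)
qed

lemma subgroup_gl_within: "subgroup (gl_within S X) (BijGroup (free_space S))"
proof -
  interpret B: group "BijGroup (free_space S)" by (rule group_BijGroup)
  show ?thesis
  proof (rule B.subgroupI)
    show "gl_within S X \<noteq> {}" using one_gl_within by blast
  qed (auto simp: carrier_BijGroup gl_within_inv gl_within_mult(1) gl_withinD(1))
qed

section \<open>Transvections\<close>

text \<open>The operator \<open>1 + u\<close> tensor the \<open>z\<close>-th coordinate. A whole
  vector \<open>u\<close> bundles the elementary matrices of one column, so one operator clears a
  column; with \<open>u z = 0\<close> the inverse is obtained by negating \<open>u\<close>.\<close>

definition tv :: "'a set \<Rightarrow> 'a \<Rightarrow> ('a \<Rightarrow> 'f::field) \<Rightarrow> ('a \<Rightarrow> 'f) \<Rightarrow> ('a \<Rightarrow> 'f)" where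
  "tv S z u = (\<lambda>v\<in>free_space S. \<lambda>x. v x + v z * u x)"

definition transvections :: "'a set \<Rightarrow> 'a set \<Rightarrow> (('a \<Rightarrow> 'f::field) \<Rightarrow> ('a \<Rightarrow> 'f)) set" where
  "transvections S X = {tv S z u |z u. z \<in> X \<and> u \<in> free_space X \<and> u z = 0}"

lemma tv_gl_within:
  assumes z: "z \<in> X" and X: "X \<subseteq> S" and u: "u \<in> free_space X" "u z = 0"
  shows "tv S z u \<in> gl_within S X"
    and "inv\<^bsub>BijGroup (free_space S)\<^esub> (tv S z u) = tv S z (\<lambda>x. - u x)"
proof -
  let ?V = "free_space S"
  interpret B: group "BijGroup ?V" by (rule group_BijGroup)
  have V: "tv S z w v \<in> ?V" if "w \<in> free_space X" "v \<in> ?V" for v w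
    using that free_space_add[OF that(2) free_space_scale[of w S "v z"]] free_space_mono[OF X]
    by (auto simp: tv_def)
  have u': "(\<lambda>x. - u x) \<in> free_space X" using u by (simp add: free_space_def)
  have cancel: "tv S z (\<lambda>x. - w x) (tv S z w v) = v" if "w \<in> free_space X" "w z = 0" "v \<in> ?V" for w v
    using V[OF that(1,3)] that(2,3) by (simp add: tv_def)
  have bij: "tv S z w \<in> Bij ?V" if w: "w \<in> free_space X" "w z = 0" for w
  proof -
    have w': "(\<lambda>x. - w x) \<in> free_space X" using w by (simp add: free_space_def)
    have "bij_betw (tv S z w) ?V ?V"
    proof (rule bij_betwI[where g = "tv S z (\<lambda>x. - w x)"])
      show "tv S z (\<lambda>x. - w x) (tv S z w v) = v" if "v \<in> ?V" for v using cancel w that by blast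
      show "tv S z w (tv S z (\<lambda>x. - w x) v) = v" if "v \<in> ?V" for v
        using cancel[OF w' _ that] w by simp
    qed (use V w w' in auto)
    then show ?thesis by (simp add: Bij_def tv_def)
  qed
  show "tv S z u \<in> gl_within S X"
    unfolding gl_within_def
  proof (intro CollectI conjI bij u)
    show "linear_on_free_space S (tv S z u)"
      unfolding linear_on_free_space_def tv_def
      by (auto simp: free_space_add free_space_scale fun_eq_iff algebra_simps)
    show "acts_within S X (tv S z u)"
      using z free_space_outside[OF u(1)] by (auto simp: acts_within_def tv_def)
  qed
  show "inv\<^bsub>BijGroup ?V\<^esub> (tv S z u) = tv S z (\<lambda>x. - u x)"
  proof (rule B.inv_equality)
    have "compose ?V (tv S z (\<lambda>x. - u x)) (tv S z u) = (\<lambda>v\<in>?V. v)"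
      using cancel[OF u] by (auto simp: compose_def)
    then show "tv S z (\<lambda>x. - u x) \<otimes>\<^bsub>BijGroup ?V\<^esub> tv S z u = \<one>\<^bsub>BijGroup ?V\<^esub>"
      using bij[OF u] bij[OF u'] u by (simp add: mult_BijGroup one_BijGroup)
  qed (use bij[OF u] bij[OF u'] u in \<open>auto simp: carrier_BijGroup\<close>)
qed

lemma transvections_subset: "X \<subseteq> S \<Longrightarrow> transvections S X \<subseteq> gl_within S X"
  by (auto simp: transvections_def intro!: tv_gl_within(1))

text \<open>Multiplication from the left adds multiples of row \<open>z\<close> to the other
  rows.\<close>

lemma det_on_tv_mult:
  fixes T :: "('a \<Rightarrow> 'f::field) \<Rightarrow> ('a \<Rightarrow> 'f)"
  assumes X: "finite X" "X \<subseteq> S" and z: "z \<in> X" and u: "u \<in> free_space X" "u z = 0" and T: "T \<in> gl_within S X"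
  shows "det_on X (matrix_entry (tv S z u \<otimes>\<^bsub>BijGroup (free_space S)\<^esub> T)) = det_on X (matrix_entry T)"
proof -
  have "det_on X (matrix_entry (tv S z u \<otimes>\<^bsub>BijGroup (free_space S)\<^esub> T))
    = det_on X (\<lambda>x y. matrix_entry T x y + u x * matrix_entry T z y)"
  proof (rule det_on_cong)
    fix x y assume "y \<in> X"
    then have y: "basis_vector y \<in> (free_space S :: ('a \<Rightarrow> 'f) set)"
      by (rule free_space_basis[OF subsetD[OF X(2)]])
    show "matrix_entry (tv S z u \<otimes>\<^bsub>BijGroup (free_space S)\<^esub> T) x y = matrix_entry T x y + u x * matrix_entry T z y"
      unfolding matrix_entry_def gl_within_mult(2)[OF tv_gl_within(1)[OF z X(2) u] T y]
      using gl_withinD(4)[OF T y] by (simp add: tv_def)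
  qed
  also have "\<dots> = det_on X (matrix_entry T)"
    using X(1) z u(2) by (rule det_on_add_rows)
  finally show ?thesis .
qed

section \<open>Generation by transvections\<close>

lemma basis_vector_same: "basis_vector y y = 1"
  by (simp add: basis_vector_def)

lemma free_space_shrink: "v \<in> free_space S \<Longrightarrow> (\<And>x. x \<notin> X \<Longrightarrow> v x = 0) \<Longrightarrow> v \<in> free_space X"
  by (auto simp: free_space_def)

definition tv_group :: "'a set \<Rightarrow> 'a set \<Rightarrow> (('a \<Rightarrow> 'f::field) \<Rightarrow> ('a \<Rightarrow> 'f)) set" where
  "tv_group S X = generate (BijGroup (free_space S)) (transvections S X)"

lemma transvections_subset_Bij: "X \<subseteq> S \<Longrightarrow> transvections S X \<subseteq> carrier (BijGroup (free_space S))"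
  using transvections_subset gl_withinD(1) by (fastforce simp: carrier_BijGroup)

lemma subgroup_tv_group: "X \<subseteq> S \<Longrightarrow> subgroup (tv_group S X) (BijGroup (free_space S))"
  unfolding tv_group_def
  by (rule group.generate_is_subgroup[OF group_BijGroup transvections_subset_Bij])

lemma tv_group_subset: "X \<subseteq> S \<Longrightarrow> tv_group S X \<subseteq> gl_within S X"
  unfolding tv_group_def
  by (rule group.generate_subgroup_incl[OF group_BijGroup transvections_subset subgroup_gl_within])

lemma tv_group_mono:
  assumes "X \<subseteq> Y"
  shows "tv_group S X \<subseteq> tv_group S Y"
proof -
  have "transvections S X \<subseteq> transvections S Y"
    unfolding transvections_def using assms free_space_mono[OF assms] by (auto 4 4)
  then show ?thesis
    unfolding tv_group_def by (rule group.mono_generate[OF group_BijGroup])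
qed

lemma tv_in_tv_group: "z \<in> X \<Longrightarrow> u \<in> free_space X \<Longrightarrow> u z = 0 \<Longrightarrow> tv S z u \<in> tv_group S X"
  unfolding tv_group_def by (rule generate.incl) (auto simp: transvections_def)

lemma det_on_tv_group_mult:
  fixes T :: "('a \<Rightarrow> 'f::field) \<Rightarrow> ('a \<Rightarrow> 'f)"
  assumes X: "finite X" "X \<subseteq> S" and h: "h \<in> tv_group S X" and T: "T \<in> gl_within S X"
  shows "det_on X (matrix_entry (h \<otimes>\<^bsub>BijGroup (free_space S)\<^esub> T)) = det_on X (matrix_entry T)"
proof -
  interpret B: group "BijGroup (free_space S :: ('a \<Rightarrow> 'f) set)" by (rule group_BijGroup)
  have gl: "U \<in> carrier (BijGroup (free_space S))" if "U \<in> gl_within S X" for U :: "('a \<Rightarrow> 'f) \<Rightarrow> ('a \<Rightarrow> 'f)"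
    using gl_withinD(1)[OF that] by (simp add: carrier_BijGroup)
  show ?thesis
    using h[unfolded tv_group_def] T
  proof (induction arbitrary: T rule: generate.induct)
    case one
    then show ?case using gl by simp
  next
    case (incl h)
    then show ?case using det_on_tv_mult[OF X] by (auto simp: transvections_def)
  next
    case (inv h)
    then obtain z u where zu: "h = tv S z u" "z \<in> X" "u \<in> free_space X" "u z = 0"
      by (auto simp: transvections_def)
    have "(\<lambda>x. - u x) \<in> free_space X" using zu by (simp add: free_space_def)
    then show ?case
      using det_on_tv_mult[OF X zu(2) _ _ inv.prems, of "\<lambda>x. - u x"] zu
      by (simp add: tv_gl_within(2)[OF zu(2) X(2) zu(3,4)])
  next
    case (eng h1 h2)
    have "h1 \<in> gl_within S X" "h2 \<in> gl_within S X"
      using eng.hyps tv_group_subset[OF X(2)] by (auto simp: tv_group_def)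
    then show ?case
      using eng.IH(1)[OF gl_within_mult(1)] eng.IH(2) eng.prems gl
      by (simp add: B.m_assoc)
  qed
qed

lemma det_on_one: "finite X \<Longrightarrow> X \<subseteq> S \<Longrightarrow> det_on X (matrix_entry (\<one>\<^bsub>BijGroup (free_space S)\<^esub>)) = (1 :: 'f::field)"
proof -
  assume X: "finite X" "X \<subseteq> S"
  have "det_on X (matrix_entry (\<one>\<^bsub>BijGroup (free_space S)\<^esub>)) = det_on {} (matrix_entry (\<one>\<^bsub>BijGroup (free_space S)\<^esub>) :: 'a \<Rightarrow> 'a \<Rightarrow> 'f)"
  proof (rule det_on_extend[OF X(1)])
    fix x y assume "y \<in> X"
    then have "basis_vector y \<in> (free_space S :: ('a \<Rightarrow> 'f) set)"
      by (rule free_space_basis[OF subsetD[OF X(2)]])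
    then show "matrix_entry (\<one>\<^bsub>BijGroup (free_space S)\<^esub>) x y = (if x = y then 1 else 0 :: 'f)"
      by (simp add: matrix_entry_def one_BijGroup basis_vector_def)
  qed simp
  also have "\<dots> = 1" by (simp add: det_on_def sign_id)
  finally show ?thesis .
qed

lemma det_on_tv_group:
  fixes h :: "('a \<Rightarrow> 'f::field) \<Rightarrow> ('a \<Rightarrow> 'f)"
  assumes X: "finite X" "X \<subseteq> S" and h: "h \<in> tv_group S X"
  shows "det_on X (matrix_entry h) = 1"
proof -
  interpret B: group "BijGroup (free_space S :: ('a \<Rightarrow> 'f) set)" by (rule group_BijGroup)
  have "h \<in> carrier (BijGroup (free_space S))"
    using h tv_group_subset[OF X(2)] gl_withinD(1) by (auto simp: carrier_BijGroup)
  then show ?thesis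
    using det_on_tv_group_mult[OF X h one_gl_within] det_on_one[OF X] by simp
qed

section \<open>Gaussian elimination with determinant-one operations\<close>

definition fixes_basis :: "'a set \<Rightarrow> (('a \<Rightarrow> 'f::field) \<Rightarrow> ('a \<Rightarrow> 'f)) \<Rightarrow> bool" where
  "fixes_basis Y T \<longleftrightarrow> (\<forall>y\<in>Y. T (basis_vector y) = basis_vector y)"

lemma fixes_basis_free_space:
  assumes lin: "linear_on_free_space S T" and Y: "Y \<subseteq> S" "fixes_basis Y T" and v: "v \<in> free_space Y"
  shows "T v = v"
  using v
proof (induction v rule: free_space_induct)
  case zero
  then show ?case by (rule free_linear_zero[OF lin])
next
  case (basis y)
  then show ?case using Y by (simp add: fixes_basis_def)
next
  case (add u v)
  then have "u \<in> free_space S" "v \<in> free_space S" using free_space_mono[OF Y(1)] by auto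
  then show ?case using free_linear_add[OF lin] add by simp
next
  case (scale c v)
  then have "v \<in> free_space S" using free_space_mono[OF Y(1)] by auto
  then show ?case using free_linear_scale[OF lin] scale by simp
qed

text \<open>Otherwise the image of the basis vector at \<open>z\<close> lies in the span of
  \<open>Y\<close>, which \<open>T\<close> fixes pointwise. Injectivity then gives that
  \<open>z\<close>-th basis vector itself, which is not in that span.\<close>

lemma gl_within_column_nonzero:
  fixes T :: "('a \<Rightarrow> 'f::field) \<Rightarrow> ('a \<Rightarrow> 'f)"
  assumes X: "X \<subseteq> S" and T: "T \<in> gl_within S X" and Y: "Y \<subseteq> X" "fixes_basis Y T" and z: "z \<in> X - Y"
  shows "\<exists>x\<in>X - Y. T (basis_vector z) x \<noteq> 0"
proof (rule ccontr)
  assume *: "\<not> ?thesis"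
  note T' = gl_withinD[OF T]
  have "z \<in> S" using z X by blast
  then have ez: "basis_vector z \<in> (free_space S :: ('a \<Rightarrow> 'f) set)" by (rule free_space_basis)
  let ?w = "T (basis_vector z)"
  have w: "?w \<in> free_space S" by (rule T'(4)[OF ez])
  have "?w x = 0" if "x \<notin> Y" for x
  proof (cases "x \<in> X")
    case False
    then show ?thesis using acts_withinD(1)[OF T'(3) ez False] z by (auto simp: basis_vector_def)
  qed (use * that in blast)
  then have "?w \<in> free_space Y" using w by (auto simp: free_space_def)
  then have "T ?w = ?w" using fixes_basis_free_space[OF T'(2) _ Y(2)] Y X by blast
  then have "?w = basis_vector z" using inj_onD[OF T'(5) _ w ez] by blast
  then have "?w z = 1" by (simp add: basis_vector_def)
  then show False using * z by auto
qed

lemma tv_mult_column: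
  fixes T :: "('a \<Rightarrow> 'f::field) \<Rightarrow> ('a \<Rightarrow> 'f)"
  assumes X: "X \<subseteq> S" and T: "T \<in> gl_within S X" and x: "x \<in> X" and u: "u \<in> free_space X" "u x = 0" and y: "y \<in> X"
  shows "(tv S x u \<otimes>\<^bsub>BijGroup (free_space S)\<^esub> T) (basis_vector y) =
    (\<lambda>s. T (basis_vector y) s + T (basis_vector y) x * u s)"
proof -
  have ey: "basis_vector y \<in> (free_space S :: ('a \<Rightarrow> 'f) set)"
    using y by (rule free_space_basis[OF subsetD[OF X]])
  show ?thesis
    unfolding gl_within_mult(2)[OF tv_gl_within(1)[OF x X u] T ey]
    using gl_withinD(4)[OF T ey] by (simp add: tv_def)
qed

lemma tv_mult_fixes_basis:
  assumes X: "X \<subseteq> S" and T: "T \<in> gl_within S X" and x: "x \<in> X" and u: "u \<in> free_space X" "u x = 0"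
    and Y: "Y \<subseteq> X" "fixes_basis Y T" "x \<notin> Y"
  shows "fixes_basis Y (tv S x u \<otimes>\<^bsub>BijGroup (free_space S)\<^esub> T)"
  unfolding fixes_basis_def
proof
  fix y assume "y \<in> Y"
  then have y: "y \<in> X" "T (basis_vector y) = basis_vector y" "x \<noteq> y" using Y by (auto simp: fixes_basis_def)
  show "(tv S x u \<otimes>\<^bsub>BijGroup (free_space S)\<^esub> T) (basis_vector y) = basis_vector y"
    unfolding tv_mult_column[OF X T x u y(1)] y(2) using y(3) by (simp add: basis_vector_def)
qed

lemma free_space_scaled_basis: "y \<in> X \<Longrightarrow> (\<lambda>s. c * basis_vector y s) \<in> free_space X"
  by (rule free_space_scale[OF free_space_basis])

lemma ex_tv_group_fixes_basis:
  fixes T :: "('a \<Rightarrow> 'f::field) \<Rightarrow> ('a \<Rightarrow> 'f)"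
  assumes X: "finite X" "X \<subseteq> S" and T: "T \<in> gl_within S X" and Y: "Y \<subseteq> X" "Y \<noteq> X"
  shows "\<exists>h\<in>tv_group S X. fixes_basis Y (h \<otimes>\<^bsub>BijGroup (free_space S)\<^esub> T)"
proof -
  let ?B = "BijGroup (free_space S :: ('a \<Rightarrow> 'f) set)"
  interpret B: group ?B by (rule group_BijGroup)
  have "finite Y" using X Y finite_subset by blast
  then show ?thesis using Y
  proof (induction Y)
    case empty
    have "\<one>\<^bsub>?B\<^esub> \<in> tv_group S X" using subgroup.one_closed[OF subgroup_tv_group[OF X(2)]] .
    then show ?case by (auto simp: fixes_basis_def)
  next
    case (insert z Y)
    have z: "z \<in> X" "z \<notin> Y" and YX: "Y \<subseteq> X" "Y \<noteq> X" using insert by auto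
    obtain x0 where x0: "x0 \<in> X" "x0 \<notin> Y" "x0 \<noteq> z" using insert.prems by blast
    have glc: "U \<in> carrier ?B" if "U \<in> gl_within S X" for U :: "('a \<Rightarrow> 'f) \<Rightarrow> ('a \<Rightarrow> 'f)"
      using gl_withinD(1)[OF that] by (simp add: carrier_BijGroup)
    define reach where "reach U \<longleftrightarrow> U \<in> gl_within S X \<and> (\<exists>h\<in>tv_group S X. U = h \<otimes>\<^bsub>?B\<^esub> T) \<and> fixes_basis Y U" for U
    have step: "reach (tv S x u \<otimes>\<^bsub>?B\<^esub> U)"
      if U: "reach U" and xu: "x \<in> X" "x \<notin> Y" "u \<in> free_space X" "u x = 0" for U x u
    proof -
      obtain h where h: "h \<in> tv_group S X" "U = h \<otimes>\<^bsub>?B\<^esub> T" using U by (auto simp: reach_def)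
      have tvg: "tv S x u \<in> tv_group S X" by (rule tv_in_tv_group[OF xu(1,3,4)])
      then have "tv S x u \<otimes>\<^bsub>?B\<^esub> U = (tv S x u \<otimes>\<^bsub>?B\<^esub> h) \<otimes>\<^bsub>?B\<^esub> T"
        unfolding h(2) using h(1) T tv_group_subset[OF X(2)] glc by (intro B.m_assoc[symmetric]) auto
      moreover have "tv S x u \<otimes>\<^bsub>?B\<^esub> h \<in> tv_group S X"
        using subgroup.m_closed[OF subgroup_tv_group[OF X(2)] tvg h(1)] .
      moreover have "fixes_basis Y (tv S x u \<otimes>\<^bsub>?B\<^esub> U)"
        using U xu by (intro tv_mult_fixes_basis[OF X(2) _ _ _ _ YX(1)]) (auto simp: reach_def)
      moreover have "tv S x u \<otimes>\<^bsub>?B\<^esub> U \<in> gl_within S X"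
        using U gl_within_mult(1)[OF tv_gl_within(1)[OF xu(1) X(2) xu(3,4)]] by (auto simp: reach_def)
      ultimately show ?thesis unfolding reach_def by blast
    qed
    have col: "(tv S x u \<otimes>\<^bsub>?B\<^esub> U) (basis_vector z) = (\<lambda>s. U (basis_vector z) s + U (basis_vector z) x * u s)"
      if U: "reach U" and xu: "x \<in> X" "u \<in> free_space X" "u x = 0" for U x u
      using U z by (intro tv_mult_column[OF X(2) _ xu]) (auto simp: reach_def)
    obtain h where h: "h \<in> tv_group S X" "fixes_basis Y (h \<otimes>\<^bsub>?B\<^esub> T)" using insert.IH YX by blast
    define T1 where "T1 = h \<otimes>\<^bsub>?B\<^esub> T"
    have "T1 \<in> gl_within S X"
      unfolding T1_def using gl_within_mult(1) h(1) T tv_group_subset[OF X(2)] by blast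
    then have T1: "reach T1" using h by (auto simp: reach_def T1_def)
    have "\<exists>T2. reach T2 \<and> (\<exists>x\<in>X - Y - {z}. T2 (basis_vector z) x \<noteq> 0)"
    proof (cases "\<exists>x\<in>X - Y - {z}. T1 (basis_vector z) x \<noteq> 0")
      case True
      then show ?thesis using T1 by blast
    next
      case False
      have "\<exists>x\<in>X - Y. T1 (basis_vector z) x \<noteq> 0"
        using T1 z YX by (intro gl_within_column_nonzero[OF X(2)]) (auto simp: reach_def)
      then have nz: "T1 (basis_vector z) z \<noteq> 0" using False by blast
      \<comment> \<open>Column \<open>z\<close> is nonzero only in row \<open>z\<close> among the
        unfinished rows; adding that row to row \<open>x0\<close> creates a second nonzero
        entry.\<close>
      let ?u = "\<lambda>s. 1 * basis_vector x0 s :: 'f"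
      have u: "?u \<in> free_space X" "?u z = 0"
        by (rule free_space_scaled_basis[OF x0(1)]) (use x0 in \<open>simp add: basis_vector_def\<close>)
      have "T1 (basis_vector z) x0 = 0" using False x0 by blast
      then have "(tv S z ?u \<otimes>\<^bsub>?B\<^esub> T1) (basis_vector z) x0 \<noteq> 0"
        unfolding col[OF T1 z(1) u] using nz by (simp add: basis_vector_def)
      then show ?thesis using step[OF T1 z u] x0 by blast
    qed
    then obtain T2 x where T2: "reach T2" and x: "x \<in> X" "x \<notin> Y" "x \<noteq> z" "T2 (basis_vector z) x \<noteq> 0"
      by blast
    \<comment> \<open>The coefficient solves the equation that adding this multiple of row
      \<open>x\<close> makes the pivot in row \<open>z\<close> equal to 1.\<close>
    let ?u = "\<lambda>s. (1 - T2 (basis_vector z) z) / T2 (basis_vector z) x * basis_vector z s"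
    have u: "?u \<in> free_space X" "?u x = 0"
      by (rule free_space_scaled_basis[OF z(1)]) (use x in \<open>simp add: basis_vector_def\<close>)
    define T3 where "T3 = tv S x ?u \<otimes>\<^bsub>?B\<^esub> T2"
    have T3: "reach T3" unfolding T3_def by (rule step[OF T2 x(1,2) u])
    have one: "T3 (basis_vector z) z = 1"
      unfolding T3_def col[OF T2 x(1) u] using x by (simp add: basis_vector_def)
    \<comment> \<open>With pivot 1, adding this vector times the pivot replaces column
      \<open>z\<close> by the basis vector.\<close>
    let ?w = "\<lambda>s. basis_vector z s - T3 (basis_vector z) s"
    have ez: "basis_vector z \<in> (free_space S :: ('a \<Rightarrow> 'f) set)"
      using z(1) by (rule free_space_basis[OF subsetD[OF X(2)]])
    have T3gl: "T3 \<in> gl_within S X" using T3 by (simp add: reach_def)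
    have "?w \<in> free_space S" by (rule free_space_diff[OF ez gl_withinD(4)[OF T3gl ez]])
    moreover have "?w s = 0" if "s \<notin> X" for s
      using acts_withinD(1)[OF gl_withinD(3)[OF T3gl] ez that] by simp
    ultimately have w: "?w \<in> free_space X" "?w z = 0"
      by (rule free_space_shrink) (simp_all add: one basis_vector_same)
    have T4: "reach (tv S z ?w \<otimes>\<^bsub>?B\<^esub> T3)" by (rule step[OF T3 z w])
    moreover have "(tv S z ?w \<otimes>\<^bsub>?B\<^esub> T3) (basis_vector z) = basis_vector z"
      unfolding col[OF T3 z(1) w] one by simp
    ultimately show ?case by (auto simp: reach_def fixes_basis_def)
  qed
qed

lemma gl_within_eq_one:
  assumes X: "X \<subseteq> S" and T: "T \<in> gl_within S X" and f: "fixes_basis X T"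
  shows "T = \<one>\<^bsub>BijGroup (free_space S)\<^esub>"
proof (rule extensionalityI[of _ "free_space S"])
  note T' = gl_withinD[OF T]
  show "T \<in> extensional (free_space S)" by (rule T'(6))
  show "\<one>\<^bsub>BijGroup (free_space S)\<^esub> \<in> extensional (free_space S)" by (simp add: one_BijGroup)
  have "fixes_basis S T"
    unfolding fixes_basis_def
  proof
    fix y assume y: "y \<in> S"
    show "T (basis_vector y) = basis_vector y"
    proof (cases "y \<in> X")
      case False
      then show ?thesis
        by (intro acts_withinD(2)[OF T'(3) free_space_basis[OF y]]) (auto simp: basis_vector_def)
    qed (use f in \<open>simp add: fixes_basis_def\<close>)
  qed
  then show "T v = (\<one>\<^bsub>BijGroup (free_space S)\<^esub>) v" if "v \<in> free_space S" for v
    using fixes_basis_free_space[OF T'(2) order_refl _ that] that by (simp add: one_BijGroup)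
qed

text \<open>Elimination reaches all columns but one, and clearing the last leaves a diagonal matrix
  with a single entry possibly different from 1. The operations preserve the determinant, so that
  entry is the determinant of \<open>T\<close>, namely 1.\<close>

lemma mem_tv_group_if_det_one:
  fixes T :: "('a \<Rightarrow> 'f::field) \<Rightarrow> ('a \<Rightarrow> 'f)"
  assumes X: "finite X" "X \<subseteq> S" and T: "T \<in> gl_within S X" and det: "det_on X (matrix_entry T) = 1"
  shows "T \<in> tv_group S X"
proof (cases "X = {}")
  case True
  then have "T = \<one>\<^bsub>BijGroup (free_space S)\<^esub>"
    using gl_within_eq_one[OF X(2) T] by (simp add: fixes_basis_def)
  then show ?thesis using subgroup.one_closed[OF subgroup_tv_group[OF X(2)]] by simp
next
  case False
  then obtain z where z: "z \<in> X" by blast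
  let ?B = "BijGroup (free_space S :: ('a \<Rightarrow> 'f) set)"
  interpret B: group ?B by (rule group_BijGroup)
  have glc: "U \<in> carrier ?B" if "U \<in> gl_within S X" for U :: "('a \<Rightarrow> 'f) \<Rightarrow> ('a \<Rightarrow> 'f)"
    using gl_withinD(1)[OF that] by (simp add: carrier_BijGroup)
  have Y: "X - {z} \<subseteq> X" "X - {z} \<noteq> X" using z by auto
  obtain h where h: "h \<in> tv_group S X" "fixes_basis (X - {z}) (h \<otimes>\<^bsub>?B\<^esub> T)"
    using ex_tv_group_fixes_basis[OF X T Y] by blast
  have hgl: "h \<in> gl_within S X" using h tv_group_subset[OF X(2)] by blast
  define T1 where "T1 = h \<otimes>\<^bsub>?B\<^esub> T"
  have T1: "T1 \<in> gl_within S X" unfolding T1_def by (rule gl_within_mult(1)[OF hgl T])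
  have f1: "fixes_basis (X - {z}) T1" using h by (simp add: T1_def)
  define w where "w = T1 (basis_vector z)"
  have ez: "basis_vector z \<in> (free_space S :: ('a \<Rightarrow> 'f) set)"
    using z by (rule free_space_basis[OF subsetD[OF X(2)]])
  have nz: "w z \<noteq> 0"
    using gl_within_column_nonzero[OF X(2) T1 Y(1) f1] z unfolding w_def by blast
  \<comment> \<open>Chosen so that \<open>w + w z * u\<close> is the multiple \<open>w z\<close> of
    the basis vector at \<open>z\<close>.\<close>
  define u where "u = (\<lambda>s. basis_vector z s - inverse (w z) * w s)"
  have wS: "w \<in> free_space S" unfolding w_def by (rule gl_withinD(4)[OF T1 ez])
  have "u \<in> free_space S" unfolding u_def by (rule free_space_diff[OF ez free_space_scale[OF wS]])
  moreover have "u s = 0" if "s \<notin> X" for s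
    using acts_withinD(1)[OF gl_withinD(3)[OF T1] ez that] z that by (auto simp: u_def w_def basis_vector_def)
  ultimately have u: "u \<in> free_space X" "u z = 0"
    by (rule free_space_shrink) (simp_all add: nz u_def basis_vector_same)
  define T2 where "T2 = tv S z u \<otimes>\<^bsub>?B\<^esub> T1"
  have tvgl: "tv S z u \<in> gl_within S X" by (rule tv_gl_within(1)[OF z X(2) u])
  have T2: "T2 \<in> gl_within S X" unfolding T2_def by (rule gl_within_mult(1)[OF tvgl T1])
  have f2: "fixes_basis (X - {z}) T2"
    unfolding T2_def by (rule tv_mult_fixes_basis[OF X(2) T1 z u Y(1) f1]) simp
  have T2z: "T2 (basis_vector z) = (\<lambda>s. w z * basis_vector z s)"
    unfolding T2_def tv_mult_column[OF X(2) T1 z u z] w_def[symmetric] using nz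
    by (simp add: u_def algebra_simps)
  have "1 = det_on X (matrix_entry T)" using det by simp
  also have "\<dots> = det_on X (matrix_entry T1)"
    unfolding T1_def by (rule det_on_tv_group_mult[OF X h(1) T, symmetric])
  also have "\<dots> = det_on X (matrix_entry T2)"
    unfolding T2_def by (rule det_on_tv_mult[OF X z u T1, symmetric])
  also have "\<dots> = det_on {z} (matrix_entry T2)"
  proof (rule det_on_extend[OF X(1)])
    fix x y assume xy: "x \<in> X" "y \<in> X" "x \<notin> {z} \<or> y \<notin> {z}"
    show "matrix_entry T2 x y = (if x = y then 1 else 0)"
    proof (cases "y = z")
      case True
      then show ?thesis using xy T2z by (simp add: matrix_entry_def basis_vector_def)
    next
      case False
      then show ?thesis using f2 xy by (simp add: matrix_entry_def fixes_basis_def basis_vector_def)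
    qed
  qed (use z in simp)
  also have "\<dots> = w z" using T2z by (simp add: det_on_singleton matrix_entry_def basis_vector_def)
  finally have "T2 (basis_vector z) = basis_vector z" using T2z by simp
  then have "fixes_basis X T2" using f2 by (auto simp: fixes_basis_def)
  then have "T2 = \<one>\<^bsub>?B\<^esub>" by (rule gl_within_eq_one[OF X(2) T2])
  moreover have "T2 = (tv S z u \<otimes>\<^bsub>?B\<^esub> h) \<otimes>\<^bsub>?B\<^esub> T"
    unfolding T2_def T1_def using glc tvgl hgl T by (simp add: B.m_assoc)
  ultimately have "inv\<^bsub>?B\<^esub> T = tv S z u \<otimes>\<^bsub>?B\<^esub> h"
    using glc tvgl hgl T by (intro B.inv_equality) auto
  moreover have "tv S z u \<otimes>\<^bsub>?B\<^esub> h \<in> tv_group S X"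
    using subgroup.m_closed[OF subgroup_tv_group[OF X(2)] tv_in_tv_group[OF z u] h(1)] .
  ultimately have "inv\<^bsub>?B\<^esub> (inv\<^bsub>?B\<^esub> T) \<in> tv_group S X"
    using subgroup.m_inv_closed[OF subgroup_tv_group[OF X(2)]] by metis
  then show ?thesis using glc[OF T] by simp
qed

section \<open>The finitary special linear group as a union of transvection groups\<close>

text \<open>Generation by transvections replaces the determinant from here on. In particular closure
  under products and inverses follows without multiplicativity of the determinant, whose defining
  block varies with the operator.\<close>

lemma mem_sl_fin: "T \<in> carrier (sl_fin S) \<longleftrightarrow> (\<exists>X. finite X \<and> X \<subseteq> S \<and> T \<in> tv_group S X)"
proof
  let ?X0 = "fst ` nontrivial_entries S T \<union> snd ` nontrivial_entries S T"
  have "nontrivial_entries S T \<subseteq> S \<times> S" by (auto simp: nontrivial_entries_def)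
  then have X0: "?X0 \<subseteq> S" by auto
  have ne0: "x \<in> ?X0 \<and> y \<in> ?X0" if "(x, y) \<in> nontrivial_entries S T" for x y
    using imageI[OF that, of fst] imageI[OF that, of snd] by simp
  {
    assume "T \<in> carrier (sl_fin S)"
    then have T: "T \<in> Bij (free_space S)" "linear_on_free_space S T" "finite (nontrivial_entries S T)" "fin_det S T = 1"
      by (auto simp: sl_fin_def)
    have "T ` free_space S \<subseteq> free_space S" using T(1) by (auto simp: Bij_def bij_betw_def)
    then have "acts_within S ?X0 T"
      using acts_within_iff_nontrivial_entries[OF T(2) _ X0] ne0 by (simp add: subrelI)
    then have "T \<in> gl_within S ?X0" using T by (simp add: gl_within_def)
    then have "T \<in> tv_group S ?X0"
      using T X0 by (intro mem_tv_group_if_det_one) (auto simp: fin_det_def)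
    then show "\<exists>X. finite X \<and> X \<subseteq> S \<and> T \<in> tv_group S X" using X0 T(3) by (intro exI[of _ ?X0]) auto
  }
  assume "\<exists>X. finite X \<and> X \<subseteq> S \<and> T \<in> tv_group S X"
  then obtain X where X: "finite X" "X \<subseteq> S" "T \<in> tv_group S X" by blast
  then have T: "T \<in> gl_within S X" using tv_group_subset by blast
  note T' = gl_withinD[OF T]
  have ne: "nontrivial_entries S T \<subseteq> X \<times> X"
    using acts_within_iff_nontrivial_entries[OF T'(2) _ X(2)] T'(3,4) by blast
  then have fin: "finite (nontrivial_entries S T)" using X finite_subset by blast
  have "?X0 \<subseteq> X" using ne by auto
  then have "det_on X (matrix_entry T) = fin_det S T"
    unfolding fin_det_def
  proof (rule det_on_extend[OF X(1)])
    fix x y assume xy: "x \<in> X" "y \<in> X" "x \<notin> ?X0 \<or> y \<notin> ?X0"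
    then have "(x, y) \<notin> nontrivial_entries S T" using ne0 by blast
    then show "matrix_entry T x y = (if x = y then 1 else 0)"
      using xy X(2) by (auto simp: nontrivial_entries_def)
  qed
  then show "T \<in> carrier (sl_fin S)"
    using det_on_tv_group[OF X] T'(1,2) fin by (simp add: sl_fin_def)
qed

lemma subgroup_sl_fin:
  "subgroup (carrier (sl_fin S)) (BijGroup (free_space S :: ('a \<Rightarrow> 'f::field) set))"
proof -
  interpret B: group "BijGroup (free_space S :: ('a \<Rightarrow> 'f) set)" by (rule group_BijGroup)
  show ?thesis
  proof (rule B.subgroupI)
    show "carrier (sl_fin S) \<subseteq> carrier (BijGroup (free_space S))"
      by (auto simp: sl_fin_def carrier_BijGroup)
    have "\<one>\<^bsub>BijGroup (free_space S)\<^esub> \<in> (tv_group S {} :: (('a \<Rightarrow> 'f) \<Rightarrow> ('a \<Rightarrow> 'f)) set)" using subgroup.one_closed[OF subgroup_tv_group] by blast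
    then have "\<one>\<^bsub>BijGroup (free_space S)\<^esub> \<in> carrier (sl_fin S :: (('a \<Rightarrow> 'f) \<Rightarrow> ('a \<Rightarrow> 'f)) monoid)"
      unfolding mem_sl_fin by (intro exI[of _ "{}"]) simp
    then show "carrier (sl_fin S :: (('a \<Rightarrow> 'f) \<Rightarrow> ('a \<Rightarrow> 'f)) monoid) \<noteq> {}" by (metis empty_iff)
  next
    fix T :: "('a \<Rightarrow> 'f) \<Rightarrow> ('a \<Rightarrow> 'f)" assume "T \<in> carrier (sl_fin S)"
    then obtain X where X: "finite X" "X \<subseteq> S" "T \<in> tv_group S X" unfolding mem_sl_fin by blast
    then show "inv\<^bsub>BijGroup (free_space S)\<^esub> T \<in> carrier (sl_fin S)"
      unfolding mem_sl_fin using subgroup.m_inv_closed[OF subgroup_tv_group[OF X(2)] X(3)] by (intro exI[of _ X]) simp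
  next
    fix T U :: "('a \<Rightarrow> 'f) \<Rightarrow> ('a \<Rightarrow> 'f)" assume "T \<in> carrier (sl_fin S)" "U \<in> carrier (sl_fin S)"
    then obtain X Y where XY: "finite X" "X \<subseteq> S" "T \<in> tv_group S X" "finite Y" "Y \<subseteq> S" "U \<in> tv_group S Y"
      unfolding mem_sl_fin by blast
    have "T \<in> tv_group S (X \<union> Y)" "U \<in> tv_group S (X \<union> Y)"
      using XY tv_group_mono[of X "X \<union> Y" S] tv_group_mono[of Y "X \<union> Y" S] by auto
    then have "T \<otimes>\<^bsub>BijGroup (free_space S)\<^esub> U \<in> tv_group S (X \<union> Y)"
      using subgroup.m_closed[OF subgroup_tv_group[of "X \<union> Y" S]] XY by auto
    then show "T \<otimes>\<^bsub>BijGroup (free_space S)\<^esub> U \<in> carrier (sl_fin S)"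
      unfolding mem_sl_fin using XY by (intro exI[of _ "X \<union> Y"]) auto
  qed
qed

lemma group_sl_fin: "group (sl_fin S)"
  using subgroup.subgroup_is_group[OF subgroup_sl_fin group_BijGroup]
  by (simp add: sl_fin_def)

lemma mult_sl_fin: "T \<otimes>\<^bsub>sl_fin S\<^esub> U = T \<otimes>\<^bsub>BijGroup (free_space S)\<^esub> U"
  by (simp add: sl_fin_def)

lemma one_sl_fin: "\<one>\<^bsub>sl_fin S\<^esub> = \<one>\<^bsub>BijGroup (free_space S)\<^esub>"
  by (simp add: sl_fin_def)

lemma inv_sl_fin:
  assumes "T \<in> carrier (sl_fin S)"
  shows "inv\<^bsub>sl_fin S\<^esub> T = inv\<^bsub>BijGroup (free_space S)\<^esub> T"
proof -
  have eq: "sl_fin S = (BijGroup (free_space S))\<lparr>carrier := carrier (sl_fin S)\<rparr>"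
    by (simp add: sl_fin_def)
  show ?thesis
    using group.m_inv_consistent[OF group_BijGroup subgroup_sl_fin assms] eq by metis
qed

section \<open>The elementary enrichment\<close>

definition sl_supported :: "'a set \<Rightarrow> 'a set \<Rightarrow> (('a \<Rightarrow> 'f::field) \<Rightarrow> ('a \<Rightarrow> 'f)) set" where
  "sl_supported S X = {T \<in> carrier (sl_fin S). acts_within S X T}"

text \<open>Composition with the inverse makes it send the basis vector at \<open>y\<close> to the
  one at \<open>p y\<close>, so that products of permutations go to products.\<close>

definition perm_op :: "'a set \<Rightarrow> ('a \<Rightarrow> 'a) \<Rightarrow> ('a \<Rightarrow> 'f::field) \<Rightarrow> ('a \<Rightarrow> 'f)" where
  "perm_op S p = (\<lambda>v\<in>free_space S. v \<circ> inv_into UNIV p)"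

lemma sl_finD:
  assumes "T \<in> carrier (sl_fin S)"
  shows "T \<in> Bij (free_space S)" "linear_on_free_space S T" "v \<in> free_space S \<Longrightarrow> T v \<in> free_space S"
    "T \<in> extensional (free_space S)"
  using assms by (auto simp: sl_fin_def Bij_def bij_betw_def)

lemma sl_supported_gl_within: "T \<in> sl_supported S X \<Longrightarrow> T \<in> gl_within S X"
  using sl_finD by (auto simp: sl_supported_def gl_within_def)

lemma sl_supportedI: "T \<in> carrier (sl_fin S) \<Longrightarrow> T \<in> gl_within S X \<Longrightarrow> T \<in> sl_supported S X"
  by (simp add: sl_supported_def gl_within_def)

lemma sl_mult_apply:
  assumes "T \<in> carrier (sl_fin S)" "U \<in> carrier (sl_fin S)" "v \<in> free_space S"
  shows "(T \<otimes>\<^bsub>sl_fin S\<^esub> U) v = T (U v)"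
  using assms sl_finD(1)[OF assms(1)] sl_finD(1)[OF assms(2)]
  by (simp add: mult_sl_fin mult_BijGroup compose_def)

lemma sl_fin_eqI:
  assumes "T \<in> carrier (sl_fin S)" "U \<in> carrier (sl_fin S)" "\<And>v. v \<in> free_space S \<Longrightarrow> T v = U v"
  shows "T = U"
  using sl_finD(4)[OF assms(1)] sl_finD(4)[OF assms(2)] assms(3) by (rule extensionalityI)

lemma tv_group_sl_fin: "finite X \<Longrightarrow> X \<subseteq> S \<Longrightarrow> T \<in> tv_group S X \<Longrightarrow> T \<in> carrier (sl_fin S)"
  unfolding mem_sl_fin by blast

lemma alt_comp_free_space:
  assumes p: "p \<in> carrier (alt_fin S)" and v: "v \<in> free_space S"
  shows "v \<circ> p \<in> free_space S"
proof -
  have "{x. (v \<circ> p) x \<noteq> 0} = p -` {x. v x \<noteq> 0}" by auto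
  moreover have "finite (p -` {x. v x \<noteq> 0})"
    using v alt_fin_bij[OF p] by (intro finite_vimageI) (auto simp: free_space_def bij_is_inj)
  moreover have "x \<in> S" if "v (p x) \<noteq> 0" for x
    using that v p free_space_outside[OF v, of "p x"] by (auto simp: mem_alt_fin permutes_in_image)
  ultimately show ?thesis by (auto simp: free_space_def)
qed

lemma inv_inv_alt:
  assumes "p \<in> carrier (alt_fin S)"
  shows "inv_into UNIV (inv_into UNIV p) = p"
  using alt_fin_bij[OF assms] by (rule inv_inv_eq)

lemma perm_op_apply:
  assumes "v \<in> free_space S"
  shows "perm_op S p v = v \<circ> inv_into UNIV p"
  using assms by (simp add: perm_op_def)

lemma perm_op_gl_within:
  assumes p: "p \<in> carrier (alt_fin S)"
  shows "(perm_op S p :: ('a \<Rightarrow> 'f::field) \<Rightarrow> ('a \<Rightarrow> 'f)) \<in> gl_within S {x. p x \<noteq> x}"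
  unfolding gl_within_def
proof (intro CollectI conjI)
  let ?V = "free_space S :: ('a \<Rightarrow> 'f) set"
  let ?q = "inv_into UNIV p"
  have q: "?q \<in> carrier (alt_fin S)" by (rule alt_fin_inv[OF p])
  note pq = alt_fin_inv_apply[OF p]
  have "bij_betw (perm_op S p) ?V ?V"
  proof (rule bij_betwI[where g = "perm_op S ?q"])
    show "perm_op S p \<in> ?V \<rightarrow> ?V" using alt_comp_free_space[OF q] by (auto simp: perm_op_apply)
    show "perm_op S ?q \<in> ?V \<rightarrow> ?V"
      using alt_comp_free_space[OF p] by (auto simp: perm_op_apply inv_inv_alt[OF p])
    show "perm_op S ?q (perm_op S p v) = v" if "v \<in> ?V" for v
      using that alt_comp_free_space[OF q that] pq by (simp add: perm_op_apply inv_inv_alt[OF p] fun_eq_iff)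
    show "perm_op S p (perm_op S ?q v) = v" if "v \<in> ?V" for v
      using that alt_comp_free_space[OF p that] pq by (simp add: perm_op_apply inv_inv_alt[OF p] fun_eq_iff)
  qed
  then show "perm_op S p \<in> Bij ?V" by (simp add: Bij_def perm_op_def)
  show "linear_on_free_space S (perm_op S p :: ('a \<Rightarrow> 'f) \<Rightarrow> ('a \<Rightarrow> 'f))"
    unfolding linear_on_free_space_def
    by (auto simp: perm_op_apply free_space_add free_space_scale fun_eq_iff)
  have fixq: "?q x = x" if "p x = x" for x using pq(1)[of x] that by simp
  have fixp: "p x = x" if "?q x = x" for x using pq(2)[of x] that by simp
  show "acts_within S {x. p x \<noteq> x} (perm_op S p :: ('a \<Rightarrow> 'f) \<Rightarrow> ('a \<Rightarrow> 'f))"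
    unfolding acts_within_def
  proof (intro ballI conjI allI impI)
    fix v assume v: "v \<in> ?V"
    show "perm_op S p v x = v x" if "x \<notin> {x. p x \<noteq> x}" for x
      using v that fixq by (simp add: perm_op_apply)
    show "perm_op S p v = v" if v0: "\<forall>x\<in>{x. p x \<noteq> x}. v x = 0"
    proof
      fix x
      show "perm_op S p v x = v x"
      proof (cases "p x = x")
        case False
        then have "p (?q x) \<noteq> ?q x" using fixq pq(2) by metis
        then show ?thesis using v0 v False by (simp add: perm_op_apply)
      qed (use v fixq in \<open>simp add: perm_op_apply\<close>)
    qed
  qed
qed

text \<open>The determinant of a permutation matrix is the sign, so evenness places the operator in
  the group over every field.\<close>

lemma perm_op_sl_fin:
  assumes p: "p \<in> carrier (alt_fin S)"
  shows "(perm_op S p :: ('a \<Rightarrow> 'f::field) \<Rightarrow> ('a \<Rightarrow> 'f)) \<in> carrier (sl_fin S)"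
proof -
  let ?X = "{x. p x \<noteq> x}"
  have X: "finite ?X" "?X \<subseteq> S" "p permutes ?X"
    using p by (auto simp: mem_alt_fin permutes_def)
  have "det_on ?X (matrix_entry (perm_op S p :: ('a \<Rightarrow> 'f) \<Rightarrow> ('a \<Rightarrow> 'f))) = det_on ?X (\<lambda>x y. if x = p y then 1 else 0)"
  proof (rule det_on_cong)
    fix x y assume "y \<in> ?X"
    then have y: "basis_vector y \<in> (free_space S :: ('a \<Rightarrow> 'f) set)" using X(2) by (intro free_space_basis) auto
    have "inv_into UNIV p x = y \<longleftrightarrow> x = p y" using alt_fin_inv_apply[OF p] by metis
    then show "matrix_entry (perm_op S p :: ('a \<Rightarrow> 'f) \<Rightarrow> ('a \<Rightarrow> 'f)) x y = (if x = p y then 1 else 0)"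
      unfolding matrix_entry_def perm_op_apply[OF y] by (simp add: basis_vector_def)
  qed
  also have "\<dots> = of_int (sign p)" by (rule det_on_permutation_matrix[OF X(1,3)])
  also have "sign p = 1" using p by (simp add: mem_alt_fin sign_def)
  finally have "det_on ?X (matrix_entry (perm_op S p :: ('a \<Rightarrow> 'f) \<Rightarrow> ('a \<Rightarrow> 'f))) = 1" by simp
  from mem_tv_group_if_det_one[OF X(1,2) perm_op_gl_within[OF p] this]
  show ?thesis by (rule tv_group_sl_fin[OF X(1,2)])
qed

lemma perm_op_comp:
  assumes p: "p \<in> carrier (alt_fin S)" and q: "q \<in> carrier (alt_fin S)"
  shows "(perm_op S (p \<circ> q) :: ('a \<Rightarrow> 'f::field) \<Rightarrow> ('a \<Rightarrow> 'f)) = perm_op S p \<otimes>\<^bsub>sl_fin S\<^esub> perm_op S q"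
proof (rule sl_fin_eqI)
  interpret SL: group "sl_fin S :: (('a \<Rightarrow> 'f) \<Rightarrow> ('a \<Rightarrow> 'f)) monoid" by (rule group_sl_fin)
  show "(perm_op S (p \<circ> q) :: ('a \<Rightarrow> 'f::field) \<Rightarrow> ('a \<Rightarrow> 'f)) \<in> carrier (sl_fin S)"
    by (rule perm_op_sl_fin[OF alt_fin_comp[OF p q]])
  show "perm_op S p \<otimes>\<^bsub>sl_fin S\<^esub> (perm_op S q :: ('a \<Rightarrow> 'f::field) \<Rightarrow> ('a \<Rightarrow> 'f)) \<in> carrier (sl_fin S)"
    by (rule SL.m_closed[OF perm_op_sl_fin[OF p] perm_op_sl_fin[OF q]])
  fix v :: "'a \<Rightarrow> 'f" assume v: "v \<in> free_space S"
  have "inv_into UNIV (p \<circ> q) = inv_into UNIV q \<circ> inv_into UNIV p"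
    by (rule o_inv_distrib[OF alt_fin_bij[OF p] alt_fin_bij[OF q]])
  then show "perm_op S (p \<circ> q) v = (perm_op S p \<otimes>\<^bsub>sl_fin S\<^esub> perm_op S q) v"
    unfolding sl_mult_apply[OF perm_op_sl_fin[OF p] perm_op_sl_fin[OF q] v]
    using v alt_comp_free_space[OF alt_fin_inv[OF q] v] by (simp add: perm_op_apply comp_assoc)
qed

lemma inv_perm_op:
  assumes p: "p \<in> carrier (alt_fin S)"
  shows "inv\<^bsub>sl_fin S\<^esub> (perm_op S p :: ('a \<Rightarrow> 'f::field) \<Rightarrow> ('a \<Rightarrow> 'f)) = perm_op S (inv_into UNIV p)"
proof -
  interpret SL: group "sl_fin S :: (('a \<Rightarrow> 'f) \<Rightarrow> ('a \<Rightarrow> 'f)) monoid" by (rule group_sl_fin)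
  have "perm_op S (inv_into UNIV p) \<otimes>\<^bsub>sl_fin S\<^esub> (perm_op S p :: ('a \<Rightarrow> 'f) \<Rightarrow> ('a \<Rightarrow> 'f)) = perm_op S (inv_into UNIV p \<circ> p)"
    by (rule perm_op_comp[OF alt_fin_inv[OF p] p, symmetric])
  also have "inv_into UNIV p \<circ> p = id" using alt_fin_inv_apply[OF p] by auto
  also have "perm_op S id = \<one>\<^bsub>sl_fin S\<^esub>"
    by (auto simp: perm_op_def one_sl_fin one_BijGroup fun_eq_iff inv_id)
  finally show ?thesis
    by (rule SL.inv_equality[OF _ perm_op_sl_fin[OF p] perm_op_sl_fin[OF alt_fin_inv[OF p]]])
qed

lemma perm_op_conj_apply:
  assumes p: "p \<in> carrier (alt_fin S)" and n: "n \<in> carrier (sl_fin S)" and v: "v \<in> free_space S"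
  shows "(perm_op S p \<otimes>\<^bsub>sl_fin S\<^esub> n \<otimes>\<^bsub>sl_fin S\<^esub> inv\<^bsub>sl_fin S\<^esub> perm_op S p) v = n (v \<circ> p) \<circ> inv_into UNIV p"
proof -
  interpret SL: group "sl_fin S :: (('a \<Rightarrow> 'b) \<Rightarrow> ('a \<Rightarrow> 'b)) monoid" by (rule group_sl_fin)
  have q: "perm_op S (inv_into UNIV p) v = v \<circ> p" using v by (simp add: perm_op_apply inv_inv_alt[OF p])
  note vp = alt_comp_free_space[OF p v]
  show ?thesis
    unfolding inv_perm_op[OF p]
      sl_mult_apply[OF SL.m_closed[OF perm_op_sl_fin[OF p] n] perm_op_sl_fin[OF alt_fin_inv[OF p]] v]
      q sl_mult_apply[OF perm_op_sl_fin[OF p] n vp]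
    by (rule perm_op_apply[OF sl_finD(3)[OF n vp]])
qed

text \<open>\<open>U\<close> leaves the coordinates in \<open>X\<close> unchanged, so
  \<open>T\<close> displaces \<open>U v\<close> exactly as it displaces \<open>v\<close>, and the
  same holds with the roles exchanged. Both products therefore equal \<open>v\<close> plus the two
  displacements.\<close>

lemma gl_within_commute:
  assumes T: "T \<in> gl_within S X" and U: "U \<in> gl_within S Y" and disj: "X \<inter> Y = {}" and v: "v \<in> free_space S"
  shows "T (U v) = U (T v)"
proof
  fix x
  note T' = gl_withinD[OF T] and U' = gl_withinD[OF U]
  have "T (U v) x - U v x = T v x - v x"
    by (rule acts_within_diff[OF T'(2,3) U'(4)[OF v] v]) (use acts_withinD(1)[OF U'(3) v] disj in blast)
  moreover have "U (T v) x - T v x = U v x - v x"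
    by (rule acts_within_diff[OF U'(2,3) T'(4)[OF v] v]) (use acts_withinD(1)[OF T'(3) v] disj in blast)
  ultimately have "v x + T (U v) x = v x + U (T v) x" by (simp add: algebra_simps)
  then show "T (U v) x = U (T v) x" by simp
qed

lemma sl_supported_commute:
  assumes T: "T \<in> sl_supported S X" and U: "U \<in> sl_supported S Y" and disj: "X \<inter> Y = {}"
  shows "T \<otimes>\<^bsub>sl_fin S\<^esub> U = U \<otimes>\<^bsub>sl_fin S\<^esub> T"
proof -
  interpret SL: group "sl_fin S :: (('a \<Rightarrow> 'b) \<Rightarrow> ('a \<Rightarrow> 'b)) monoid" by (rule group_sl_fin)
  have TU: "T \<in> carrier (sl_fin S)" "U \<in> carrier (sl_fin S)" using T U by (auto simp: sl_supported_def)
  show ?thesis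
  proof (rule sl_fin_eqI)
    show "(T \<otimes>\<^bsub>sl_fin S\<^esub> U) v = (U \<otimes>\<^bsub>sl_fin S\<^esub> T) v" if v: "v \<in> free_space S" for v
      unfolding sl_mult_apply[OF TU v] sl_mult_apply[OF TU(2,1) v]
      by (rule gl_within_commute[OF sl_supported_gl_within[OF T] sl_supported_gl_within[OF U] disj v])
  qed (use TU in auto)
qed

lemma perm_op_supported:
  assumes "p \<in> carrier (alt_fin S)"
  shows "perm_op S p \<in> sl_supported S {x. p x \<noteq> x}"
  by (rule sl_supportedI[OF perm_op_sl_fin[OF assms] perm_op_gl_within[OF assms]])

lemma sl_supported_conj_image:
  assumes p: "p \<in> carrier (alt_fin S)" and n: "n \<in> sl_supported S X"
  shows "perm_op S p \<otimes>\<^bsub>sl_fin S\<^esub> n \<otimes>\<^bsub>sl_fin S\<^esub> inv\<^bsub>sl_fin S\<^esub> perm_op S p \<in> sl_supported S (p ` X)"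
proof -
  interpret SL: group "sl_fin S :: (('a \<Rightarrow> 'b) \<Rightarrow> ('a \<Rightarrow> 'b)) monoid" by (rule group_sl_fin)
  have nc: "n \<in> carrier (sl_fin S)" and naw: "acts_within S X n" using n by (auto simp: sl_supported_def)
  note pq = alt_fin_inv_apply[OF p]
  have "acts_within S (p ` X) (perm_op S p \<otimes>\<^bsub>sl_fin S\<^esub> n \<otimes>\<^bsub>sl_fin S\<^esub> inv\<^bsub>sl_fin S\<^esub> perm_op S p)"
    unfolding acts_within_def
  proof (intro ballI conjI allI impI)
    fix v :: "'a \<Rightarrow> 'b" assume v: "v \<in> free_space S"
    note vp = alt_comp_free_space[OF p v]
    show "(perm_op S p \<otimes>\<^bsub>sl_fin S\<^esub> n \<otimes>\<^bsub>sl_fin S\<^esub> inv\<^bsub>sl_fin S\<^esub> perm_op S p) v x = v x" if x: "x \<notin> p ` X" for x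
    proof -
      have "inv_into UNIV p x \<notin> X" using x pq(2)[of x] by (metis imageI)
      then show ?thesis
        unfolding perm_op_conj_apply[OF p nc v] using acts_withinD(1)[OF naw vp] pq(2) by simp
    qed
    show "(perm_op S p \<otimes>\<^bsub>sl_fin S\<^esub> n \<otimes>\<^bsub>sl_fin S\<^esub> inv\<^bsub>sl_fin S\<^esub> perm_op S p) v = v" if v0: "\<forall>x\<in>p ` X. v x = 0"
    proof -
      have "n (v \<circ> p) = v \<circ> p" using v0 by (intro acts_withinD(2)[OF naw vp]) auto
      then show ?thesis unfolding perm_op_conj_apply[OF p nc v] using pq(2) by (simp add: fun_eq_iff)
    qed
  qed
  moreover have "perm_op S p \<in> carrier (sl_fin S :: (('a \<Rightarrow> 'b) \<Rightarrow> ('a \<Rightarrow> 'b)) monoid)" by (rule perm_op_sl_fin[OF p])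
  ultimately show ?thesis using nc by (simp add: sl_supported_def)
qed

lemma supported_group_sl_fin:
  assumes "infinite S"
  shows "supported_group (sl_fin S :: (('a \<Rightarrow> 'f::field) \<Rightarrow> ('a \<Rightarrow> 'f)) monoid) S (sl_supported S) (perm_op S)"
proof -
  let ?SL = "sl_fin S :: (('a \<Rightarrow> 'f) \<Rightarrow> ('a \<Rightarrow> 'f)) monoid"
  interpret SL: group ?SL by (rule group_sl_fin)
  show ?thesis
  proof (intro supported_group.intro supported_group_axioms.intro)
    show "group ?SL" by (rule group_sl_fin)
    show "infinite S" by fact
    show "sl_supported S X \<subseteq> (sl_supported S Y :: (('a \<Rightarrow> 'f) \<Rightarrow> ('a \<Rightarrow> 'f)) set)" if "X \<subseteq> Y" for X Y
      using acts_within_mono[OF _ that] by (auto simp: sl_supported_def)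
    show "perm_op S \<in> hom (alt_fin S) ?SL"
      by (rule homI) (simp_all add: perm_op_sl_fin mult_alt_fin perm_op_comp)
  next
    fix X :: "'a set"
    show "subgroup (sl_supported S X) ?SL"
    proof (rule SL.subgroupI)
      show "sl_supported S X \<subseteq> carrier ?SL" by (auto simp: sl_supported_def)
      have "\<one>\<^bsub>?SL\<^esub> \<in> sl_supported S X"
        using SL.one_closed one_gl_within[of S X] by (intro sl_supportedI) (auto simp: one_sl_fin)
      then show "sl_supported S X \<noteq> ({} :: (('a \<Rightarrow> 'f) \<Rightarrow> ('a \<Rightarrow> 'f)) set)" by (metis empty_iff)
    next
      fix T :: "('a \<Rightarrow> 'f) \<Rightarrow> ('a \<Rightarrow> 'f)" assume T: "T \<in> sl_supported S X"
      then have Tc: "T \<in> carrier ?SL" by (simp add: sl_supported_def)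
      show "inv\<^bsub>?SL\<^esub> T \<in> sl_supported S X"
        using gl_within_inv[OF sl_supported_gl_within[OF T]] SL.inv_closed[OF Tc]
        by (intro sl_supportedI) (simp_all add: inv_sl_fin[OF Tc])
    next
      fix T U :: "('a \<Rightarrow> 'f) \<Rightarrow> ('a \<Rightarrow> 'f)" assume TU: "T \<in> sl_supported S X" "U \<in> sl_supported S X"
      then have c: "T \<in> carrier ?SL" "U \<in> carrier ?SL" by (auto simp: sl_supported_def)
      show "T \<otimes>\<^bsub>?SL\<^esub> U \<in> sl_supported S X"
      proof (rule sl_supportedI[OF SL.m_closed[OF c]])
        show "T \<otimes>\<^bsub>?SL\<^esub> U \<in> gl_within S X"
          unfolding mult_sl_fin by (rule gl_within_mult(1)[OF sl_supported_gl_within[OF TU(1)] sl_supported_gl_within[OF TU(2)]])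
      qed
    qed
  next
    fix T assume T: "T \<in> carrier ?SL"
    then obtain X where X: "finite X" "X \<subseteq> S" "T \<in> tv_group S X" unfolding mem_sl_fin by blast
    then have "T \<in> sl_supported S X" using sl_supportedI[OF T] tv_group_subset[OF X(2)] by blast
    then show "\<exists>X. finite X \<and> X \<subseteq> S \<and> T \<in> sl_supported S X" using X by blast
  next
    fix X Y :: "'a set" and T U :: "('a \<Rightarrow> 'f) \<Rightarrow> ('a \<Rightarrow> 'f)"
    assume "X \<inter> Y = {}" "T \<in> sl_supported S X" "U \<in> sl_supported S Y"
    then show "T \<otimes>\<^bsub>?SL\<^esub> U = U \<otimes>\<^bsub>?SL\<^esub> T" using sl_supported_commute by blast
  next
    fix p X and n :: "('a \<Rightarrow> 'f) \<Rightarrow> ('a \<Rightarrow> 'f)"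
    assume p: "p \<in> carrier (alt_fin S)" and n: "n \<in> sl_supported S X"
    show "perm_op S p \<otimes>\<^bsub>?SL\<^esub> n \<otimes>\<^bsub>?SL\<^esub> inv\<^bsub>?SL\<^esub> perm_op S p \<in> sl_supported S (p ` X)"
      by (rule sl_supported_conj_image[OF p n])
    show "perm_op S p \<otimes>\<^bsub>?SL\<^esub> n = n \<otimes>\<^bsub>?SL\<^esub> perm_op S p" if "\<And>x. x \<in> X \<Longrightarrow> p x = x"
      by (rule sl_supported_commute[OF perm_op_supported[OF p] n]) (use that in auto)
  qed
qed

text \<open>\<open>tv S z u\<close> is the commutator of \<open>tv S x u\<close> and \<open>tv S z e\<^sub>x\<close> for any \<open>x\<close> off the support
  of \<open>u\<close>.\<close>

lemma sl_fin_perfect: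
  fixes w :: "(('a \<Rightarrow> 'f::field) \<Rightarrow> ('a \<Rightarrow> 'f)) \<Rightarrow> complex"
  assumes S: "infinite S"
    and mult: "\<And>T U. T \<in> carrier (sl_fin S) \<Longrightarrow> U \<in> carrier (sl_fin S) \<Longrightarrow> w (T \<otimes>\<^bsub>sl_fin S\<^esub> U) = w T * w U"
    and one: "w \<one>\<^bsub>sl_fin S\<^esub> = 1" and n: "n \<in> carrier (sl_fin S)"
  shows "w n = 1"
proof -
  let ?SL = "sl_fin S :: (('a \<Rightarrow> 'f) \<Rightarrow> ('a \<Rightarrow> 'f)) monoid"
  interpret SL: group ?SL by (rule group_sl_fin)
  have nz: "w T \<noteq> 0" if "T \<in> carrier ?SL" for T
    using mult[OF that SL.inv_closed[OF that]] one that by auto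
  have tv1: "w (tv S z u) = 1"
    if X: "finite X" "X \<subseteq> S" and z: "z \<in> X" and u: "u \<in> free_space X" "u z = 0" for X z and u :: "'a \<Rightarrow> 'f"
  proof -
    have "infinite (S - X)" using S X by simp
    from infinite_imp_nonempty[OF this] obtain x where x: "x \<in> S" "x \<notin> X" by (meson DiffE ex_in_conv)
    have ux: "u x = 0" using free_space_outside[OF u(1) x(2)] .
    have xz: "x \<noteq> z" using x z by auto
    let ?X = "insert x X" and ?e = "basis_vector x :: 'a \<Rightarrow> 'f"
    have X': "finite ?X" "?X \<subseteq> S" using X x by auto
    have uX: "u \<in> free_space ?X" using u free_space_mono[of X ?X] by auto
    have e: "?e \<in> free_space ?X" "?e z = 0"
      by (rule free_space_basis, simp) (use xz in \<open>simp add: basis_vector_def\<close>)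
    have A: "tv S x u \<in> carrier ?SL" "tv S z u \<in> carrier ?SL" and B: "tv S z ?e \<in> carrier ?SL"
      using tv_in_tv_group[of _ ?X] z uX u ux e by (auto intro!: tv_group_sl_fin[OF X'])
    have tvV: "tv S y t v \<in> free_space S" if "tv S y t \<in> carrier ?SL" "v \<in> free_space S" for y t v
      using sl_finD(3)[OF that] .
    \<comment> \<open>The commutator relation is written without inverses, so applying
      \<open>w\<close> and cancelling its nonzero values gives the claim. The fresh coordinate
      \<open>x\<close> serves as an intermediate stop between \<open>z\<close> and
      \<open>u\<close>.\<close>
    have "tv S x u \<otimes>\<^bsub>?SL\<^esub> tv S z ?e = tv S z u \<otimes>\<^bsub>?SL\<^esub> (tv S z ?e \<otimes>\<^bsub>?SL\<^esub> tv S x u)"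
    proof (rule sl_fin_eqI)
      fix v :: "'a \<Rightarrow> 'f" assume v: "v \<in> free_space S"
      have BA: "tv S z ?e (tv S x u v) \<in> free_space S" by (rule tvV[OF B tvV[OF A(1) v]])
      have "tv S x u (tv S z ?e v) = tv S z u (tv S z ?e (tv S x u v))"
        using v tvV[OF B v] tvV[OF A(1) v] BA xz ux u(2)
        by (simp add: tv_def fun_eq_iff basis_vector_def algebra_simps)
      then show "(tv S x u \<otimes>\<^bsub>?SL\<^esub> tv S z ?e) v = (tv S z u \<otimes>\<^bsub>?SL\<^esub> (tv S z ?e \<otimes>\<^bsub>?SL\<^esub> tv S x u)) v"
        using sl_mult_apply[OF A(1) B v] sl_mult_apply[OF A(2) SL.m_closed[OF B A(1)] v] sl_mult_apply[OF B A(1) v]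
        by simp
    qed (use A B in auto)
    then have "w (tv S x u) * w (tv S z ?e) = w (tv S z u) * (w (tv S z ?e) * w (tv S x u))"
      using mult A B by (metis SL.m_closed)
    then show ?thesis using nz A B by (simp add: field_simps)
  qed
  obtain X where X: "finite X" "X \<subseteq> S" "n \<in> tv_group S X" using n unfolding mem_sl_fin by blast
  show ?thesis
    using X(3) unfolding tv_group_def
  proof (induction rule: generate.induct)
    case one
    then show ?case using \<open>w \<one>\<^bsub>?SL\<^esub> = 1\<close> by (simp add: one_sl_fin)
  next
    case (incl h)
    then show ?case using tv1[OF X(1,2)] by (auto simp: transvections_def)
  next
    case (inv h)
    then obtain z u where zu: "h = tv S z u" "z \<in> X" "u \<in> free_space X" "u z = 0"
      by (auto simp: transvections_def)
    have "(\<lambda>x. - u x) \<in> free_space X" using zu by (simp add: free_space_def)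
    then show ?case
      using tv1[OF X(1,2) zu(2), of "\<lambda>x. - u x"] zu tv_gl_within(2)[OF zu(2) X(2) zu(3,4)] by simp
  next
    case (eng h1 h2)
    then have "h1 \<in> carrier ?SL" "h2 \<in> carrier ?SL"
      using tv_group_sl_fin[OF X(1,2)] by (auto simp: tv_group_def)
    then show ?case using mult[of h1 h2] eng.IH by (simp add: mult_sl_fin)
  qed
qed

lemma no_linear_character_sl_fin:
  assumes "infinite S"
  shows "no_linear_character (sl_fin S :: (('a \<Rightarrow> 'f::field) \<Rightarrow> ('a \<Rightarrow> 'f)) monoid)"
proof (rule ccontr)
  assume "\<not> ?thesis"
  then obtain w n where "w \<one>\<^bsub>sl_fin S\<^esub> = (1 :: complex)"
    "\<forall>x\<in>carrier (sl_fin S). \<forall>y\<in>carrier (sl_fin S). w (x \<otimes>\<^bsub>sl_fin S\<^esub> y) = w x * w (y :: ('a \<Rightarrow> 'f) \<Rightarrow> ('a \<Rightarrow> 'f))"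
    "n \<in> carrier (sl_fin S)" "w n \<noteq> 1"
    unfolding no_linear_character_def by blast
  then show False using sl_fin_perfect[OF assms, of w n] by simp
qed

section \<open>The regular representation acting on the finitary special linear group\<close>

lemma left_regular_free_space:
  assumes "group G" and g: "g \<in> carrier G" and v: "v \<in> free_space (carrier G)"
  shows "left_regular G g v \<in> free_space (carrier G)"
proof -
  interpret G: group G by fact
  have "{x. left_regular G g v x \<noteq> 0} \<subseteq> (\<lambda>y. g \<otimes>\<^bsub>G\<^esub> y) ` {x. v x \<noteq> 0}"
  proof
    fix x assume "x \<in> {x. left_regular G g v x \<noteq> 0}"
    then have x: "x \<in> carrier G" "v (inv\<^bsub>G\<^esub> g \<otimes>\<^bsub>G\<^esub> x) \<noteq> 0" by (auto simp: left_regular_def split: if_splits)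
    moreover have "g \<otimes>\<^bsub>G\<^esub> (inv\<^bsub>G\<^esub> g \<otimes>\<^bsub>G\<^esub> x) = x" using x g by (simp add: G.m_assoc[symmetric])
    ultimately show "x \<in> (\<lambda>y. g \<otimes>\<^bsub>G\<^esub> y) ` {x. v x \<noteq> 0}" by (metis (mono_tags) imageI mem_Collect_eq)
  qed
  then have "finite {x. left_regular G g v x \<noteq> 0}"
    using v finite_subset by (fastforce simp: free_space_def)
  then show ?thesis by (auto simp: free_space_def left_regular_def split: if_splits)
qed

theorem enrichment_elementary:
  assumes G: "group G" and inf: "infinite (carrier G)"
  shows "enrichment G (sl_fin (carrier G) :: (('a \<Rightarrow> 'f::field) \<Rightarrow> ('a \<Rightarrow> 'f)) monoid)
    (sl_supported (carrier G)) (perm_op (carrier G))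
    (\<lambda>g T. restrict (left_regular G g \<circ> T \<circ> left_regular G (inv\<^bsub>G\<^esub> g)) (free_space (carrier G)))"
proof -
  interpret G: group G by fact
  let ?S = "carrier G"
  let ?SL = "sl_fin ?S :: (('a \<Rightarrow> 'f) \<Rightarrow> ('a \<Rightarrow> 'f)) monoid"
  let ?V = "free_space ?S :: ('a \<Rightarrow> 'f) set"
  interpret supported_group ?SL ?S "sl_supported ?S" "perm_op ?S"
    by (rule supported_group_sl_fin[OF inf])
  let ?l = "left_regular G :: 'a \<Rightarrow> ('a \<Rightarrow> 'f) \<Rightarrow> ('a \<Rightarrow> 'f)"
  let ?\<alpha> = "\<lambda>g T. restrict (?l g \<circ> T \<circ> ?l (inv\<^bsub>G\<^esub> g)) ?V"
  note lV = left_regular_free_space[OF G]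
  have l_mult: "?l (g \<otimes>\<^bsub>G\<^esub> h) v = ?l g (?l h v)" if "g \<in> ?S" "h \<in> ?S" for g h v
    using that by (auto simp: left_regular_def fun_eq_iff G.inv_mult_group G.m_assoc)
  have l_one: "?l \<one>\<^bsub>G\<^esub> v = v" if "v \<in> ?V" for v
    using that free_space_outside[OF that] by (auto simp: left_regular_def fun_eq_iff)
  have ad_eq: "?\<alpha> g n = perm_op ?S p \<otimes>\<^bsub>?SL\<^esub> n \<otimes>\<^bsub>?SL\<^esub> inv\<^bsub>?SL\<^esub> perm_op ?S p"
    if g: "g \<in> ?S" and X: "finite X" "X \<subseteq> ?S" "n \<in> sl_supported ?S X" and p: "p \<in> carrier (alt_fin ?S)"
      and px: "\<And>x. x \<in> X \<Longrightarrow> p x = g \<otimes>\<^bsub>G\<^esub> x" for g X n p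
  proof (rule extensionalityI[of _ ?V])
    have nc: "n \<in> carrier ?SL" by (rule L_closed[OF X])
    have "perm_op ?S p \<in> carrier ?SL" by (rule perm_op_sl_fin[OF p])
    then have "perm_op ?S p \<otimes>\<^bsub>?SL\<^esub> n \<otimes>\<^bsub>?SL\<^esub> inv\<^bsub>?SL\<^esub> perm_op ?S p \<in> carrier ?SL" using nc by simp
    then show "perm_op ?S p \<otimes>\<^bsub>?SL\<^esub> n \<otimes>\<^bsub>?SL\<^esub> inv\<^bsub>?SL\<^esub> perm_op ?S p \<in> extensional ?V" by (rule sl_finD(4))
    show "?\<alpha> g n \<in> extensional ?V" by simp
    note n' = gl_withinD[OF sl_supported_gl_within[OF X(3)]]
    note pq = alt_fin_inv_apply[OF p]
    fix v assume v: "v \<in> ?V"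
    \<comment> \<open>The translated vector and the one permuted by \<open>p\<close> may differ, but
      not on \<open>X\<close>. The displacement by \<open>n\<close> depends only on coordinates in
      \<open>X\<close> and is supported on \<open>X\<close>, where translating back and permuting
      back also agree.\<close>
    define w1 where "w1 = ?l (inv\<^bsub>G\<^esub> g) v"
    define w2 where "w2 = v \<circ> p"
    have w1: "w1 \<in> ?V" unfolding w1_def by (rule lV[OF G.inv_closed[OF g] v])
    have w2: "w2 \<in> ?V" unfolding w2_def by (rule alt_comp_free_space[OF p v])
    have w12: "w1 x = w2 x" if "x \<in> X" for x
    proof -
      have "x \<in> ?S" using that X(2) by blast
      then show ?thesis using px[OF that] g by (simp add: w1_def w2_def left_regular_def)
    qed
    have nd: "n w1 x = w1 x + (n w2 x - w2 x)" for x
      using acts_within_diff[OF n'(2,3) w1 w2 w12, of x] by (simp add: algebra_simps)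
    have d0: "n w2 x - w2 x = 0" if "x \<notin> X" for x
      using acts_withinD(1)[OF n'(3) w2 that] by simp
    have "?l g (n w1) s = n w2 (inv_into UNIV p s)" for s
    proof (cases "s \<in> ?S")
      case True
      have gs: "g \<otimes>\<^bsub>G\<^esub> (inv\<^bsub>G\<^esub> g \<otimes>\<^bsub>G\<^esub> s) = s" using True g by (simp add: G.m_assoc[symmetric])
      have w1s: "w1 (inv\<^bsub>G\<^esub> g \<otimes>\<^bsub>G\<^esub> s) = v s" using True g gs by (simp add: w1_def left_regular_def)
      have w2s: "w2 (inv_into UNIV p s) = v s" using pq(2) by (simp add: w2_def)
      have "n w2 (inv\<^bsub>G\<^esub> g \<otimes>\<^bsub>G\<^esub> s) - w2 (inv\<^bsub>G\<^esub> g \<otimes>\<^bsub>G\<^esub> s) = n w2 (inv_into UNIV p s) - w2 (inv_into UNIV p s)"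
      proof (cases "inv\<^bsub>G\<^esub> g \<otimes>\<^bsub>G\<^esub> s \<in> X")
        case True
        then have "p (inv\<^bsub>G\<^esub> g \<otimes>\<^bsub>G\<^esub> s) = s" using px gs by simp
        then have "inv_into UNIV p s = inv\<^bsub>G\<^esub> g \<otimes>\<^bsub>G\<^esub> s" using pq(1) by metis
        then show ?thesis by simp
      next
        case False
        have "inv_into UNIV p s \<notin> X"
        proof
          assume i: "inv_into UNIV p s \<in> X"
          then have "s = g \<otimes>\<^bsub>G\<^esub> inv_into UNIV p s" using px[OF i] pq(2) by simp
          then have "inv\<^bsub>G\<^esub> g \<otimes>\<^bsub>G\<^esub> s = inv\<^bsub>G\<^esub> g \<otimes>\<^bsub>G\<^esub> (g \<otimes>\<^bsub>G\<^esub> inv_into UNIV p s)" by simp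
          also have "\<dots> = inv_into UNIV p s"
          proof -
            have "inv_into UNIV p s \<in> ?S" using i X(2) by blast
            then show ?thesis using g by (simp add: G.m_assoc[symmetric])
          qed
          finally show False using i False by simp
        qed
        then show ?thesis using d0 False by simp
      qed
      then show ?thesis using True nd[of "inv\<^bsub>G\<^esub> g \<otimes>\<^bsub>G\<^esub> s"] w1s w2s by (simp add: left_regular_def algebra_simps)
    next
      case False
      then have "inv_into UNIV p s = s"
        using pq(1)[of s] p permutes_not_in[of p ?S s] by (simp add: mem_alt_fin)
      then show ?thesis using False free_space_outside[OF n'(4)[OF w2] False] by (simp add: left_regular_def)
    qed
    then show "?\<alpha> g n v = (perm_op ?S p \<otimes>\<^bsub>?SL\<^esub> n \<otimes>\<^bsub>?SL\<^esub> inv\<^bsub>?SL\<^esub> perm_op ?S p) v"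
      unfolding perm_op_conj_apply[OF p nc v] using v by (simp add: w1_def w2_def fun_eq_iff)
  qed
  have ex_q: "\<exists>q\<in>carrier (alt_fin ?S). \<forall>x\<in>X. q x = g \<otimes>\<^bsub>G\<^esub> x" if g: "g \<in> ?S" and X: "finite X" "X \<subseteq> ?S" for g X
  proof (rule ex_alt_fin_extending[OF inf X])
    show "inj_on (\<lambda>x. g \<otimes>\<^bsub>G\<^esub> x) X" using X(2) g by (auto simp: inj_on_def subset_iff)
    show "(\<lambda>x. g \<otimes>\<^bsub>G\<^esub> x) ` X \<subseteq> ?S" using X(2) g by auto
  qed
  show ?thesis
  proof
    fix g assume g: "g \<in> ?S"
    show "?\<alpha> g \<in> hom ?SL ?SL"
    proof (rule homI)
      fix n assume n: "n \<in> carrier ?SL"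
      obtain X where X: "finite X" "X \<subseteq> ?S" "n \<in> sl_supported ?S X" using L_cover[OF n] by blast
      obtain q where q: "q \<in> carrier (alt_fin ?S)" "\<forall>x\<in>X. q x = g \<otimes>\<^bsub>G\<^esub> x" using ex_q[OF g X(1,2)] by blast
      have "?\<alpha> g n = ad q n" unfolding ad_def using ad_eq[OF g X q(1)] q(2) by blast
      then show "?\<alpha> g n \<in> carrier ?SL" using ad_closed[OF q(1) n] by simp
    next
      fix n m assume n: "n \<in> carrier ?SL" and m: "m \<in> carrier ?SL"
      \<comment> \<open>A common support of \<open>n\<close> and \<open>m\<close> also supports
        their product, so a single permutation realises the action on all three and multiplicativity
        is that of conjugation.\<close>
      obtain X where X: "finite X" "X \<subseteq> ?S" "{n, m} \<subseteq> sl_supported ?S X"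
        by (rule ex_common_support[of "{n, m}"]) (use n m in auto)
      obtain q where q: "q \<in> carrier (alt_fin ?S)" "\<forall>x\<in>X. q x = g \<otimes>\<^bsub>G\<^esub> x" using ex_q[OF g X(1,2)] by blast
      have ad': "?\<alpha> g k = ad q k" if "k \<in> sl_supported ?S X" for k
        unfolding ad_def using ad_eq[OF g X(1,2) that q(1)] q(2) by blast
      have "n \<otimes>\<^bsub>?SL\<^esub> m \<in> sl_supported ?S X"
        using subgroup.m_closed[OF L_subgroup[OF X(1,2)]] X(3) by blast
      then have "?\<alpha> g (n \<otimes>\<^bsub>?SL\<^esub> m) = ad q (n \<otimes>\<^bsub>?SL\<^esub> m)" by (rule ad')
      also have "\<dots> = ad q n \<otimes>\<^bsub>?SL\<^esub> ad q m" by (rule ad_mult[OF q(1) n m])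
      also have "\<dots> = ?\<alpha> g n \<otimes>\<^bsub>?SL\<^esub> ?\<alpha> g m" using ad'[of n] ad'[of m] X(3) by simp
      finally show "?\<alpha> g (n \<otimes>\<^bsub>?SL\<^esub> m) = ?\<alpha> g n \<otimes>\<^bsub>?SL\<^esub> ?\<alpha> g m" .
    qed
  next
    fix g h and n :: "('a \<Rightarrow> 'f) \<Rightarrow> ('a \<Rightarrow> 'f)" assume gh: "g \<in> ?S" "h \<in> ?S"
    show "?\<alpha> (g \<otimes>\<^bsub>G\<^esub> h) n = ?\<alpha> g (?\<alpha> h n)"
    proof (rule extensionalityI[of _ ?V])
      fix v assume v: "v \<in> ?V"
      then show "?\<alpha> (g \<otimes>\<^bsub>G\<^esub> h) n v = ?\<alpha> g (?\<alpha> h n) v"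
        using gh lV[OF G.inv_closed[OF gh(1)] v] by (simp add: l_mult G.inv_mult_group)
    qed simp_all
  next
    fix n assume n: "n \<in> carrier ?SL"
    show "?\<alpha> \<one>\<^bsub>G\<^esub> n = n"
    proof (rule extensionalityI[of _ ?V])
      show "?\<alpha> \<one>\<^bsub>G\<^esub> n v = n v" if "v \<in> ?V" for v
        using that l_one[OF that] l_one[OF sl_finD(3)[OF n that]] by simp
    qed (use sl_finD(4)[OF n] in simp_all)
  next
    fix g X p and n :: "('a \<Rightarrow> 'f) \<Rightarrow> ('a \<Rightarrow> 'f)"
    assume "g \<in> ?S" "finite X" "X \<subseteq> ?S" "n \<in> sl_supported ?S X" "p \<in> carrier (alt_fin ?S)"
      "\<And>x. x \<in> X \<Longrightarrow> p x = g \<otimes>\<^bsub>G\<^esub> x"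
    then show "?\<alpha> g n = perm_op ?S p \<otimes>\<^bsub>?SL\<^esub> n \<otimes>\<^bsub>?SL\<^esub> inv\<^bsub>?SL\<^esub> perm_op ?S p" by (rule ad_eq)
  next
    show "no_linear_character ?SL" by (rule no_linear_character_sl_fin[OF inf])
  qed
qed

theorem theorem1p8:
  fixes G :: "('a, 'm) monoid_scheme"
    and A :: "('a \<times> ('a \<Rightarrow> 'a)) monoid"
    and Alt :: "('a \<Rightarrow> 'a) monoid"
    and E :: "('a \<times> (('a \<Rightarrow> 'f::{field,finite}) \<Rightarrow> ('a \<Rightarrow> 'f))) monoid"
    and SL :: "(('a \<Rightarrow> 'f) \<Rightarrow> ('a \<Rightarrow> 'f)) monoid"
  defines "A \<equiv> alternating_enrichment G" and "Alt \<equiv> alt_fin (carrier G)"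
    and "E \<equiv> elementary_enrichment G" and "SL \<equiv> sl_fin (carrier G)"
  assumes "group G" and "countable (carrier G)" and "infinite (carrier G)"
  shows "(icc G \<longrightarrow>
        character_space A homeomorphic_space
          identify_points (disjoint_union_topology (character_space G) (character_space Alt))
            (Inl (delta_one G)) (Inr (const_one Alt)) \<and>
        character_space E homeomorphic_space
          identify_points (disjoint_union_topology (character_space G) (character_space SL))
            (Inl (delta_one G)) (Inr (const_one SL))) \<and>
      (\<not> icc G \<longrightarrow>
        character_space A homeomorphic_space
          disjoint_union_topology (character_space G)
            (subtopology (character_space Alt) (characters Alt - {const_one Alt})) \<and>
        character_space E homeomorphic_space
          disjoint_union_topology (character_space G)
            (subtopology (character_space SL) (characters SL - {const_one SL})))"
proof -
  interpret A: enrichment G Alt "alt_supported (carrier G)" "\<lambda>p. p"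
    "\<lambda>g p. left_mult G g \<circ> p \<circ> left_mult G (inv\<^bsub>G\<^esub> g)"
    unfolding Alt_def by (rule enrichment_alternating) fact+
  interpret E: enrichment G SL "sl_supported (carrier G)" "perm_op (carrier G)"
    "\<lambda>g T. restrict (left_regular G g \<circ> T \<circ> left_regular G (inv\<^bsub>G\<^esub> g)) (free_space (carrier G))"
    unfolding SL_def by (rule enrichment_elementary) fact+
  show ?thesis
    using A.character_space_icc A.character_space_not_icc E.character_space_icc E.character_space_not_icc
    unfolding A_def E_def alternating_enrichment_def elementary_enrichment_def Alt_def SL_def
    by blast
qed

end
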